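(* Let $n,m\ge 1$ be integers. The crystal $[\mathscr C_m]$, with the maps $(wt,\tilde e_{i,m},\tilde f_{i,m},\varepsilon_{i,m},\varphi_{i,m})_{1\le i\le n}$, of isomorphism classes of irreducible finite-dimensional modules over the $n$-colored planar rook algebra $\mathbb CP_m$ is isomorphic, as a $gl_{n+1}(\mathbb C)$-crystal, to $B(m\epsilon_1)$, the crystal basis of the irreducible polynomial $U_q(gl_{n+1})$-module $V(m\epsilon_1)$ of highest weight $m\epsilon_1$.
   Context: Algebra. Fix $n\ge1$. In the ring $\mathbb Z_2^n$ (componentwise operations) let $u_i$ be the element with $i$-th component $1$ and other components $0$. For $m\ge1$, $P_m$ is the set of $m\times m$ matrices over $\mathbb Z_2^n$ with entries in $\{0,u_1,\dots,u_n\}$ such that (a) each row and each column has at most one nonzero entry; (b) for no $1\le i\le n$ is there a $2\times2$ submatrix $\begin{pmatrix}0 & u_i \\ u_i & 0\end{pmatrix}$. $P_m$ is a semigroup under matrix multiplication; $\mathbb CP_m$ is its semigroup algebra over $\mathbb C$. For $d_1\in P_{m_1},d_2\in P_{m_2}$, $d_1\otimes d_2\in P_{m_1+m_2}$ is the block diagonal matrix with blocks $d_1,d_2$; this extends bilinearly to an embedding $\mathbb CP_{m_1}\otimes\mathbb CP_{m_2}\to\mathbb CP_{m_1+m_2}$. Let $I_i=(u_i)$ ($1\le i\le n$) and $I_0=(0)$ in $P_1$, $e_1=\sum_{i=1}^nI_i-(n-1)I_0$; the identity of $\mathbb CP_m$ is $e_m=e_1^{\otimes m}$. For $d\in P_m$,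 $size(d)$ is the number of nonzero entries; $d'\subseteq d$ means $d'$ is obtained from $d$ by replacing some nonzero entries by $0$; $x_d=\sum_{d'\subseteq d}(-1)^{size(d)-size(d')}d'$. The $x_d$ form a basis of $\mathbb CP_m$. For $1\le k\le n$, $\beta_k(d)$ is the set of $j$ such that column $j$ of $d$ contains $u_k$, and $\beta_0(d)$ is the set of indices of zero columns; $\beta(d)=(\beta_0(d),\dots,\beta_n(d))$. Let $X_m$ be the set of $(n+1)$-tuples $T=(T_0,\dots,T_n)$ of pairwise disjoint, possibly empty, sets with union $\{1,\dots,m\}$. For $T\in X_m$, $W^m_T=\mathrm{span}_{\mathbb C}\{x_d: d\in P_m,\ \beta(d)=T\}$, a left $\mathbb CP_m$-module. Modules are left and unital. It is known that $\mathbb CP_m$ is semisimple, the $W^m_T$ are irreducible and exhaust the irreducibles up to isomorphism, and $W^m_T\cong W^m_{T'}$ iff $|T_i|=|T'_i|$ for all $0\le i\le n$. $W^m_{m_0,\dots,m_n}$ denotes $W^m_T$ for the $T$ consisting of consecutive intervals of sizes $m_0,\dots,m_n$ (in this order), where $\sum m_i=m$. Functors. $\mathscr C_m$ is the category of finite-dimensional $\mathbb CP_m$-modules and $[\mathscr C_m]=\{[W^m_{m_0,\dots,m_n}]: m_i\ge0,\ \sum m_i=m\}$ is the set of isomorphism classes of its irreducible objects. For $m\ge2$ let $\psi_{i,m}:\mathbb CP_{m-1}\to\mathbb CP_m$ be the (non-unital) algebra embedding $x\mapsto x\otimes(I_i-I_0)$ for $1\le i\le n$, and $x\mapsto x\otimes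 I_0$ for $i=0$. Then $Res_{i,m}:\mathscr C_m\to\mathscr C_{m-1}$ is $Res_{i,m}(M)=\psi_{i,m}(e_{m-1})M$ with $x\in\mathbb CP_{m-1}$ acting as $\psi_{i,m}(x)$, and $Ind_{i,m}:\mathscr C_{m-1}\to\mathscr C_m$ is $Ind_{i,m}(M)=\mathbb CP_m\otimes_{\mathbb CP_{m-1}}M$, where $\mathbb CP_{m-1}$ acts on $\mathbb CP_m$ on the right through $\psi_{i,m}$. For $1\le i\le n$, $m\ge1$: $\tilde{\mathscr E}_{i,m}=Res_{i,m+1}\circ Ind_{i-1,m+1}$, $\tilde{\mathscr F}_{i,m}=Res_{i-1,m+1}\circ Ind_{i,m+1}$, and $\tilde e_{i,m},\tilde f_{i,m}:[\mathscr C_m]\to[\mathscr C_m]\cup\{0\}$ are the maps they induce on isomorphism classes ($0$ meaning the zero module). Moreover $wt([W^m_{m_0,\dots,m_n}])=\sum_{j=0}^nm_j\epsilon_{j+1}$, $\varepsilon_{i,m}([W^m_{m_0,\dots,m_n}])=m_i$, $\varphi_{i,m}([W^m_{m_0,\dots,m_n}])=m_{i-1}$. Crystals. $\mathfrak h$ is the diagonal Cartan subalgebra of $gl_{n+1}(\mathbb C)$, $\epsilon_i(E_{jj})=\delta_{ij}$, $P=\bigoplus_{i=1}^{n+1}\mathbb Z\epsilon_i$. A $gl_{n+1}(\mathbb C)$-crystal is a set $B$ with maps $wt:B\to P$, $\varepsilon_i,\varphi_i:B\to\mathbb Z\cup\{-\infty\}$, $\tilde e_i,\tilde f_i:B\to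 B\cup\{0\}$ ($1\le i\le n$) such that: (a) $\varphi_i(b)=\varepsilon_i(b)+wt(b)(E_{ii}-E_{i+1,i+1})$; (b) $wt(\tilde e_ib)=wt(b)+\epsilon_i-\epsilon_{i+1}$ if $\tilde e_ib\in B$, and $wt(\tilde f_ib)=wt(b)-\epsilon_i+\epsilon_{i+1}$ if $\tilde f_ib\in B$; (c) for $b_1,b_2\in B$, $\tilde f_ib_2=b_1$ iff $\tilde e_ib_1=b_2$; (d) if $\varepsilon_i(b)=-\infty$ then $\tilde e_ib=\tilde f_ib=0$. An isomorphism of crystals is a bijection commuting with all these maps (with $0\mapsto0$). Tensor product: $B_1\otimes B_2=\{b_1\otimes b_2\}$ with $\tilde e_i(b_1\otimes b_2)=\tilde e_ib_1\otimes b_2$ if $\varphi_i(b_1)\ge\varepsilon_i(b_2)$ and $b_1\otimes\tilde e_ib_2$ otherwise; $\tilde f_i(b_1\otimes b_2)=\tilde f_ib_1\otimes b_2$ if $\varphi_i(b_1)>\varepsilon_i(b_2)$ and $b_1\otimes\tilde f_ib_2$ otherwise; $wt(b_1\otimes b_2)=wt(b_1)+wt(b_2)$; $\varepsilon_i(b_1\otimes b_2)=\max\{\varepsilon_i(b_1),\varepsilon_i(b_2)-wt(b_1)(E_{ii}-E_{i+1,i+1})\}$; $\varphi_i(b_1\otimes b_2)=\max\{\varphi_i(b_2),\varphi_i(b_1)+wt(b_2)(E_{ii}-E_{i+1,i+1})\}$ (and $b\otimes0=0\otimes b=0$). $B(\epsilon_1)$ is the set of boxes filled with $j\in\{0,1,\dots,n\}$,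 with $wt(j)=\epsilon_{j+1}$, $\varepsilon_i(j)=\delta_{i,j}$, $\varphi_i(j)=\delta_{i,j+1}$, $\tilde f_i(i-1)=i$, $\tilde e_i(i)=i-1$, all other values of $\tilde e_i,\tilde f_i$ being $0$. $B(\lambda)$ is realized on semistandard Young tableaux of shape $\lambda$ with entries in $\{0,\dots,n\}$, its crystal structure being induced from $B(\epsilon_1)^{\otimes|\lambda|}$ via the Middle-Eastern reading (a tableau is sent to the tensor product of its boxes read right to left in each row, rows from top to bottom). For $\lambda=m\epsilon_1$ the shape is one row of $m$ boxes. *)

theory Defs
  imports
    "HOL-Library.Z2"
    "HOL-Library.Function_Algebras"
    "HOL-Library.Extended"
    "HOL-Algebra.AbelCoset"
    "HOL-Algebra.Generated_Groups"
    "HOL-Algebra.Free_Abelian_Groups"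
    "Jordan_Normal_Form.Matrix"
begin

section \<open>The colored planar rook algebra\<close>

text \<open>
  The ring \<open>\<int>\<^sub>2\<^sup>n\<close> is realised as the functions \<open>nat \<Rightarrow> bit\<close> supported on \<open>{1..n}\<close>, with
  componentwise operations; all entries used below lie in \<open>{0, u\<^sub>1, \<dots>, u\<^sub>n}\<close>.  Rows and columns
  of matrices are numbered from \<open>0\<close>.
\<close>

definition u_elt :: "nat \<Rightarrow> nat \<Rightarrow> bit" where
  "u_elt i = (\<lambda>j. if j = i then 1 else 0)"

type_synonym rook = "(nat \<Rightarrow> bit) mat"

definition planar_rook :: "nat \<Rightarrow> nat \<Rightarrow> rook set" where
  "planar_rook n m = {d \<in> carrier_mat m m.
     (\<forall>r<m. \<forall>c<m. d $$ (r, c) \<in> insert 0 (u_elt ` {1..n})) \<and>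
     (\<forall>r<m. \<forall>c<m. \<forall>c'<m. d $$ (r, c) \<noteq> 0 \<and> d $$ (r, c') \<noteq> 0 \<longrightarrow> c = c') \<and>
     (\<forall>c<m. \<forall>r<m. \<forall>r'<m. d $$ (r, c) \<noteq> 0 \<and> d $$ (r', c) \<noteq> 0 \<longrightarrow> r = r') \<and>
     \<not> (\<exists>i\<in>{1..n}. \<exists>r r' c c'. r < r' \<and> r' < m \<and> c < c' \<and> c' < m \<and>
          d $$ (r, c) = 0 \<and> d $$ (r, c') = u_elt i \<and>
          d $$ (r', c) = u_elt i \<and> d $$ (r', c') = 0)}"

text \<open>
  An element of \<open>\<complex>P\<^sub>m\<close> is its coefficient function, vanishing off \<open>P\<^sub>m\<close>.
\<close>

type_synonym rook_alg = "rook \<Rightarrow> complex"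

definition basis_elt :: "rook \<Rightarrow> rook_alg" where
  "basis_elt d = (\<lambda>d'. if d' = d then 1 else 0)"

text \<open>The bilinear extension of \<open>(d\<^sub>1, d\<^sub>2) \<mapsto> diag(d\<^sub>1, d\<^sub>2)\<close> to \<open>\<complex>P\<^sub>k \<times> \<complex>P\<^sub>l \<rightarrow> \<complex>P\<^sub>k\<^sub>+\<^sub>l\<close>.\<close>

definition alg_tensor :: "nat \<Rightarrow> nat \<Rightarrow> nat \<Rightarrow> rook_alg \<Rightarrow> rook_alg \<Rightarrow> rook_alg" where
  "alg_tensor n k l x y = (\<lambda>d. \<Sum>(d1, d2) \<in> {(d1, d2) \<in> planar_rook n k \<times> planar_rook n l.
     diag_block_mat [d1, d2] = d}. x d1 * y d2)"

definition I_elt :: "nat \<Rightarrow> rook_alg" where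
  "I_elt i = basis_elt (mat 1 1 (\<lambda>_. if i = 0 then 0 else u_elt i))"

definition e1_elt :: "nat \<Rightarrow> rook_alg" where
  "e1_elt n = (\<lambda>d. (\<Sum>i = 1..n. I_elt i d) - (of_nat n - 1) * I_elt 0 d)"

primrec e_elt :: "nat \<Rightarrow> nat \<Rightarrow> rook_alg" where
  "e_elt n 0 = basis_elt (0\<^sub>m 0 0)"
| "e_elt n (Suc m) = alg_tensor n m 1 (e_elt n m) (e1_elt n)"

definition CP :: "nat \<Rightarrow> nat \<Rightarrow> rook_alg ring" where
  "CP n m = \<lparr>carrier = {x. \<forall>d. d \<notin> planar_rook n m \<longrightarrow> x d = 0},
     monoid.mult = (\<lambda>x y d. \<Sum>(d1, d2) \<in> {(d1, d2) \<in> planar_rook n m \<times> planar_rook n m. d1 * d2 = d}.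
       x d1 * y d2),
     one = e_elt n m,
     ring.zero = 0,
     add = (+)\<rparr>"

definition rook_size :: "rook \<Rightarrow> nat" where
  "rook_size d = card {(r, c). r < dim_row d \<and> c < dim_col d \<and> d $$ (r, c) \<noteq> 0}"

definition sub_rooks :: "rook \<Rightarrow> rook set" where
  "sub_rooks d = {d' \<in> carrier_mat (dim_row d) (dim_col d).
     \<forall>r < dim_row d. \<forall>c < dim_col d. d' $$ (r, c) = d $$ (r, c) \<or> d' $$ (r, c) = 0}"

definition x_elt :: "rook \<Rightarrow> rook_alg" where
  "x_elt d = (\<lambda>b. \<Sum>d' \<in> sub_rooks d. (-1) ^ (rook_size d - rook_size d') * basis_elt d' b)"

definition col_set :: "nat \<Rightarrow> rook \<Rightarrow> nat set" where
  "col_set k d = (if k = 0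
     then {j. j < dim_col d \<and> (\<forall>r < dim_row d. d $$ (r, j) = 0)}
     else {j. j < dim_col d \<and> (\<exists>r < dim_row d. d $$ (r, j) = u_elt k)})"


section \<open>Modules\<close>

text \<open>
  The library locale \<open>module\<close> requires a commutative ring of scalars.  As there, the fields
  \<open>mult\<close> and \<open>one\<close> of the module record carry no meaning.
\<close>

locale left_module = R?: ring R + M?: abelian_group M for R (structure) and M (structure) +
  assumes smult_closed:
      "\<lbrakk>a \<in> carrier R; x \<in> carrier M\<rbrakk> \<Longrightarrow> a \<odot>\<^bsub>M\<^esub> x \<in> carrier M"
    and smult_l_distr:
      "\<lbrakk>a \<in> carrier R; b \<in> carrier R; x \<in> carrier M\<rbrakk> \<Longrightarrow>
        (a \<oplus> b) \<odot>\<^bsub>M\<^esub> x = a \<odot>\<^bsub>M\<^esub> x \<oplus>\<^bsub>M\<^esub> b \<odot>\<^bsub>M\<^esub> x"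
    and smult_r_distr:
      "\<lbrakk>a \<in> carrier R; x \<in> carrier M; y \<in> carrier M\<rbrakk> \<Longrightarrow>
        a \<odot>\<^bsub>M\<^esub> (x \<oplus>\<^bsub>M\<^esub> y) = a \<odot>\<^bsub>M\<^esub> x \<oplus>\<^bsub>M\<^esub> a \<odot>\<^bsub>M\<^esub> y"
    and smult_assoc:
      "\<lbrakk>a \<in> carrier R; b \<in> carrier R; x \<in> carrier M\<rbrakk> \<Longrightarrow>
        (a \<otimes> b) \<odot>\<^bsub>M\<^esub> x = a \<odot>\<^bsub>M\<^esub> (b \<odot>\<^bsub>M\<^esub> x)"
    and smult_one:
      "x \<in> carrier M \<Longrightarrow> \<one> \<odot>\<^bsub>M\<^esub> x = x"

definition irreducible_module :: "('a, 'r) ring_scheme \<Rightarrow> ('a, 'v, 's) module_scheme \<Rightarrow> bool" where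
  "irreducible_module R M \<longleftrightarrow> left_module R M \<and> carrier M \<noteq> {\<zero>\<^bsub>M\<^esub>} \<and>
     (\<forall>H. submodule H R M \<longrightarrow> H = {\<zero>\<^bsub>M\<^esub>} \<or> H = carrier M)"

definition modules_isomorphic ::
  "('a, 'r) ring_scheme \<Rightarrow> ('a, 'v, 's) module_scheme \<Rightarrow> ('a, 'w, 't) module_scheme \<Rightarrow> bool" where
  "modules_isomorphic R M N \<longleftrightarrow> (\<exists>f \<in> iso (add_monoid M) (add_monoid N).
     \<forall>a \<in> carrier R. \<forall>v \<in> carrier M. f (a \<odot>\<^bsub>M\<^esub> v) = a \<odot>\<^bsub>N\<^esub> f v)"

text \<open>
  A unital \<open>\<complex>P\<^sub>m\<close>-module is a complex vector space via \<open>c v = (c e\<^sub>m) v\<close>, and module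
  homomorphisms are automatically linear.
\<close>

definition findim_module :: "nat \<Rightarrow> nat \<Rightarrow> (rook_alg, 'v, 's) module_scheme \<Rightarrow> bool" where
  "findim_module n m M \<longleftrightarrow> left_module (CP n m) M \<and>
     (\<exists>S. finite S \<and> S \<subseteq> carrier M \<and>
       (\<forall>v \<in> carrier M. \<exists>a :: 'v \<Rightarrow> complex.
          v = finsum M (\<lambda>s. (\<lambda>d. a s * e_elt n m d) \<odot>\<^bsub>M\<^esub> s) S))"

text \<open>
  Isomorphism classes are taken among modules with carrier in the infinite-dimensional
  complex space \<open>rook_alg\<close>, which contains a copy of every finite-dimensional module.  The
  representative \<open>M\<close> itself may live on any type.
\<close>

type_synonym rook_module = "(rook_alg, rook_alg) module"

definition iso_class ::
  "nat \<Rightarrow> nat \<Rightarrow> (rook_alg, 'v, 's) module_scheme \<Rightarrow> rook_module set" where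
  "iso_class n m M = {N. findim_module n m N \<and> modules_isomorphic (CP n m) M N}"

definition simple_classes :: "nat \<Rightarrow> nat \<Rightarrow> rook_module set set" where
  "simple_classes n m =
     {iso_class n m M | M :: rook_module. findim_module n m M \<and> irreducible_module (CP n m) M}"

definition W_module :: "nat \<Rightarrow> nat \<Rightarrow> (nat \<Rightarrow> nat set) \<Rightarrow> rook_module" where
  "W_module n m T = \<lparr>
     carrier = {w. \<exists>a :: rook \<Rightarrow> complex.
       w = (\<lambda>b. \<Sum>d \<in> {d \<in> planar_rook n m. \<forall>k\<le>n. col_set k d = T k}. a d * x_elt d b)},
     monoid.mult = monoid.mult (CP n m), one = monoid.one (CP n m), ring.zero = 0, add = (+),
     smult = monoid.mult (CP n m)\<rparr>"

text \<open>\<open>W\<^sup>m\<close> with indices \<open>m\<^sub>0, \<dots>, m\<^sub>n\<close>, where \<open>m\<^sub>k = \<mu> k\<close>.\<close>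

definition W_std :: "nat \<Rightarrow> nat \<Rightarrow> (nat \<Rightarrow> nat) \<Rightarrow> rook_module" where
  "W_std n m \<mu> = W_module n m (\<lambda>k. {(\<Sum>j<k. \<mu> j) ..< (\<Sum>j\<le>k. \<mu> j)})"


section \<open>Restriction and induction\<close>

text \<open>
  \<open>psi n i m : \<complex>P\<^sub>m\<^sub>-\<^sub>1 \<rightarrow> \<complex>P\<^sub>m\<close>, for \<open>m \<ge> 2\<close>.
\<close>

definition psi :: "nat \<Rightarrow> nat \<Rightarrow> nat \<Rightarrow> rook_alg \<Rightarrow> rook_alg" where
  "psi n i m x = alg_tensor n (m - 1) 1 x (if i = 0 then I_elt 0 else I_elt i - I_elt 0)"

definition Res ::
  "nat \<Rightarrow> nat \<Rightarrow> nat \<Rightarrow> (rook_alg, 'v) module \<Rightarrow> (rook_alg, 'v) module" where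
  "Res n i m M = M\<lparr>
     carrier := (\<lambda>v. psi n i m (e_elt n (m - 1)) \<odot>\<^bsub>M\<^esub> v) ` carrier M,
     smult := (\<lambda>x v. psi n i m x \<odot>\<^bsub>M\<^esub> v)\<rparr>"

text \<open>
  \<open>A \<otimes>\<^sub>R M\<close>, where \<open>R\<close> acts on \<open>A\<close> from the right through a ring map \<open>f : R \<rightarrow> A\<close> that need
  not be unital: the free abelian group on \<open>A \<times> M\<close> modulo the biadditivity and balancing
  relations, with \<open>A\<close> acting on the left factor.  For algebras and a linear map \<open>f\<close>, with \<open>M\<close>
  unital, this agrees with the tensor product formed over the ground field, since
  \<open>(c a) \<otimes> v = (c a) \<otimes> 1 v = a f(c 1) \<otimes> v = a \<otimes> c v\<close>.
\<close>

definition tensor_relations ::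
  "('r, 'p) ring_scheme \<Rightarrow> ('a, 'q) ring_scheme \<Rightarrow> ('r \<Rightarrow> 'a) \<Rightarrow> ('r, 'v, 's) module_scheme
    \<Rightarrow> (('a \<times> 'v) \<Rightarrow>\<^sub>0 int) set" where
  "tensor_relations R A f M =
     {frag_of (a \<oplus>\<^bsub>A\<^esub> b, v) - frag_of (a, v) - frag_of (b, v) | a b v.
        a \<in> carrier A \<and> b \<in> carrier A \<and> v \<in> carrier M} \<union>
     {frag_of (a, v \<oplus>\<^bsub>M\<^esub> w) - frag_of (a, v) - frag_of (a, w) | a v w.
        a \<in> carrier A \<and> v \<in> carrier M \<and> w \<in> carrier M} \<union>
     {frag_of (a \<otimes>\<^bsub>A\<^esub> f r, v) - frag_of (a, r \<odot>\<^bsub>M\<^esub> v) | a r v.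
        a \<in> carrier A \<and> r \<in> carrier R \<and> v \<in> carrier M}"

definition extend_scalars ::
  "('r, 'p) ring_scheme \<Rightarrow> ('a, 'q) ring_scheme \<Rightarrow> ('r \<Rightarrow> 'a) \<Rightarrow> ('r, 'v, 's) module_scheme
    \<Rightarrow> ('a, (('a \<times> 'v) \<Rightarrow>\<^sub>0 int) set) module" where
  "extend_scalars R A f M =
     (let G = free_Abelian_group (carrier A \<times> carrier M);
          H = generate G (tensor_relations R A f M);
          Q = G Mod H
      in \<lparr>carrier = carrier Q, monoid.mult = undefined, one = undefined,
          ring.zero = monoid.one Q, add = monoid.mult Q,
          smult = (\<lambda>b X. H <#>\<^bsub>G\<^esub> (frag_extend (\<lambda>(a, v). frag_of (b \<otimes>\<^bsub>A\<^esub> a, v)) ` X))\<rparr>)"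

definition Ind ::
  "nat \<Rightarrow> nat \<Rightarrow> nat \<Rightarrow> (rook_alg, 'v) module \<Rightarrow> (rook_alg, ((rook_alg \<times> 'v) \<Rightarrow>\<^sub>0 int) set) module"
  where
  "Ind n i m M = extend_scalars (CP n (m - 1)) (CP n m) (psi n i m) M"

definition E_functor ::
  "nat \<Rightarrow> nat \<Rightarrow> nat \<Rightarrow> (rook_alg, 'v) module \<Rightarrow> (rook_alg, ((rook_alg \<times> 'v) \<Rightarrow>\<^sub>0 int) set) module"
  where
  "E_functor n i m M = Res n i (m + 1) (Ind n (i - 1) (m + 1) M)"

definition F_functor ::
  "nat \<Rightarrow> nat \<Rightarrow> nat \<Rightarrow> (rook_alg, 'v) module \<Rightarrow> (rook_alg, ((rook_alg \<times> 'v) \<Rightarrow>\<^sub>0 int) set) module"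
  where
  "F_functor n i m M = Res n (i - 1) (m + 1) (Ind n i (m + 1) M)"

text \<open>
  The map on isomorphism classes induced by a functor.  The value \<open>None\<close> stands for the class
  of the zero module; \<open>the_elem\<close> extracts the value common to all representatives.
\<close>

definition induced_map ::
  "nat \<Rightarrow> nat \<Rightarrow> (rook_module \<Rightarrow> (rook_alg, 'v) module) \<Rightarrow> rook_module set \<Rightarrow> rook_module set option"
  where
  "induced_map n m F C = the_elem
     ((\<lambda>M. if carrier (F M) = {\<zero>\<^bsub>F M\<^esub>} then None else Some (iso_class n m (F M))) ` C)"


section \<open>Crystals\<close>

text \<open>
  Weights in \<open>\<Oplus>\<^bsub>i=1..n+1\<^esub> \<int>\<epsilon>\<^sub>i\<close> are elements of \<open>nat \<Rightarrow>\<^sub>0 int\<close> with keys in \<open>{1..n+1}\<close>, and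
  \<open>\<epsilon>\<^sub>i\<close> is \<open>frag_of i\<close>.  The added element \<open>0\<close> of \<open>B \<union> {0}\<close> is \<open>None\<close>.
\<close>

record 'b crystal =
  elts :: "'b set"
  wt :: "'b \<Rightarrow> (nat \<Rightarrow>\<^sub>0 int)"
  eps :: "nat \<Rightarrow> 'b \<Rightarrow> int extended"
  phi :: "nat \<Rightarrow> 'b \<Rightarrow> int extended"
  etil :: "nat \<Rightarrow> 'b \<Rightarrow> 'b option"
  ftil :: "nat \<Rightarrow> 'b \<Rightarrow> 'b option"

text \<open>\<open>\<lambda>(E\<^sub>i\<^sub>i - E\<^sub>i\<^sub>+\<^sub>1\<^sub>,\<^sub>i\<^sub>+\<^sub>1)\<close>, as \<open>\<epsilon>\<^sub>i(E\<^sub>j\<^sub>j) = \<delta>\<^sub>i\<^sub>j\<close>.\<close>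

definition wt_pair :: "(nat \<Rightarrow>\<^sub>0 int) \<Rightarrow> nat \<Rightarrow> int" where
  "wt_pair \<Lambda> i = Poly_Mapping.lookup \<Lambda> i - Poly_Mapping.lookup \<Lambda> (i + 1)"

locale gl_crystal =
  fixes n :: nat and B :: "'b crystal"
  assumes wt_lattice: "b \<in> elts B \<Longrightarrow> Poly_Mapping.keys (wt B b) \<subseteq> {1..n + 1}"
    and eps_range: "\<lbrakk>i \<in> {1..n}; b \<in> elts B\<rbrakk> \<Longrightarrow> eps B i b \<noteq> Pinf"
    and phi_range: "\<lbrakk>i \<in> {1..n}; b \<in> elts B\<rbrakk> \<Longrightarrow> phi B i b \<noteq> Pinf"
    and etil_closed: "\<lbrakk>i \<in> {1..n}; b \<in> elts B; etil B i b = Some b'\<rbrakk> \<Longrightarrow> b' \<in> elts B"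
    and ftil_closed: "\<lbrakk>i \<in> {1..n}; b \<in> elts B; ftil B i b = Some b'\<rbrakk> \<Longrightarrow> b' \<in> elts B"
    and phi_eps: "\<lbrakk>i \<in> {1..n}; b \<in> elts B\<rbrakk> \<Longrightarrow>
      phi B i b = eps B i b + Fin (wt_pair (wt B b) i)"
    and wt_etil: "\<lbrakk>i \<in> {1..n}; b \<in> elts B; etil B i b = Some b'\<rbrakk> \<Longrightarrow>
      wt B b' = wt B b + frag_of i - frag_of (i + 1)"
    and wt_ftil: "\<lbrakk>i \<in> {1..n}; b \<in> elts B; ftil B i b = Some b'\<rbrakk> \<Longrightarrow>
      wt B b' = wt B b - frag_of i + frag_of (i + 1)"
    and ftil_etil: "\<lbrakk>i \<in> {1..n}; b1 \<in> elts B; b2 \<in> elts B\<rbrakk> \<Longrightarrow>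
      ftil B i b2 = Some b1 \<longleftrightarrow> etil B i b1 = Some b2"
    and eps_Minf: "\<lbrakk>i \<in> {1..n}; b \<in> elts B; eps B i b = Minf\<rbrakk> \<Longrightarrow>
      etil B i b = None \<and> ftil B i b = None"

definition crystals_isomorphic :: "nat \<Rightarrow> 'b crystal \<Rightarrow> 'c crystal \<Rightarrow> bool" where
  "crystals_isomorphic n B C \<longleftrightarrow> (\<exists>f. bij_betw f (elts B) (elts C) \<and>
     (\<forall>b \<in> elts B. wt C (f b) = wt B b \<and>
       (\<forall>i \<in> {1..n}.
          eps C i (f b) = eps B i b \<and> phi C i (f b) = phi B i b \<and>
          etil C i (f b) = map_option f (etil B i b) \<and>
          ftil C i (f b) = map_option f (ftil B i b))))"

definition crystal_tensor :: "'b crystal \<Rightarrow> 'c crystal \<Rightarrow> ('b \<times> 'c) crystal" where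
  "crystal_tensor B C = \<lparr>
     elts = elts B \<times> elts C,
     wt = (\<lambda>(b, c). wt B b + wt C c),
     eps = (\<lambda>i (b, c). max (eps B i b) (eps C i c + Fin (- wt_pair (wt B b) i))),
     phi = (\<lambda>i (b, c). max (phi C i c) (phi B i b + Fin (wt_pair (wt C c) i))),
     etil = (\<lambda>i (b, c). if phi B i b \<ge> eps C i c
       then map_option (\<lambda>b'. (b', c)) (etil B i b)
       else map_option (\<lambda>c'. (b, c')) (etil C i c)),
     ftil = (\<lambda>i (b, c). if phi B i b > eps C i c
       then map_option (\<lambda>b'. (b', c)) (ftil B i b)
       else map_option (\<lambda>c'. (b, c')) (ftil C i c))\<rparr>"

text \<open>
  The structure induced on \<open>S\<close> by a map \<open>g\<close> into a crystal that is injective on \<open>S\<close> and whose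
  image is stable under the crystal operators.
\<close>

definition induced_crystal :: "'b set \<Rightarrow> ('b \<Rightarrow> 'c) \<Rightarrow> 'c crystal \<Rightarrow> 'b crystal" where
  "induced_crystal S g C = \<lparr>
     elts = S,
     wt = (\<lambda>b. wt C (g b)),
     eps = (\<lambda>i b. eps C i (g b)),
     phi = (\<lambda>i b. phi C i (g b)),
     etil = (\<lambda>i b. map_option (inv_into S g) (etil C i (g b))),
     ftil = (\<lambda>i b. map_option (inv_into S g) (ftil C i (g b)))\<rparr>"

text \<open>
  The tensor power of \<open>B\<close> with \<open>N\<close> factors on words of length \<open>N\<close>, the word \<open>[b\<^sub>1, \<dots>, b\<^sub>N]\<close> being
  \<open>b\<^sub>1 \<otimes> (b\<^sub>2 \<otimes> (\<dots> \<otimes> b\<^sub>N))\<close>.  The power with no factors is the one-element crystal \<open>B(0)\<close>.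
\<close>

fun crystal_power :: "'b crystal \<Rightarrow> nat \<Rightarrow> 'b list crystal" where
  "crystal_power B 0 = \<lparr>elts = {[]}, wt = (\<lambda>_. 0), eps = (\<lambda>_ _. Fin 0), phi = (\<lambda>_ _. Fin 0),
     etil = (\<lambda>_ _. None), ftil = (\<lambda>_ _. None)\<rparr>"
| "crystal_power B (Suc 0) = induced_crystal {w. length w = 1 \<and> set w \<subseteq> elts B} hd B"
| "crystal_power B (Suc (Suc N)) =
     induced_crystal {w. length w = Suc (Suc N) \<and> set w \<subseteq> elts B} (\<lambda>w. (hd w, tl w))
       (crystal_tensor B (crystal_power B (Suc N)))"

definition box_crystal :: "nat \<Rightarrow> nat crystal" where
  "box_crystal n = \<lparr>
     elts = {0..n},
     wt = (\<lambda>j. frag_of (j + 1)),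
     eps = (\<lambda>i j. Fin (if i = j then 1 else 0)),
     phi = (\<lambda>i j. Fin (if i = j + 1 then 1 else 0)),
     etil = (\<lambda>i j. if i \<in> {1..n} \<and> j = i then Some (i - 1) else None),
     ftil = (\<lambda>i j. if i \<in> {1..n} \<and> j = i - 1 then Some i else None)\<rparr>"

text \<open>Tableaux are lists of rows, from top to bottom; a shape is the list of row lengths.\<close>

definition ssyt :: "nat \<Rightarrow> nat list \<Rightarrow> nat list list set" where
  "ssyt n shape = {t. map length t = shape \<and>
     (\<forall>row \<in> set t. sorted row \<and> set row \<subseteq> {0..n}) \<and>
     (\<forall>r r' c. r < r' \<and> r' < length t \<and> c < length (t ! r') \<longrightarrow> t ! r ! c < t ! r' ! c)}"

definition middle_eastern_reading :: "nat list list \<Rightarrow> nat list" where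
  "middle_eastern_reading t = concat (map rev t)"

definition tableau_crystal :: "nat \<Rightarrow> nat list \<Rightarrow> nat list list crystal" where
  "tableau_crystal n shape = induced_crystal (ssyt n shape) middle_eastern_reading
     (crystal_power (box_crystal n) (sum_list shape))"


section \<open>The crystal of irreducible modules\<close>

definition multiplicities :: "nat \<Rightarrow> nat \<Rightarrow> rook_module set \<Rightarrow> nat \<Rightarrow> nat" where
  "multiplicities n m C = (THE \<mu>. (\<forall>j>n. \<mu> j = 0) \<and> (\<Sum>j\<le>n. \<mu> j) = m \<and>
     C = iso_class n m (W_std n m \<mu>))"

definition simple_crystal :: "nat \<Rightarrow> nat \<Rightarrow> rook_module set crystal" where
  "simple_crystal n m = \<lparr>
     elts = simple_classes n m,
     wt = (\<lambda>C. \<Sum>j\<le>n. frag_cmul (int (multiplicities n m C j)) (frag_of (j + 1))),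
     eps = (\<lambda>i C. Fin (int (multiplicities n m C i))),
     phi = (\<lambda>i C. Fin (int (multiplicities n m C (i - 1)))),
     etil = (\<lambda>i. induced_map n m (E_functor n i m)),
     ftil = (\<lambda>i. induced_map n m (F_functor n i m))\<rparr>"

end

theory Submission
  imports Defs
begin

text \<open>
  Reading off the colour of each row and of each column, \<open>P\<^sub>m\<close> is the set of pairs \<open>(S, T)\<close> of
  colourings of \<open>{1..m}\<close> by \<open>{0..n}\<close> with equal colour multiplicities: planarity forces the edges
  of a given colour to match the \<open>p\<close>-th row with the \<open>p\<close>-th column of that colour.  By Moebius
  inversion the \<open>x\<^sub>d\<close> multiply like the matrix units \<open>E\<^sub>S\<^sub>T\<close> of this groupoid, so \<open>\<complex>P\<^sub>m\<close> is a
  product of full matrix algebras indexed by the multisets of \<open>m\<close> colours, and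
  \<open>\<psi>\<^sub>i(E\<^sub>S\<^sub>T) = E\<^sub>S\<^sub>i\<^sub>,\<^sub>T\<^sub>i\<close>.

  A simple module is then the same as a module generated by some \<open>w = E\<^sub>T\<^sub>T w \<noteq> 0\<close>, and its class
  depends only on the multiset of \<open>T\<close>.  Induction sends \<open>w\<close> to the generator \<open>1 \<otimes> w\<close> fixed by
  \<open>E\<^sub>T\<^sub>i\<^sub>,\<^sub>T\<^sub>i\<close>, and restriction keeps a generator fixed by \<open>E\<^sub>U\<^sub>i\<^sub>,\<^sub>U\<^sub>i\<close> or kills the module.  Hence the
  functors move one colour \<open>i\<close> to \<open>i - 1\<close> or back, exactly as the crystal operators do on
  one-row tableaux.  Both crystals are compared with the crystal of multisets of colours.
\<close>

section \<open>Crystals of multisets and of one-row tableaux\<close>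

text \<open>The algebra is handled through coordinates: \<open>coef n m x S T\<close> is the entry
  of \<open>x\<close> at the matrix unit of \<open>(S, T)\<close>, and by \<open>coef_eqI\<close>
  equality of elements is equality of all entries with \<open>mset S = mset T\<close>. The
  matrix-unit rule reduces to an identity of indicators: \<open>rook S U\<close> lies below
  \<open>d1 * d2\<close> iff some, necessarily unique, \<open>T\<close> has \<open>rook S T\<close>
  below \<open>d1\<close> and \<open>rook T U\<close> below \<open>d2\<close>. Colour 0 draws no
  edge but has to be kept as a colour, because it counts zero rows and zero columns.

  The obstacle on the module side is that the functors leave the fixed carrier type and that classes
  are accessed through arbitrary representatives. Simple modules are therefore tracked by
  \<open>cyclic_at\<close>, which makes sense on every carrier type, passes to isomorphic modules
  and determines the class. For an induced module, a quotient of a free abelian group, the generator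
  is easy to name; the work is to see that it does not vanish, and one matrix entry of a balanced
  pairing detects this.\<close>

definition crystal_iso :: "nat \<Rightarrow> ('b \<Rightarrow> 'c) \<Rightarrow> 'b crystal \<Rightarrow> 'c crystal \<Rightarrow> bool" where
  "crystal_iso n f B C \<longleftrightarrow> bij_betw f (elts B) (elts C) \<and>
     (\<forall>b \<in> elts B. wt C (f b) = wt B b \<and>
       (\<forall>i \<in> {1..n}.
          eps C i (f b) = eps B i b \<and> phi C i (f b) = phi B i b \<and>
          etil C i (f b) = map_option f (etil B i b) \<and>
          ftil C i (f b) = map_option f (ftil B i b)))"

text \<open>An isomorphism carries all axioms along, so they are checked by hand only for multisets.
  Closure of the operators of \<open>K\<close> shows that \<open>g\<close> sends their values into
  \<open>B\<close>; axiom (c) also uses that \<open>g\<close> is injective on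
  \<open>elts K\<close>.\<close>

lemma gl_crystal_transfer:
  assumes K: "gl_crystal n K" and iso: "crystal_iso n g K B"
  shows "gl_crystal n B"
proof -
  interpret K: gl_crystal n K by fact
  have bij: "bij_betw g (elts K) (elts B)"
    and wt: "\<And>b. b \<in> elts K \<Longrightarrow> wt B (g b) = wt K b"
    and eps: "\<And>b i. \<lbrakk>b \<in> elts K; i \<in> {1..n}\<rbrakk> \<Longrightarrow> eps B i (g b) = eps K i b"
    and phi: "\<And>b i. \<lbrakk>b \<in> elts K; i \<in> {1..n}\<rbrakk> \<Longrightarrow> phi B i (g b) = phi K i b"
    and etil: "\<And>b i. \<lbrakk>b \<in> elts K; i \<in> {1..n}\<rbrakk> \<Longrightarrow> etil B i (g b) = map_option g (etil K i b)"
    and ftil: "\<And>b i. \<lbrakk>b \<in> elts K; i \<in> {1..n}\<rbrakk> \<Longrightarrow> ftil B i (g b) = map_option g (ftil K i b)"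
    using iso by (auto simp: crystal_iso_def)
  have inj: "g b = g b' \<longleftrightarrow> b = b'" if "b \<in> elts K" "b' \<in> elts K" for b b'
    using bij that by (auto simp: bij_betw_def inj_on_def)
  have mem: "g b \<in> elts B" if "b \<in> elts K" for b
    using bij that by (auto simp: bij_betw_def)
  have ex: "\<exists>a \<in> elts K. b = g a" if "b \<in> elts B" for b
    using bij that by (auto simp: bij_betw_def)
  show ?thesis
  proof
    fix b assume "b \<in> elts B"
    then obtain a where "a \<in> elts K" "b = g a" using ex by blast
    then show "Poly_Mapping.keys (wt B b) \<subseteq> {1..n + 1}" using K.wt_lattice[of a] wt by simp
  next
    fix b i assume "i \<in> {1..n}" "b \<in> elts B"
    then obtain a where a: "a \<in> elts K" "b = g a" and i: "i \<in> {1..n}" using ex by blast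
    show "eps B i b \<noteq> \<infinity>" "phi B i b \<noteq> \<infinity>" "phi B i b = eps B i b + Fin (wt_pair (wt B b) i)"
      using a K.eps_range[OF i a(1)] K.phi_range[OF i a(1)] K.phi_eps[OF i a(1)]
      by (simp_all add: eps[OF a(1) i] phi[OF a(1) i] wt[OF a(1)])
    show "etil B i b = None \<and> ftil B i b = None" if "eps B i b = -\<infinity>"
      using K.eps_Minf[OF i a(1)] that
      by (simp add: a(2) eps[OF a(1) i] etil[OF a(1) i] ftil[OF a(1) i])
    fix b'
    show "b' \<in> elts B" "wt B b' = wt B b + frag_of i - frag_of (i + 1)" if "etil B i b = Some b'"
    proof -
      obtain a' where a': "etil K i a = Some a'" "b' = g a'"
        using \<open>etil B i b = Some b'\<close> by (auto simp: a(2) etil[OF a(1) i])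
      have "a' \<in> elts K" using K.etil_closed[OF i a(1) a'(1)] .
      then show "b' \<in> elts B" "wt B b' = wt B b + frag_of i - frag_of (i + 1)"
        using K.wt_etil[OF i a(1) a'(1)] by (simp_all add: a' a(2) wt[OF a(1)] wt mem)
    qed
    show "b' \<in> elts B" "wt B b' = wt B b - frag_of i + frag_of (i + 1)" if "ftil B i b = Some b'"
    proof -
      obtain a' where a': "ftil K i a = Some a'" "b' = g a'"
        using \<open>ftil B i b = Some b'\<close> by (auto simp: a(2) ftil[OF a(1) i])
      have "a' \<in> elts K" using K.ftil_closed[OF i a(1) a'(1)] .
      then show "b' \<in> elts B" "wt B b' = wt B b - frag_of i + frag_of (i + 1)"
        using K.wt_ftil[OF i a(1) a'(1)] by (simp_all add: a' a(2) wt[OF a(1)] wt mem)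
    qed
  next
    fix b1 b2 i assume i: "i \<in> {1..n}" and "b1 \<in> elts B" "b2 \<in> elts B"
    then obtain a1 a2 where a: "a1 \<in> elts K" "b1 = g a1" "a2 \<in> elts K" "b2 = g a2"
      using ex by blast
    have "ftil B i b2 = Some b1 \<longleftrightarrow> ftil K i a2 = Some a1"
    proof (cases "ftil K i a2")
      case (Some c)
      then show ?thesis using inj[OF K.ftil_closed[OF i a(3) Some] a(1)]
        by (simp add: ftil[OF a(3) i] a(2,4))
    qed (simp add: ftil[OF a(3) i] a(2,4))
    moreover have "etil B i b1 = Some b2 \<longleftrightarrow> etil K i a1 = Some a2"
    proof (cases "etil K i a1")
      case (Some c)
      then show ?thesis using inj[OF K.etil_closed[OF i a(1) Some] a(3)]
        by (simp add: etil[OF a(1) i] a(2,4))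
    qed (simp add: etil[OF a(1) i] a(2,4))
    ultimately show "ftil B i b2 = Some b1 \<longleftrightarrow> etil B i b1 = Some b2"
      using K.ftil_etil[OF i a(1,3)] by simp
  qed
qed

text \<open>A common source \<open>K\<close> spares a direct comparison of module classes with
  tableaux: the isomorphism is \<open>h\<close> after the inverse of \<open>g\<close>.\<close>

lemma crystals_isomorphic_via:
  assumes K: "gl_crystal n K" and B: "crystal_iso n g K B" and C: "crystal_iso n h K C"
  shows "crystals_isomorphic n B C"
proof -
  interpret K: gl_crystal n K by fact
  define u where "u = inv_into (elts K) g"
  have bijg: "bij_betw g (elts K) (elts B)" and bijh: "bij_betw h (elts K) (elts C)"
    using B C by (auto simp: crystal_iso_def)
  define f where "f = h \<circ> u"
  have bij: "bij_betw f (elts B) (elts C)"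
    unfolding u_def f_def using bij_betw_trans[OF bij_betw_inv_into[OF bijg] bijh] .
  have ug: "u (g a) = a" if "a \<in> elts K" for a
    by (simp add: u_def bij_betw_inv_into_left[OF bijg that])
  \<comment> \<open>The inverse undoes \<open>g\<close> only on \<open>elts K\<close>; closure of
    the operators of \<open>K\<close> supplies the proviso below.\<close>
  have map_f: "map_option f (map_option g x) = map_option h x"
    if "\<And>y. x = Some y \<Longrightarrow> y \<in> elts K" for x
    using that by (cases x) (simp_all add: f_def ug)
  have "crystal_iso n f B C"
    unfolding crystal_iso_def
  proof (intro conjI ballI bij)
    fix b assume "b \<in> elts B"
    then obtain a where a: "a \<in> elts K" "b = g a"
      using bijg by (metis bij_betw_imp_surj_on imageE)
    note g = conjunct2[OF B[unfolded crystal_iso_def], rule_format, OF a(1)]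
    note h = conjunct2[OF C[unfolded crystal_iso_def], rule_format, OF a(1)]
    have hub: "f b = h a" by (simp add: f_def a(2) ug[OF a(1)])
    show "wt C (f b) = wt B b"
      unfolding hub unfolding a(2) using g h by simp
    fix i assume i: "i \<in> {1..n}"
    note gi = conjunct2[OF g, rule_format, OF i]
    note hi = conjunct2[OF h, rule_format, OF i]
    show "eps C i (f b) = eps B i b" "phi C i (f b) = phi B i b"
      unfolding hub unfolding a(2) using gi hi by simp_all
    show "etil C i (f b) = map_option f (etil B i b)"
      unfolding hub unfolding a(2) using gi hi map_f[OF K.etil_closed[OF i a(1)]] by simp
    show "ftil C i (f b) = map_option f (ftil B i b)"
      unfolding hub unfolding a(2) using gi hi map_f[OF K.ftil_closed[OF i a(1)]] by simp
  qed
  then show ?thesis unfolding crystals_isomorphic_def crystal_iso_def by blast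
qed

section \<open>The crystal of multisets of colours\<close>

definition mset_wt :: "nat \<Rightarrow> nat multiset \<Rightarrow> (nat \<Rightarrow>\<^sub>0 int)" where
  "mset_wt n M = (\<Sum>j\<le>n. frag_cmul (int (count M j)) (frag_of (j + 1)))"

text \<open>A one-row tableau and a simple class are both determined by how often each colour
  occurs. As \<open>etil i\<close> trades one \<open>i\<close> for an \<open>i - 1\<close>, the
  values of \<open>eps\<close> and \<open>phi\<close> are the numbers of times \<open>etil\<close>
  and \<open>ftil\<close> can be applied before reaching \<open>None\<close>.\<close>

definition mset_crystal :: "nat \<Rightarrow> nat \<Rightarrow> nat multiset crystal" where
  "mset_crystal n m = \<lparr>
     elts = {M. size M = m \<and> set_mset M \<subseteq> {..n}},
     wt = mset_wt n,
     eps = (\<lambda>i M. Fin (int (count M i))),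
     phi = (\<lambda>i M. Fin (int (count M (i - 1)))),
     etil = (\<lambda>i M. if i \<in># M then Some (add_mset (i - 1) (M - {#i#})) else None),
     ftil = (\<lambda>i M. if i - 1 \<in># M then Some (add_mset i (M - {#i - 1#})) else None)\<rparr>"

text \<open>Colour \<open>j\<close> sits at key \<open>j + 1\<close>. The guard matters at key 0,
  where truncated subtraction would read off colour 0.\<close>

lemma lookup_wt_mset:
  "Poly_Mapping.lookup (mset_wt n M) k = (if 1 \<le> k \<and> k \<le> n + 1 then int (count M (k - 1)) else 0)"
proof -
  have "Poly_Mapping.lookup (mset_wt n M) k =
    (\<Sum>j\<le>n. if j + 1 = k then int (count M j) else 0)"
    by (simp add: mset_wt_def lookup_sum) (intro sum.cong refl, auto)
  also have "\<dots> = (\<Sum>j\<in>{..n} \<inter> {j. j + 1 = k}. int (count M j))"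
    by (subst sum.inter_restrict) auto
  also have "\<dots> = (if 1 \<le> k \<and> k \<le> n + 1 then int (count M (k - 1)) else 0)"
  proof (cases "1 \<le> k \<and> k \<le> n + 1")
    case True
    then obtain l where l: "k = l + 1" "l \<le> n"
      by (metis add.commute le_add_diff_inverse add_le_cancel_right)
    then have "{..n} \<inter> {j. j + 1 = k} = {l}" by auto
    then show ?thesis using l by simp
  next
    case False
    then have "{..n} \<inter> {j. j + 1 = k} = {}" by auto
    then show ?thesis unfolding if_not_P[OF False] by simp
  qed
  finally show ?thesis .
qed

lemma gl_crystal_mset_crystal: "gl_crystal n (mset_crystal n m)"
proof
  fix M assume "M \<in> elts (mset_crystal n m)"
  show "Poly_Mapping.keys (wt (mset_crystal n m) M) \<subseteq> {1..n + 1}"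
    by (auto simp: mset_crystal_def in_keys_iff lookup_wt_mset split: if_splits)
next
  fix i M assume i: "i \<in> {1..n}" and M: "M \<in> elts (mset_crystal n m)"
  show "eps (mset_crystal n m) i M \<noteq> \<infinity>" "phi (mset_crystal n m) i M \<noteq> \<infinity>"
    "eps (mset_crystal n m) i M = -\<infinity> \<Longrightarrow>
      etil (mset_crystal n m) i M = None \<and> ftil (mset_crystal n m) i M = None"
    by (simp_all add: mset_crystal_def)
  show "phi (mset_crystal n m) i M =
      eps (mset_crystal n m) i M + Fin (wt_pair (wt (mset_crystal n m) M) i)"
    using i by (simp add: mset_crystal_def wt_pair_def lookup_wt_mset)
  fix M'
  show "M' \<in> elts (mset_crystal n m)"
    "wt (mset_crystal n m) M' = wt (mset_crystal n m) M + frag_of i - frag_of (i + 1)"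
    if "etil (mset_crystal n m) i M = Some M'"
  proof -
    have "i \<in># M" "M' = add_mset (i - 1) (M - {#i#})"
      using that by (auto simp: mset_crystal_def split: if_splits)
    then obtain M0 where M0: "M = add_mset i M0" "M' = add_mset (i - 1) M0"
      by (metis add_mset_remove_trivial insert_DiffM)
    show "M' \<in> elts (mset_crystal n m)"
      using M i by (auto simp: mset_crystal_def M0)
    show "wt (mset_crystal n m) M' = wt (mset_crystal n m) M + frag_of i - frag_of (i + 1)"
      unfolding crystal.simps mset_crystal_def M0
    proof (rule poly_mapping_eqI)
      fix k
      obtain i' where i': "i = Suc i'" "i' < n" using i by (cases i) auto
      show "Poly_Mapping.lookup (mset_wt n (add_mset (i - 1) M0)) k =
          Poly_Mapping.lookup (mset_wt n (add_mset i M0) + frag_of i - frag_of (i + 1)) k"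
        by (cases k) (use i' in \<open>simp_all add: lookup_wt_mset Poly_Mapping.lookup_add lookup_minus\<close>)
    qed
  qed
  show "M' \<in> elts (mset_crystal n m)"
    "wt (mset_crystal n m) M' = wt (mset_crystal n m) M - frag_of i + frag_of (i + 1)"
    if "ftil (mset_crystal n m) i M = Some M'"
  proof -
    have "i - 1 \<in># M" "M' = add_mset i (M - {#i - 1#})"
      using that by (auto simp: mset_crystal_def split: if_splits)
    then obtain M0 where M0: "M = add_mset (i - 1) M0" "M' = add_mset i M0"
      by (metis add_mset_remove_trivial insert_DiffM)
    show "M' \<in> elts (mset_crystal n m)"
      using M i by (auto simp: mset_crystal_def M0)
    show "wt (mset_crystal n m) M' = wt (mset_crystal n m) M - frag_of i + frag_of (i + 1)"
      unfolding crystal.simps mset_crystal_def M0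
    proof (rule poly_mapping_eqI)
      fix k
      obtain i' where i': "i = Suc i'" "i' < n" using i by (cases i) auto
      show "Poly_Mapping.lookup (mset_wt n (add_mset i M0)) k =
          Poly_Mapping.lookup (mset_wt n (add_mset (i - 1) M0) - frag_of i + frag_of (i + 1)) k"
        by (cases k) (use i' in \<open>simp_all add: lookup_wt_mset Poly_Mapping.lookup_add lookup_minus\<close>)
    qed
  qed
next
  fix i M1 M2 assume i: "i \<in> {1..n}"
  show "ftil (mset_crystal n m) i M2 = Some M1 \<longleftrightarrow> etil (mset_crystal n m) i M1 = Some M2"
    using i by (auto simp: mset_crystal_def)
qed

text \<open>This is the Middle-Eastern reading of the one-row tableau with content \<open>M\<close>:
  the row increases weakly and is read from right to left.\<close>

definition desc :: "nat multiset \<Rightarrow> nat list" where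
  "desc M = rev (sorted_list_of_multiset M)"

lemma mset_desc [simp]: "mset (desc M) = M"
  by (simp add: desc_def)

lemma desc_unique: "\<lbrakk>sorted (rev w); mset w = M\<rbrakk> \<Longrightarrow> desc M = w"
  by (metis desc_def mset_rev rev_rev_ident sorted_list_of_multiset_mset sorted_sort_id)

lemma desc_Cons: "(\<And>y. y \<in># M \<Longrightarrow> y \<le> x) \<Longrightarrow> desc (add_mset x M) = x # desc M"
  by (rule desc_unique) (auto simp: sorted_append desc_def)

lemma length_desc [simp]: "length (desc M) = size M"
  by (metis mset_desc size_mset)

lemma set_desc [simp]: "set (desc M) = set_mset M"
  by (metis mset_desc set_mset_mset)

abbreviation words :: "nat \<Rightarrow> nat \<Rightarrow> nat list set" where
  "words n N \<equiv> {w. length w = N \<and> set w \<subseteq> {0..n}}"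

text \<open>A tensor power is an induced crystal, so its operators return through
  \<open>inv_into\<close>; here that map is seen to be consing.\<close>

lemma inv_hd_tl: "b # v \<in> words n (Suc N) \<Longrightarrow>
   inv_into (words n (Suc N)) (\<lambda>w. (hd w, tl w)) (b, v) = b # v"
  by (rule inv_into_f_eq) (auto simp: inj_on_def length_Suc_conv)

lemma inv_hd: "b \<le> n \<Longrightarrow> inv_into (words n 1) hd b = [b]"
  by (rule inv_into_f_eq) (auto simp: inj_on_def length_Suc_conv)

lemma max_mset_cases:
  assumes "M \<noteq> {#}"
  obtains x M' where "M = add_mset x M'" "\<And>y. y \<in># M' \<Longrightarrow> y \<le> (x::nat)"
proof
  show "M = add_mset (Max_mset M) (M - {#Max_mset M#})" using assms by simp
  show "\<And>y. y \<in># M - {#Max_mset M#} \<Longrightarrow> y \<le> Max_mset M" by (meson Max_ge finite_set_mset in_diffD)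
qed


lemma mset_wt_add: "x \<le> n \<Longrightarrow> mset_wt n (add_mset x M) = frag_of (x + 1) + mset_wt n M"
proof (rule poly_mapping_eqI)
  fix k assume "x \<le> n"
  then show "Poly_Mapping.lookup (mset_wt n (add_mset x M)) k =
    Poly_Mapping.lookup (frag_of (x + 1) + mset_wt n M) k"
    by (cases k) (simp_all add: lookup_wt_mset Poly_Mapping.lookup_add)
qed

text \<open>The largest letter \<open>x\<close> is split off as the first tensor factor. If
  \<open>i = x + 1\<close>, the tail contains no \<open>i\<close>; hence the tensor rule lets
  \<open>etil i\<close> act on the head exactly when the tail has no \<open>i\<close>, and
  \<open>ftil i\<close> exactly when \<open>x = i - 1\<close>. So \<open>etil i\<close> changes the
  rightmost \<open>i\<close> and \<open>ftil i\<close> the leftmost \<open>i - 1\<close>, and the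
  word stays descending.\<close>

lemma crystal_power_desc:
  assumes "size M = Suc N" "set_mset M \<subseteq> {..n}" "i \<in> {1..n}"
  shows "wt (crystal_power (box_crystal n) (Suc N)) (desc M) = mset_wt n M \<and>
    eps (crystal_power (box_crystal n) (Suc N)) i (desc M) = Fin (int (count M i)) \<and>
    phi (crystal_power (box_crystal n) (Suc N)) i (desc M) = Fin (int (count M (i - 1))) \<and>
    etil (crystal_power (box_crystal n) (Suc N)) i (desc M) =
      (if i \<in># M then Some (desc (add_mset (i - 1) (M - {#i#}))) else None) \<and>
    ftil (crystal_power (box_crystal n) (Suc N)) i (desc M) =
      (if i - 1 \<in># M then Some (desc (add_mset i (M - {#i - 1#}))) else None)"
  using assms(1,2)
proof (induction N arbitrary: M)
  case 0
  then obtain x where x: "M = {#x#}" "x \<le> n"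
    by (metis atMost_iff insert_subset set_mset_add_mset_insert size_1_singleton_mset One_nat_def)
  have d: "desc {#y#} = [y]" for y by (rule desc_unique) auto
  have "mset_wt n {#x#} = frag_of (x + 1)"
    using mset_wt_add[OF x(2), of "{#}"] by (simp add: mset_wt_def)
  then show ?case using assms(3) x(2) inv_hd[of _ n]
    by (auto simp: x(1) induced_crystal_def box_crystal_def d)
next
  case (Suc N)
  have "M \<noteq> {#}" using Suc.prems by auto
  then obtain x M' where M: "M = add_mset x M'" and mx: "\<And>y. y \<in># M' \<Longrightarrow> y \<le> x"
    by (rule max_mset_cases) blast
  have M': "size M' = Suc N" "set_mset M' \<subseteq> {..n}" and x: "x \<le> n"
    using Suc.prems by (auto simp: M)
  note IH = Suc.IH[OF M']
  define P where "P = crystal_power (box_crystal n) (Suc N)"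
  define f where "f = inv_into (words n (Suc (Suc N))) (\<lambda>w. (hd w, tl w))"
  have f: "f (y, desc M'') = desc (add_mset y M'')"
    if "y \<le> n" "size M'' = Suc N" "set_mset M'' \<subseteq> {..n}" "\<And>z. z \<in># M'' \<Longrightarrow> z \<le> y" for y M''
  proof -
    have "desc (add_mset y M'') = y # desc M''" by (rule desc_Cons) (rule that(4))
    moreover have "f (y, desc M'') = y # desc M''"
      unfolding f_def by (rule inv_hd_tl) (use that in auto)
    ultimately show ?thesis by simp
  qed
  have d: "desc M = x # desc M'" unfolding M by (rule desc_Cons) (rule mx)
  have elt: "elts (box_crystal n) = {0..n}" by (simp add: box_crystal_def)
  have wt: "wt (crystal_power (box_crystal n) (Suc (Suc N))) (desc M) = frag_of (x + 1) + mset_wt n M'"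
    using IH by (simp add: induced_crystal_def crystal_tensor_def d box_crystal_def)
  have wp: "wt_pair (frag_of (x + 1)) i = (if x + 1 = i then 1 else 0) - (if x = i then 1 else 0)"
    by (simp add: wt_pair_def)
  have wp': "wt_pair (mset_wt n M') i = int (count M' (i - 1)) - int (count M' i)"
    using assms(3) by (simp add: wt_pair_def lookup_wt_mset)
  have eps: "eps (crystal_power (box_crystal n) (Suc (Suc N))) i (desc M) =
     max (Fin (if i = x then 1 else 0)) (Fin (int (count M' i)) + Fin (- wt_pair (frag_of (x + 1)) i))"
    using IH by (simp add: induced_crystal_def crystal_tensor_def d box_crystal_def)
  have phi: "phi (crystal_power (box_crystal n) (Suc (Suc N))) i (desc M) =
     max (Fin (int (count M' (i - 1)))) (Fin (if i = x + 1 then 1 else 0) +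
       Fin (wt_pair (mset_wt n M') i))"
    using IH by (simp add: induced_crystal_def crystal_tensor_def d box_crystal_def)
  have et: "etil (crystal_power (box_crystal n) (Suc (Suc N))) i (desc M) =
     map_option f (if (if i = x + 1 then 1 else 0) \<ge> int (count M' i)
       then map_option (\<lambda>b'. (b', desc M')) (if x = i then Some (i - 1) else None)
       else map_option (\<lambda>c'. (x, c')) (if i \<in># M' then Some (desc (add_mset (i - 1) (M' - {#i#}))) else None))"
    using IH assms(3) by (simp add: induced_crystal_def crystal_tensor_def d box_crystal_def f_def)
  have ft: "ftil (crystal_power (box_crystal n) (Suc (Suc N))) i (desc M) =
     map_option f (if (if i = x + 1 then 1 else 0) > int (count M' i)
       then map_option (\<lambda>b'. (b', desc M')) (if x = i - 1 then Some i else None)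
       else map_option (\<lambda>c'. (x, c')) (if i - 1 \<in># M' then Some (desc (add_mset i (M' - {#i - 1#}))) else None))"
    using IH assms(3) by (simp add: induced_crystal_def crystal_tensor_def d box_crystal_def f_def)
  \<comment> \<open>This is where maximality of \<open>x\<close> enters the tensor rule: for
    \<open>x = i - 1\<close> it makes \<open>eps\<close> of the tail vanish.\<close>
  have big: "x < y \<Longrightarrow> y \<notin># M'" for y using mx by force
  then have cbig: "x < y \<Longrightarrow> count M' y = 0" for y by (simp add: not_in_iff)
  have i: "i = Suc (i - 1)" using assms(3) by auto
  have e1: "etil (crystal_power (box_crystal n) (Suc (Suc N))) i (desc M) =
      (if i \<in># M then Some (desc (add_mset (i - 1) (M - {#i#}))) else None)"
  proof (cases "i \<in># M'")
    case True
    then have "i \<le> x" by (rule mx)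
    then have "i - 1 \<le> x" by simp
    have "f (x, desc (add_mset (i - 1) (M' - {#i#}))) =
      desc (add_mset x (add_mset (i - 1) (M' - {#i#})))"
      by (rule f) (use True M' x \<open>i - 1 \<le> x\<close> mx assms(3)
        in \<open>auto simp: size_Diff_singleton dest!: in_diffD\<close>)
    then show ?thesis unfolding et using True \<open>i \<le> x\<close>
      by (simp add: M add_mset_commute count_eq_zero_iff)
  next
    case False
    show ?thesis
    proof (cases "x = i")
      case True
      \<comment> \<open>The tail has no \<open>i\<close> left, so its letters are at most
        \<open>i - 1\<close> and the lowered head is still a largest letter.\<close>
      have "f (i - 1, desc M') = desc (add_mset (i - 1) M')"
        by (rule f) (use M' x False True mx i
          in \<open>auto, metis Suc_leI le_neq_implies_less less_Suc_eq_le\<close>)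
      then show ?thesis unfolding et using True False by (simp add: M not_in_iff)
    next
      case False
      then show ?thesis unfolding et using \<open>i \<notin># M'\<close> by (auto simp: M)
    qed
  qed
  have e2: "ftil (crystal_power (box_crystal n) (Suc (Suc N))) i (desc M) =
      (if i - 1 \<in># M then Some (desc (add_mset i (M - {#i - 1#}))) else None)"
  proof (cases "x = i - 1")
    case True
    then have "count M' i = 0" using cbig i by auto
    have "f (i, desc M') = desc (add_mset i M')"
      by (rule f) (use M' mx True assms(3) in \<open>auto intro: le_trans[OF _ diff_le_self]\<close>)
    then show ?thesis unfolding et ft using True i \<open>count M' i = 0\<close> by (simp add: M)
  next
    case False
    then have ni: "i \<noteq> x + 1" using i by auto
    show ?thesis
    proof (cases "i - 1 \<in># M'")
      case True
      then have "i \<le> x" using mx[OF True] False i by auto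
      have "f (x, desc (add_mset i (M' - {#i - 1#}))) = desc (add_mset x (add_mset i (M' - {#i - 1#})))"
        by (rule f) (use True M' x \<open>i \<le> x\<close> mx assms(3)
          in \<open>auto simp: size_Diff_singleton dest!: in_diffD\<close>)
      then show ?thesis unfolding ft using True False ni by (simp add: M add_mset_commute)
    next
      case nM: False
      then show ?thesis unfolding ft using False ni by (simp add: M)
    qed
  qed
  have "mset_wt n M = frag_of (x + 1) + mset_wt n M'"
    unfolding M by (rule mset_wt_add) (rule x)
  moreover have "eps (crystal_power (box_crystal n) (Suc (Suc N))) i (desc M) = Fin (int (count M i))"
    unfolding eps wp using cbig i by (auto simp: M)
  moreover have "phi (crystal_power (box_crystal n) (Suc (Suc N))) i (desc M) =
    Fin (int (count M (i - 1)))"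
    unfolding phi wp' using cbig i by (auto simp: M)
  ultimately show ?case using e1 e2 wt by simp
qed

text \<open>With a single row the column condition of \<open>ssyt\<close> is vacuous, so a tableau
  is just the sorted list of its content; \<open>crystal_power_desc\<close> then describes the
  structure on its reading word.\<close>

lemma crystal_iso_tableau:
  assumes "n \<ge> 1" "m \<ge> 1"
  shows "crystal_iso n (\<lambda>M. [sorted_list_of_multiset M]) (mset_crystal n m) (tableau_crystal n [m])"
proof -
  obtain N where N: "m = Suc N" using assms(2) by (cases m) auto
  define g :: "nat multiset \<Rightarrow> nat list list" where "g = (\<lambda>M. [sorted_list_of_multiset M])"
  have ssyt: "ssyt n [m] = {[row] |row. length row = m \<and> sorted row \<and> set row \<subseteq> {0..n}}"
    by (fastforce simp: ssyt_def map_eq_Cons_conv)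
  have g: "g M \<in> ssyt n [m]" if "M \<in> elts (mset_crystal n m)" for M
    using that unfolding ssyt g_def mset_crystal_def
    by (auto simp: size_mset[symmetric] simp del: size_mset)
  have bij: "bij_betw g (elts (mset_crystal n m)) (elts (tableau_crystal n [m]))"
    unfolding bij_betw_def
  proof
    show "inj_on g (elts (mset_crystal n m))"
      by (rule inj_onI) (metis g_def list.inject mset_sorted_list_of_multiset)
    have "t \<in> g ` elts (mset_crystal n m)" if t: "t \<in> ssyt n [m]" for t
    proof -
      obtain row where row: "t = [row]" "length row = m" "sorted row" "set row \<subseteq> {0..n}"
        using t unfolding ssyt by blast
      then have "t = g (mset row)" by (simp add: g_def sorted_sort_id)
      moreover have "mset row \<in> elts (mset_crystal n m)" using row by (auto simp: mset_crystal_def)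
      ultimately show ?thesis by blast
    qed
    then show "g ` elts (mset_crystal n m) = elts (tableau_crystal n [m])"
      using g by (auto simp: tableau_crystal_def induced_crystal_def)
  qed
  have read: "middle_eastern_reading (g M) = desc M" for M
    by (simp add: middle_eastern_reading_def g_def desc_def)
  have inv: "inv_into (ssyt n [m]) middle_eastern_reading (desc M) = g M"
    if "M \<in> elts (mset_crystal n m)" for M
    by (rule inv_into_f_eq)
      (use g[OF that] read in \<open>auto simp: inj_on_def ssyt middle_eastern_reading_def\<close>)
  have "crystal_iso n g (mset_crystal n m) (tableau_crystal n [m])"
    unfolding crystal_iso_def
  proof (intro conjI ballI bij)
    fix M assume M: "M \<in> elts (mset_crystal n m)"
    then have s: "size M = Suc N" "set_mset M \<subseteq> {..n}"
      by (auto simp: mset_crystal_def N)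
    show "wt (tableau_crystal n [m]) (g M) = wt (mset_crystal n m) M"
      \<comment> \<open>The weight clause of \<open>crystal_power_desc\<close> comes with some index
        of \<open>{1..n}\<close>; \<open>n \<ge> 1\<close> provides the index 1.\<close>
      using crystal_power_desc[OF s, of 1] assms(1)
      by (simp add: tableau_crystal_def induced_crystal_def read mset_crystal_def N)
    fix i assume i: "i \<in> {1..n}"
    interpret gl_crystal n "mset_crystal n m" by (rule gl_crystal_mset_crystal)
    note p = crystal_power_desc[OF s i, folded N]
    show "eps (tableau_crystal n [m]) i (g M) = eps (mset_crystal n m) i M"
      "phi (tableau_crystal n [m]) i (g M) = phi (mset_crystal n m) i M"
      using p by (simp_all add: tableau_crystal_def induced_crystal_def read mset_crystal_def)
    have "etil (tableau_crystal n [m]) i (g M) =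
        map_option (inv_into (ssyt n [m]) middle_eastern_reading) (map_option desc (etil (mset_crystal n m) i M))"
      using p by (simp add: tableau_crystal_def induced_crystal_def read mset_crystal_def)
    then show "etil (tableau_crystal n [m]) i (g M) = map_option g (etil (mset_crystal n m) i M)"
      using etil_closed[OF i M] inv by (cases "etil (mset_crystal n m) i M") simp_all
    have "ftil (tableau_crystal n [m]) i (g M) =
        map_option (inv_into (ssyt n [m]) middle_eastern_reading) (map_option desc (ftil (mset_crystal n m) i M))"
      using p by (simp add: tableau_crystal_def induced_crystal_def read mset_crystal_def)
    then show "ftil (tableau_crystal n [m]) i (g M) = map_option g (ftil (mset_crystal n m) i M)"
      using ftil_closed[OF i M] inv by (cases "ftil (mset_crystal n m) i M") simp_all
  qed
  then show ?thesis by (simp add: g_def)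
qed

section \<open>Left modules and extension of scalars\<close>

context left_module
begin

lemma smult_l_null: "x \<in> carrier M \<Longrightarrow> \<zero> \<odot>\<^bsub>M\<^esub> x = \<zero>\<^bsub>M\<^esub>"
  by (metis M.add.r_cancel_one' R.l_zero R.zero_closed smult_closed smult_l_distr)

lemma smult_r_null: "a \<in> carrier R \<Longrightarrow> a \<odot>\<^bsub>M\<^esub> \<zero>\<^bsub>M\<^esub> = \<zero>\<^bsub>M\<^esub>"
  by (metis M.add.r_cancel_one' M.l_zero M.zero_closed smult_closed smult_r_distr)

lemma smult_l_minus:
  assumes "a \<in> carrier R" "x \<in> carrier M"
  shows "(\<ominus> a) \<odot>\<^bsub>M\<^esub> x = \<ominus>\<^bsub>M\<^esub> (a \<odot>\<^bsub>M\<^esub> x)"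
proof -
  have "(\<ominus> a) \<odot>\<^bsub>M\<^esub> x \<oplus>\<^bsub>M\<^esub> a \<odot>\<^bsub>M\<^esub> x = \<zero>\<^bsub>M\<^esub>"
    using assms smult_l_distr[of "\<ominus> a" a x] by (simp add: R.l_neg smult_l_null)
  then show ?thesis
    using assms by (simp add: M.minus_equality smult_closed)
qed

lemma smult_r_minus:
  assumes "a \<in> carrier R" "x \<in> carrier M"
  shows "a \<odot>\<^bsub>M\<^esub> (\<ominus>\<^bsub>M\<^esub> x) = \<ominus>\<^bsub>M\<^esub> (a \<odot>\<^bsub>M\<^esub> x)"
proof -
  have "a \<odot>\<^bsub>M\<^esub> (\<ominus>\<^bsub>M\<^esub> x) \<oplus>\<^bsub>M\<^esub> a \<odot>\<^bsub>M\<^esub> x = \<zero>\<^bsub>M\<^esub>"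
    using assms smult_r_distr[of a "\<ominus>\<^bsub>M\<^esub> x" x] by (simp add: M.l_neg smult_r_null)
  then show ?thesis
    using assms by (simp add: M.minus_equality smult_closed)
qed

lemma smult_finsum_left:
  assumes "finite S" "\<And>s. s \<in> S \<Longrightarrow> a s \<in> carrier R" "x \<in> carrier M"
  shows "(finsum R a S) \<odot>\<^bsub>M\<^esub> x = finsum M (\<lambda>s. a s \<odot>\<^bsub>M\<^esub> x) S"
  using assms
proof (induction S rule: finite_induct)
  case empty
  then show ?case by (simp add: smult_l_null)
next
  case (insert s S)
  have "a \<in> S \<rightarrow> carrier R" "(\<lambda>s. a s \<odot>\<^bsub>M\<^esub> x) \<in> S \<rightarrow> carrier M"
    using insert.prems by (auto simp: smult_closed)
  then show ?case
    using insert by (simp add: smult_l_distr smult_closed R.finsum_closed)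
qed

end

lemma modules_isomorphic_sym:
  assumes "left_module R M" "modules_isomorphic R M N"
  shows "modules_isomorphic R N M"
proof -
  interpret left_module R M by fact
  obtain f where f: "f \<in> iso (add_monoid M) (add_monoid N)"
    and lin: "\<And>a v. \<lbrakk>a \<in> carrier R; v \<in> carrier M\<rbrakk> \<Longrightarrow> f (a \<odot>\<^bsub>M\<^esub> v) = a \<odot>\<^bsub>N\<^esub> f v"
    using assms(2) by (auto simp: modules_isomorphic_def)
  define g where "g = inv_into (carrier M) f"
  have bij: "bij_betw f (carrier M) (carrier N)" using f by (simp add: iso_def)
  have "g \<in> iso (add_monoid N) (add_monoid M)"
    using M.add.iso_set_sym[OF f] by (simp add: g_def)
  moreover have "g (a \<odot>\<^bsub>N\<^esub> w) = a \<odot>\<^bsub>M\<^esub> g w" if "a \<in> carrier R" "w \<in> carrier N" for a w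
  proof -
    have w: "f (g w) = w" "g w \<in> carrier M"
      using bij that(2) unfolding g_def
      by (auto simp: bij_betw_inv_into_right bij_betw_def inv_into_into)
    have "g (a \<odot>\<^bsub>N\<^esub> f (g w)) = g (f (a \<odot>\<^bsub>M\<^esub> g w))"
      using lin[OF that(1) w(2)] by simp
    also have "\<dots> = a \<odot>\<^bsub>M\<^esub> g w"
      unfolding g_def using bij_betw_inv_into_left[OF bij smult_closed[OF that(1) w(2)]]
      by (simp add: g_def)
    finally show ?thesis by (simp add: w)
  qed
  ultimately show ?thesis unfolding modules_isomorphic_def by blast
qed

lemma modules_isomorphic_trans:
  assumes "modules_isomorphic R M N" "modules_isomorphic R N K"
  shows "modules_isomorphic R M K"
proof -
  obtain f where f: "f \<in> iso (add_monoid M) (add_monoid N)"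
    and f': "\<And>a v. \<lbrakk>a \<in> carrier R; v \<in> carrier M\<rbrakk> \<Longrightarrow> f (a \<odot>\<^bsub>M\<^esub> v) = a \<odot>\<^bsub>N\<^esub> f v"
    using assms(1) by (auto simp: modules_isomorphic_def)
  obtain g where g: "g \<in> iso (add_monoid N) (add_monoid K)"
    and g': "\<And>a v. \<lbrakk>a \<in> carrier R; v \<in> carrier N\<rbrakk> \<Longrightarrow> g (a \<odot>\<^bsub>N\<^esub> v) = a \<odot>\<^bsub>K\<^esub> g v"
    using assms(2) by (auto simp: modules_isomorphic_def)
  have "g \<circ> f \<in> iso (add_monoid M) (add_monoid K)"
    using iso_set_trans[OF f g] .
  moreover have "f v \<in> carrier N" if "v \<in> carrier M" for v
    using f that by (auto simp: iso_def bij_betw_def)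
  ultimately show ?thesis
    unfolding modules_isomorphic_def by (intro bexI[of _ "g \<circ> f"]) (simp_all add: f' g')
qed

text \<open>The assumption on \<open>f\<close> is closedness alone, so that the non-unital maps
  \<open>psi\<close> fit.\<close>

locale scalar_extension = left_module R M + A: ring A
  for R :: "('r, 'p) ring_scheme" and M :: "('r, 'v, 's) module_scheme" and A :: "('a, 'q) ring_scheme" +
  fixes f :: "'r \<Rightarrow> 'a"
  assumes f_closed: "r \<in> carrier R \<Longrightarrow> f r \<in> carrier A"
begin

text \<open>These give names to what \<open>extend_scalars\<close> binds locally:
  \<open>act b\<close> lifts left multiplication by \<open>b\<close> to the free group, and
  \<open>tens a v\<close> is the class of the pure tensor of \<open>a\<close> and
  \<open>v\<close>.\<close>

definition G where "G = free_Abelian_group (carrier A \<times> carrier M)"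
definition H where "H = generate G (tensor_relations R A f M)"
definition act where "act b = frag_extend (\<lambda>(a, v). frag_of (b \<otimes>\<^bsub>A\<^esub> a, v :: 'v))"
definition E where "E = extend_scalars R A f M"
definition tens where "tens a v = H #>\<^bsub>G\<^esub> frag_of (a, v)"

sublocale G: comm_group G
  unfolding G_def by (rule abelian_free_Abelian_group)

lemma G_simps: "\<one>\<^bsub>G\<^esub> = 0" "x \<otimes>\<^bsub>G\<^esub> y = x + y" "x \<in> carrier G \<longleftrightarrow>
  Poly_Mapping.keys x \<subseteq> carrier A \<times> carrier M"
  "x \<in> carrier G \<Longrightarrow> inv\<^bsub>G\<^esub> x = - x"
  by (simp_all add: G_def)

lemma frag_of_G: "a \<in> carrier A \<Longrightarrow> v \<in> carrier M \<Longrightarrow> frag_of (a, v) \<in> carrier G"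
  by (simp add: G_def)

lemma diff_G: "x \<in> carrier G \<Longrightarrow> y \<in> carrier G \<Longrightarrow> x - y \<in> carrier G"
  unfolding G_simps by (meson Un_least keys_diff order_trans)

lemma add_G: "x \<in> carrier G \<Longrightarrow> y \<in> carrier G \<Longrightarrow> x + y \<in> carrier G"
  using G.m_closed by (simp add: G_simps)

lemma relations_G: "tensor_relations R A f M \<subseteq> carrier G"
  unfolding tensor_relations_def
  by (auto intro!: diff_G frag_of_G f_closed smult_closed)

lemma subgroup_H: "subgroup H G"
  unfolding H_def by (rule G.generate_is_subgroup[OF relations_G])

sublocale H: subgroup H G by (rule subgroup_H)

lemma normal_H: "H \<lhd> G"
  by (rule G.subgroup_imp_normal[OF subgroup_H])

sublocale HN: normal H G by (rule normal_H)

lemma H_diff: "x \<in> H \<Longrightarrow> y \<in> H \<Longrightarrow> x - y \<in> H"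
  using H.m_closed[of x "inv\<^bsub>G\<^esub> y"] H.m_inv_closed[of y] H.mem_carrier[of y]
  by (simp add: G_simps)

lemma H_zero: "0 \<in> H"
  using H.one_closed by (simp add: G_simps)

lemma relation_H: "x \<in> tensor_relations R A f M \<Longrightarrow> x \<in> H"
  unfolding H_def by (rule generate.incl)

lemma coset_eq: "x \<in> carrier G \<Longrightarrow> y \<in> carrier G \<Longrightarrow> x - y \<in> H \<Longrightarrow> H #>\<^bsub>G\<^esub> x = H #>\<^bsub>G\<^esub> y"
proof (rule G.repr_independence[OF _ _ subgroup_H, symmetric])
  assume "x - y \<in> H"
  then show "x \<in> H #>\<^bsub>G\<^esub> y"
    unfolding r_coset_def by (auto simp: G_simps intro!: bexI[of _ "x - y"])
qed

lemma coset_add: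
  "x \<in> carrier G \<Longrightarrow> y \<in> carrier G \<Longrightarrow> (H #>\<^bsub>G\<^esub> x) <#>\<^bsub>G\<^esub> (H #>\<^bsub>G\<^esub> y) = H #>\<^bsub>G\<^esub> (x + y)"
  using HN.rcos_sum[of x y] by (simp add: G_simps)

lemma act_simps:
  "act b (frag_of (a, v)) = frag_of (b \<otimes>\<^bsub>A\<^esub> a, v)"
  "act b (x + y) = act b x + act b y" "act b (x - y) = act b x - act b y" "act b (- x) = - act b x"
  "act b 0 = 0"
  by (simp_all add: act_def frag_extend_add frag_extend_diff frag_extend_minus)

lemma G_induct [consumes 1, case_names zero diff frag]:
  assumes "x \<in> carrier G" "P 0"
    "\<And>x y. \<lbrakk>x \<in> carrier G; y \<in> carrier G; P x; P y\<rbrakk> \<Longrightarrow> P (x - y)"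
    "\<And>a v. \<lbrakk>a \<in> carrier A; v \<in> carrier M\<rbrakk> \<Longrightarrow> P (frag_of (a, v))"
  shows "P x"
  using assms(1) unfolding G_simps
  by (induction x rule: free_Abelian_group_induct) (use assms in \<open>auto simp: G_simps\<close>)

lemma act_G:
  assumes "b \<in> carrier A" "x \<in> carrier G"
  shows "act b x \<in> carrier G"
  using assms(2)
proof (induction x rule: G_induct)
  case zero
  then show ?case by (simp add: act_simps G_simps)
next
  case (diff x y)
  then show ?case by (simp add: act_simps diff_G)
next
  case (frag a v)
  then show ?case using assms(1) by (simp add: act_simps frag_of_G)
qed

text \<open>Left multiplication turns each relation into one of the same kind, by distributivity
  and, for the balancing relation, by associativity in \<open>A\<close>. Hence the action descends
  to the quotient.\<close>

lemma act_relations: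
  assumes b: "b \<in> carrier A" and x: "x \<in> tensor_relations R A f M"
  shows "act b x \<in> tensor_relations R A f M"
proof -
  consider (left) a a' v where "x = frag_of (a \<oplus>\<^bsub>A\<^esub> a', v) - frag_of (a, v) - frag_of (a', v)"
      "a \<in> carrier A" "a' \<in> carrier A" "v \<in> carrier M"
    | (right) a v w where "x = frag_of (a, v \<oplus>\<^bsub>M\<^esub> w) - frag_of (a, v) - frag_of (a, w)"
      "a \<in> carrier A" "v \<in> carrier M" "w \<in> carrier M"
    | (bal) a r v where "x = frag_of (a \<otimes>\<^bsub>A\<^esub> f r, v) - frag_of (a, r \<odot>\<^bsub>M\<^esub> v)"
      "a \<in> carrier A" "r \<in> carrier R" "v \<in> carrier M"
    using x unfolding tensor_relations_def by blast
  then show ?thesis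
  proof cases
    case left
    then have "act b x = frag_of ((b \<otimes>\<^bsub>A\<^esub> a) \<oplus>\<^bsub>A\<^esub> (b \<otimes>\<^bsub>A\<^esub> a'), v) - frag_of (b \<otimes>\<^bsub>A\<^esub> a, v) - frag_of (b \<otimes>\<^bsub>A\<^esub> a', v)"
      using b by (simp add: act_simps A.r_distr)
    then show ?thesis unfolding tensor_relations_def
      using left b by blast
  next
    case right
    then have "act b x = frag_of (b \<otimes>\<^bsub>A\<^esub> a, v \<oplus>\<^bsub>M\<^esub> w) - frag_of (b \<otimes>\<^bsub>A\<^esub> a, v) - frag_of (b \<otimes>\<^bsub>A\<^esub> a, w)"
      using b by (simp add: act_simps)
    then show ?thesis unfolding tensor_relations_def
      using right b by blast
  next
    case bal
    then have "act b x = frag_of ((b \<otimes>\<^bsub>A\<^esub> a) \<otimes>\<^bsub>A\<^esub> f r, v) - frag_of (b \<otimes>\<^bsub>A\<^esub> a, r \<odot>\<^bsub>M\<^esub> v)"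
      using b by (simp add: act_simps A.m_assoc f_closed)
    then show ?thesis unfolding tensor_relations_def
      using bal b by blast
  qed
qed

lemma act_H:
  assumes b: "b \<in> carrier A" and x: "x \<in> H"
  shows "act b x \<in> H"
  using x[unfolded H_def]
proof (induction x rule: generate.induct)
  case one
  then show ?case by (simp add: act_simps G_simps H_zero)
next
  case (incl h)
  then show ?case by (simp add: act_relations[OF b] relation_H)
next
  case (inv h)
  then have "act b (inv\<^bsub>G\<^esub> h) = inv\<^bsub>G\<^esub> (act b h)"
    using relations_G act_G[OF b] by (auto simp: G_simps(4) act_simps subset_iff)
  then show ?case using inv by (simp add: act_relations[OF b] relation_H)
next
  case (eng h1 h2)
  then show ?case using H.m_closed by (simp add: G_simps act_simps)
qed

lemma E_simps:
  "carrier E = rcosets\<^bsub>G\<^esub> H" "\<zero>\<^bsub>E\<^esub> = H" "X \<oplus>\<^bsub>E\<^esub> Y = X <#>\<^bsub>G\<^esub> Y"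
  by (simp_all add: E_def extend_scalars_def Let_def G_def H_def FactGroup_def)

lemma coset_E: "x \<in> carrier G \<Longrightarrow> H #>\<^bsub>G\<^esub> x \<in> carrier E"
  unfolding E_simps by (rule G.rcosetsI[OF H.subset])

lemma coset_ex: "X \<in> carrier E \<Longrightarrow> \<exists>x \<in> carrier G. X = H #>\<^bsub>G\<^esub> x"
  unfolding E_simps RCOSETS_def by auto

text \<open>The image of a coset under \<open>act b\<close> may be only a part of a coset;
  multiplying by \<open>H\<close> in \<open>extend_scalars\<close> fills it up, and stability of
  \<open>H\<close> keeps it from growing further.\<close>

lemma smult_coset:
  assumes b: "b \<in> carrier A" and x: "x \<in> carrier G"
  shows "b \<odot>\<^bsub>E\<^esub> (H #>\<^bsub>G\<^esub> x) = H #>\<^bsub>G\<^esub> act b x"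
proof -
  have "b \<odot>\<^bsub>E\<^esub> (H #>\<^bsub>G\<^esub> x) = H <#>\<^bsub>G\<^esub> (act b ` (H #>\<^bsub>G\<^esub> x))"
    by (simp add: E_def extend_scalars_def Let_def G_def H_def act_def)
  also have "\<dots> = H #>\<^bsub>G\<^esub> act b x"
  proof
    show "H <#>\<^bsub>G\<^esub> act b ` (H #>\<^bsub>G\<^esub> x) \<subseteq> H #>\<^bsub>G\<^esub> act b x"
    proof
      fix y assume "y \<in> H <#>\<^bsub>G\<^esub> act b ` (H #>\<^bsub>G\<^esub> x)"
      then obtain h h' where "h \<in> H" "h' \<in> H" "y = h + act b (h' + x)"
        unfolding set_mult_def r_coset_def by (auto simp: G_simps)
      then have "y = (h + act b h') + act b x" "h + act b h' \<in> H"
        using act_H[OF b] H.m_closed by (simp_all add: act_simps G_simps)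
      then show "y \<in> H #>\<^bsub>G\<^esub> act b x"
        unfolding r_coset_def by (auto simp: G_simps)
    qed
    show "H #>\<^bsub>G\<^esub> act b x \<subseteq> H <#>\<^bsub>G\<^esub> act b ` (H #>\<^bsub>G\<^esub> x)"
      unfolding set_mult_def r_coset_def using H_zero by (force simp: G_simps)
  qed
  finally show ?thesis .
qed

lemma abelian_group_E: "abelian_group E"
proof -
  interpret Q: comm_group "G Mod H" by (rule G.abelian_FactGroup[OF subgroup_H])
  have E: "carrier E = carrier (G Mod H)" "\<zero>\<^bsub>E\<^esub> = \<one>\<^bsub>G Mod H\<^esub>" "X \<oplus>\<^bsub>E\<^esub> Y = X \<otimes>\<^bsub>G Mod H\<^esub> Y" for X Y
    by (simp_all add: E_simps FactGroup_def)
  show ?thesis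
    by (rule abelian_groupI; unfold E)
      (rule Q.m_closed Q.one_closed Q.m_assoc Q.m_comm Q.l_one Q.l_inv_ex; assumption)+
qed

text \<open>On the free group \<open>act\<close> is multiplicative in \<open>b\<close> but not
  additive; additivity holds only modulo the relations of additivity in the left factor.\<close>

lemma act_add_H:
  assumes "b \<in> carrier A" "c \<in> carrier A" "x \<in> carrier G"
  shows "act (b \<oplus>\<^bsub>A\<^esub> c) x - (act b x + act c x) \<in> H"
  using assms(3)
proof (induction x rule: G_induct)
  case zero
  then show ?case by (simp add: act_simps H_zero)
next
  case (diff x y)
  have "act (b \<oplus>\<^bsub>A\<^esub> c) (x - y) - (act b (x - y) + act c (x - y)) =
     (act (b \<oplus>\<^bsub>A\<^esub> c) x - (act b x + act c x)) - (act (b \<oplus>\<^bsub>A\<^esub> c) y - (act b y + act c y))"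
    by (simp add: act_simps)
  then show ?case using diff H_diff by metis
next
  case (frag a v)
  have "frag_of ((b \<otimes>\<^bsub>A\<^esub> a) \<oplus>\<^bsub>A\<^esub> (c \<otimes>\<^bsub>A\<^esub> a), v) - frag_of (b \<otimes>\<^bsub>A\<^esub> a, v) - frag_of (c \<otimes>\<^bsub>A\<^esub> a, v) \<in> H"
    by (rule relation_H) (use frag assms in \<open>unfold tensor_relations_def, blast\<close>)
  then show ?case using frag assms by (simp add: act_simps A.l_distr diff_diff_eq)
qed

lemma act_mult:
  assumes "b \<in> carrier A" "c \<in> carrier A" "x \<in> carrier G"
  shows "act (b \<otimes>\<^bsub>A\<^esub> c) x = act b (act c x)"
  using assms(3)
  by (induction x rule: G_induct) (simp_all add: act_simps A.m_assoc assms)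

lemma act_one: "x \<in> carrier G \<Longrightarrow> act \<one>\<^bsub>A\<^esub> x = x"
  by (induction x rule: G_induct) (simp_all add: act_simps)

lemma left_module_E: "left_module A E"
proof -
  interpret E: abelian_group E by (rule abelian_group_E)
  show ?thesis
  proof
    fix b X assume b: "b \<in> carrier A" and "X \<in> carrier E"
    then obtain x where x: "x \<in> carrier G" "X = H #>\<^bsub>G\<^esub> x" using coset_ex by blast
    show "b \<odot>\<^bsub>E\<^esub> X \<in> carrier E"
      using x b by (simp add: smult_coset coset_E act_G)
    {
      fix c assume c: "c \<in> carrier A"
      show "(b \<oplus>\<^bsub>A\<^esub> c) \<odot>\<^bsub>E\<^esub> X = b \<odot>\<^bsub>E\<^esub> X \<oplus>\<^bsub>E\<^esub> c \<odot>\<^bsub>E\<^esub> X"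
        using x b c by (simp add: smult_coset E_simps(3) coset_add act_G)
          (rule coset_eq; simp add: act_G add_G act_add_H)
      show "(b \<otimes>\<^bsub>A\<^esub> c) \<odot>\<^bsub>E\<^esub> X = b \<odot>\<^bsub>E\<^esub> (c \<odot>\<^bsub>E\<^esub> X)"
        using x b c by (simp add: smult_coset act_mult act_G)
    }
    fix Y assume "Y \<in> carrier E"
    then obtain y where y: "y \<in> carrier G" "Y = H #>\<^bsub>G\<^esub> y" using coset_ex by blast
    show "b \<odot>\<^bsub>E\<^esub> (X \<oplus>\<^bsub>E\<^esub> Y) = b \<odot>\<^bsub>E\<^esub> X \<oplus>\<^bsub>E\<^esub> b \<odot>\<^bsub>E\<^esub> Y"
      using x y b by (simp add: smult_coset E_simps(3) coset_add act_G add_G act_simps)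
  next
    fix X assume "X \<in> carrier E"
    then obtain x where x: "x \<in> carrier G" "X = H #>\<^bsub>G\<^esub> x" using coset_ex by blast
    then show "\<one>\<^bsub>A\<^esub> \<odot>\<^bsub>E\<^esub> X = X" by (simp add: smult_coset act_one)
  qed
qed

lemma tens_closed: "a \<in> carrier A \<Longrightarrow> v \<in> carrier M \<Longrightarrow> tens a v \<in> carrier E"
  unfolding tens_def by (simp add: coset_E frag_of_G)

lemma smult_tens:
  "\<lbrakk>b \<in> carrier A; a \<in> carrier A; v \<in> carrier M\<rbrakk> \<Longrightarrow> b \<odot>\<^bsub>E\<^esub> tens a v = tens (b \<otimes>\<^bsub>A\<^esub> a) v"
  unfolding tens_def by (simp add: smult_coset frag_of_G act_simps)

lemma tens_balanced:
  "\<lbrakk>a \<in> carrier A; r \<in> carrier R; v \<in> carrier M\<rbrakk> \<Longrightarrow> tens (a \<otimes>\<^bsub>A\<^esub> f r) v = tens a (r \<odot>\<^bsub>M\<^esub> v)"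
  unfolding tens_def
  by (rule coset_eq) (auto simp: frag_of_G f_closed smult_closed tensor_relations_def intro!: relation_H)

text \<open>For \<open>v = r w\<close> the tensor of \<open>a\<close> and \<open>v\<close> equals
  that of \<open>a (f r)\<close> and \<open>w\<close>, which is a multiple of the tensor of 1 and
  \<open>w\<close>. Such multiples are closed under differences.\<close>

lemma tens_cyclic:
  assumes w: "w \<in> carrier M" and gen: "\<And>v. v \<in> carrier M \<Longrightarrow> \<exists>r \<in> carrier R. v = r \<odot>\<^bsub>M\<^esub> w"
    and X: "X \<in> carrier E"
  shows "\<exists>b \<in> carrier A. X = b \<odot>\<^bsub>E\<^esub> tens \<one>\<^bsub>A\<^esub> w"
proof -
  interpret E: left_module A E by (rule left_module_E)
  obtain x where x: "x \<in> carrier G" "X = H #>\<^bsub>G\<^esub> x" using coset_ex[OF X] by blast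
  have t: "tens \<one>\<^bsub>A\<^esub> w \<in> carrier E" by (simp add: tens_closed w)
  have "\<exists>b \<in> carrier A. H #>\<^bsub>G\<^esub> x = b \<odot>\<^bsub>E\<^esub> tens \<one>\<^bsub>A\<^esub> w"
    using x(1)
  proof (induction x rule: G_induct)
    case zero
    have "H #>\<^bsub>G\<^esub> 0 = \<zero>\<^bsub>A\<^esub> \<odot>\<^bsub>E\<^esub> tens \<one>\<^bsub>A\<^esub> w"
      using G.coset_mult_one[OF H.subset] t by (simp add: G_simps E_simps E.smult_l_null)
    then show ?case by blast
  next
    case (diff x y)
    then obtain b c where bc: "b \<in> carrier A" "c \<in> carrier A"
      "H #>\<^bsub>G\<^esub> x = b \<odot>\<^bsub>E\<^esub> tens \<one>\<^bsub>A\<^esub> w" "H #>\<^bsub>G\<^esub> y = c \<odot>\<^bsub>E\<^esub> tens \<one>\<^bsub>A\<^esub> w" by blast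
    \<comment> \<open>Both candidates for the difference give the same result after adding the coset
      of \<open>y\<close> back, and this summand is cancelled.\<close>
    have "(H #>\<^bsub>G\<^esub> (x - y)) \<oplus>\<^bsub>E\<^esub> (H #>\<^bsub>G\<^esub> y) = H #>\<^bsub>G\<^esub> x"
      using diff by (simp add: E_simps coset_add diff_G)
    moreover have "(b \<ominus>\<^bsub>A\<^esub> c) \<odot>\<^bsub>E\<^esub> tens \<one>\<^bsub>A\<^esub> w \<oplus>\<^bsub>E\<^esub> (H #>\<^bsub>G\<^esub> y) = H #>\<^bsub>G\<^esub> x"
      using bc t E.smult_l_distr[of "b \<ominus>\<^bsub>A\<^esub> c" c "tens \<one>\<^bsub>A\<^esub> w"]
      by (simp add: A.minus_eq A.a_assoc A.l_neg)
    moreover have "H #>\<^bsub>G\<^esub> (x - y) \<in> carrier E" "H #>\<^bsub>G\<^esub> y \<in> carrier E"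
      "(b \<ominus>\<^bsub>A\<^esub> c) \<odot>\<^bsub>E\<^esub> tens \<one>\<^bsub>A\<^esub> w \<in> carrier E"
      using diff bc t by (simp_all add: coset_E diff_G E.smult_closed)
    ultimately have "H #>\<^bsub>G\<^esub> (x - y) = (b \<ominus>\<^bsub>A\<^esub> c) \<odot>\<^bsub>E\<^esub> tens \<one>\<^bsub>A\<^esub> w"
      by (metis E.M.add.right_cancel)
    then show ?case using bc by blast
  next
    case (frag a v)
    then obtain r where r: "r \<in> carrier R" "v = r \<odot>\<^bsub>M\<^esub> w" using gen by blast
    have "tens a v = tens ((a \<otimes>\<^bsub>A\<^esub> f r) \<otimes>\<^bsub>A\<^esub> \<one>\<^bsub>A\<^esub>) w"
      using frag r w by (simp add: tens_balanced f_closed)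
    also have "\<dots> = (a \<otimes>\<^bsub>A\<^esub> f r) \<odot>\<^bsub>E\<^esub> tens \<one>\<^bsub>A\<^esub> w"
      using frag r w by (simp add: smult_tens f_closed)
    finally show ?case using frag r by (auto simp: tens_def f_closed)
  qed
  then show ?thesis using x by simp
qed

text \<open>
  A balanced map into a ring detects that a tensor is nonzero, so that the universal property of
  the quotient is not needed in full.
\<close>

lemma tens_nonzero:
  fixes B :: "'a \<Rightarrow> 'v \<Rightarrow> 'k::ring_1"
  assumes add_l: "\<And>a b v. \<lbrakk>a \<in> carrier A; b \<in> carrier A; v \<in> carrier M\<rbrakk> \<Longrightarrow> B (a \<oplus>\<^bsub>A\<^esub> b) v = B a v + B b v"
    and add_r: "\<And>a v w. \<lbrakk>a \<in> carrier A; v \<in> carrier M; w \<in> carrier M\<rbrakk> \<Longrightarrow> B a (v \<oplus>\<^bsub>M\<^esub> w) = B a v + B a w"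
    and bal: "\<And>a r v. \<lbrakk>a \<in> carrier A; r \<in> carrier R; v \<in> carrier M\<rbrakk> \<Longrightarrow> B (a \<otimes>\<^bsub>A\<^esub> f r) v = B a (r \<odot>\<^bsub>M\<^esub> v)"
    and av: "a \<in> carrier A" "v \<in> carrier M" and nz: "B a v \<noteq> 0"
  shows "tens a v \<noteq> \<zero>\<^bsub>E\<^esub>"
proof
  \<comment> \<open>The additive extension of \<open>B\<close> to the free abelian group; integer
    multiplicities act through \<open>of_int\<close>. It kills the relations, hence
    \<open>H\<close>, but not the given pure tensor.\<close>
  define h :: "('a \<times> 'v \<Rightarrow>\<^sub>0 int) \<Rightarrow> 'k" where
    "h x = (\<Sum>p\<in>Poly_Mapping.keys x. of_int (Poly_Mapping.lookup x p) * case_prod B p)" for x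
  have h_sup: "h x = (\<Sum>p\<in>S. of_int (Poly_Mapping.lookup x p) * case_prod B p)"
    if "finite S" "Poly_Mapping.keys x \<subseteq> S" for x S
    unfolding h_def by (rule sum.mono_neutral_left) (use that in \<open>auto simp: in_keys_iff\<close>)
  have h_diff: "h (x - y) = h x - h y" for x y
  proof -
    let ?S = "Poly_Mapping.keys x \<union> Poly_Mapping.keys y"
    have "h x = (\<Sum>p\<in>?S. of_int (Poly_Mapping.lookup x p) * case_prod B p)"
      "h y = (\<Sum>p\<in>?S. of_int (Poly_Mapping.lookup y p) * case_prod B p)"
      "h (x - y) = (\<Sum>p\<in>?S. of_int (Poly_Mapping.lookup (x - y) p) * case_prod B p)"
      by (rule h_sup; use keys_diff[of x y] in auto)+
    then show ?thesis
      by (simp add: lookup_minus algebra_simps sum_subtractf)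
  qed
  have h_frag: "h (frag_of (a, v)) = B a v" for a v
    by (simp add: h_def)
  have h0: "h 0 = 0" by (simp add: h_def)
  have h_add: "h (x + y) = h x + h y" for x y
    using h_diff[of x "0 - y"] h_diff[of 0 y] by (simp add: h0)
  have rel: "h x = 0" if "x \<in> tensor_relations R A f M" for x
    using that unfolding tensor_relations_def
    by (auto simp: h_diff h_frag add_l add_r bal)
  have H0: "h x = 0" if "x \<in> H" for x
    using that[unfolded H_def]
  proof (induction x rule: generate.induct)
    case one
    then show ?case by (simp add: G_simps h0)
  next
    case (inv x)
    then have "x \<in> carrier G" using relations_G by blast
    then show ?case using rel[OF inv] h_diff[of 0 x] by (simp add: G_simps(4) h0)
  qed (simp_all add: rel G_simps h_add)
  assume "tens a v = \<zero>\<^bsub>E\<^esub>"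
  then have "H #>\<^bsub>G\<^esub> frag_of (a, v) = H" by (simp add: tens_def E_simps)
  then have "frag_of (a, v) \<in> H"
    using G.rcos_self[OF frag_of_G[OF av] subgroup_H] by simp
  then show False using H0[of "frag_of (a, v)"] nz by (simp add: h_frag)
qed

end

section \<open>Planar rooks and colourings\<close>

lemma u_elt_eq_iff [simp]: "u_elt i = u_elt j \<longleftrightarrow> i = j"
  unfolding u_elt_def by (metis zero_neq_one)

lemma u_elt_nonzero [simp]: "u_elt i \<noteq> 0" "0 \<noteq> u_elt i"
  unfolding u_elt_def fun_eq_iff zero_fun_def by auto

lemma u_elt_mult: "u_elt i * u_elt j = (if i = j then u_elt i else 0)"
  by (auto simp: u_elt_def fun_eq_iff)

text \<open>An order-preserving bijection between the indices of one colour in two lists is the one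
  that matches equal ranks.\<close>

definition rank :: "nat list \<Rightarrow> nat \<Rightarrow> nat" where
  "rank S r = count_list (take r S) (S ! r)"

definition colorings :: "nat \<Rightarrow> nat \<Rightarrow> nat list set" where
  "colorings n m = {T. length T = m \<and> set T \<subseteq> {..n}}"

text \<open>
  The \<open>p\<close>-th row of colour \<open>k\<close> is joined to the \<open>p\<close>-th column of colour \<open>k\<close>, for \<open>k \<noteq> 0\<close>.
\<close>

definition rook :: "nat list \<Rightarrow> nat list \<Rightarrow> rook" where
  "rook S T = mat (length S) (length T)
     (\<lambda>(r, c). if S ! r = T ! c \<and> S ! r \<noteq> 0 \<and> rank S r = rank T c then u_elt (S ! r) else 0)"

lemma count_list_take: "r \<le> length S \<Longrightarrow> count_list (take r S) k = card {i. i < r \<and> S ! i = k}"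
  unfolding count_list_eq_length_filter length_filter_conv_card
  by (rule arg_cong[of _ _ card]) auto

lemma rank_less: "\<lbrakk>r < r'; r' < length S; S ! r = S ! r'\<rbrakk> \<Longrightarrow> rank S r < rank S r'"
  unfolding rank_def by (auto simp: count_list_take intro!: psubset_card_mono)

lemma rank_inj: "\<lbrakk>r < length S; r' < length S; S ! r = S ! r'; rank S r = rank S r'\<rbrakk> \<Longrightarrow> r = r'"
  by (metis linorder_neqE_nat nless_le rank_less)

lemma rank_count: "r < length S \<Longrightarrow> rank S r < count_list S (S ! r)"
  using count_list_take[of "length S" S "S ! r"]
  unfolding rank_def by (auto simp: count_list_take intro!: psubset_card_mono)

text \<open>Together with \<open>rank_inj\<close> and \<open>rank_count\<close> this says that the
  ranks within a colour run through \<open>0..<count\<close> without repetition. A head of the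
  colour in question shifts the later ranks by one.\<close>

lemma rank_ex: "p < count_list S k \<Longrightarrow> \<exists>r < length S. S ! r = k \<and> rank S r = p"
proof (induction S arbitrary: p)
  case (Cons a S)
  show ?case
  proof (cases "a = k \<and> p = 0")
    case True
    then show ?thesis by (intro exI[of _ 0]) (simp add: rank_def)
  next
    case False
    define p' where "p' = (if a = k then p - 1 else p)"
    have "p' < count_list S k" using Cons.prems False by (auto simp: p'_def split: if_splits)
    then obtain r where "r < length S" "S ! r = k" "rank S r = p'" using Cons.IH by blast
    then show ?thesis using False
      by (intro exI[of _ "Suc r"]) (auto simp: rank_def p'_def)
  qed
qed simp

lemma count_list_mset: "mset S = mset T \<Longrightarrow> count_list S k = count_list T k"
  by (metis count_mset)

text \<open>Every row has a partner column of the same colour and rank. This includes colour 0, for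
  which \<open>rook\<close> draws no edge.\<close>

lemma match_ex:
  assumes "mset S = mset T" "r < length S"
  shows "\<exists>c < length T. T ! c = S ! r \<and> rank T c = rank S r"
  using rank_ex[of "rank S r" T "S ! r"] rank_count[OF assms(2)] count_list_mset[OF assms(1), of "S ! r"]
  by auto

lemma rook_dims [simp]: "dim_row (rook S T) = length S" "dim_col (rook S T) = length T"
  by (simp_all add: rook_def)

lemma rook_carrier: "rook S T \<in> carrier_mat (length S) (length T)"
  by (simp add: rook_def)

lemma rook_entry:
  "\<lbrakk>r < length S; c < length T\<rbrakk> \<Longrightarrow> rook S T $$ (r, c) =
     (if S ! r = T ! c \<and> S ! r \<noteq> 0 \<and> rank S r = rank T c then u_elt (S ! r) else 0)"
  by (simp add: rook_def)

lemma rook_entry_u: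
  "\<lbrakk>r < length S; c < length T\<rbrakk> \<Longrightarrow> rook S T $$ (r, c) = u_elt k \<longleftrightarrow>
     S ! r = k \<and> T ! c = k \<and> k \<noteq> 0 \<and> rank S r = rank T c"
  by (auto simp: rook_entry)

lemma rook_entry_nonzero:
  "\<lbrakk>r < length S; c < length T\<rbrakk> \<Longrightarrow> rook S T $$ (r, c) \<noteq> 0 \<longleftrightarrow>
     S ! r = T ! c \<and> S ! r \<noteq> 0 \<and> rank S r = rank T c"
  by (simp add: rook_entry)

lemma rook_row:
  "\<lbrakk>mset S = mset T; r < length S; k \<noteq> 0\<rbrakk> \<Longrightarrow>
    (\<exists>c < length T. rook S T $$ (r, c) = u_elt k) \<longleftrightarrow> S ! r = k"
  using match_ex[of S T r] by (auto simp: rook_entry_u)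

lemma rook_col:
  "\<lbrakk>mset S = mset T; c < length T; k \<noteq> 0\<rbrakk> \<Longrightarrow>
    (\<exists>r < length S. rook S T $$ (r, c) = u_elt k) \<longleftrightarrow> T ! c = k"
  using match_ex[of T S c] by (auto simp: rook_entry_u)

text \<open>Colour 0 leaves no entry in the matrix, so colourings read off from matrices can be
  compared only at nonzero colours; an index with none of these has colour 0.\<close>

lemma list_eq_nonzeroI:
  assumes "length S = length T" "\<And>i k. i < length S \<Longrightarrow> k \<noteq> (0::nat) \<Longrightarrow> S ! i = k \<longleftrightarrow> T ! i = k"
  shows "S = T"
  by (rule nth_equalityI) (use assms in \<open>metis\<close>)+

lemma rook_inj:
  assumes "mset S = mset T" "mset S' = mset T'" "rook S T = rook S' T'"
  shows "S = S'" "T = T'"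
proof -
  have len: "length S = length S'" "length T = length T'"
    using assms(3) by (metis rook_dims)+
  show "S = S'" by (rule list_eq_nonzeroI) (use assms len rook_row in metis)+
  show "T = T'" by (rule list_eq_nonzeroI) (use assms len rook_col in metis)+
qed

lemma planar_rookD:
  assumes "d \<in> planar_rook n m"
  shows "d \<in> carrier_mat m m"
    "\<And>r c. \<lbrakk>r < m; c < m; d $$ (r, c) \<noteq> 0\<rbrakk> \<Longrightarrow> \<exists>k. 1 \<le> k \<and> k \<le> n \<and> d $$ (r, c) = u_elt k"
    "\<And>r c k. \<lbrakk>r < m; c < m; d $$ (r, c) = u_elt k\<rbrakk> \<Longrightarrow> 1 \<le> k \<and> k \<le> n"
    "\<And>r c c'. \<lbrakk>r < m; c < m; c' < m; d $$ (r, c) \<noteq> 0; d $$ (r, c') \<noteq> 0\<rbrakk> \<Longrightarrow> c = c'"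
    "\<And>r r' c. \<lbrakk>r < m; r' < m; c < m; d $$ (r, c) \<noteq> 0; d $$ (r', c) \<noteq> 0\<rbrakk> \<Longrightarrow> r = r'"
proof -
  note P = assms[unfolded planar_rook_def mem_Collect_eq]
  note P2 = conjunct2[OF P] and P3 = conjunct2[OF conjunct2[OF P]]
  note * = conjunct1[OF P2]
  show "d \<in> carrier_mat m m" using conjunct1[OF P] .
  show "\<And>r c. \<lbrakk>r < m; c < m; d $$ (r, c) \<noteq> 0\<rbrakk> \<Longrightarrow> \<exists>k. 1 \<le> k \<and> k \<le> n \<and> d $$ (r, c) = u_elt k"
    using * by fastforce
  show "\<And>r c k. \<lbrakk>r < m; c < m; d $$ (r, c) = u_elt k\<rbrakk> \<Longrightarrow> 1 \<le> k \<and> k \<le> n"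
    using * by fastforce
  show "\<And>r c c'. \<lbrakk>r < m; c < m; c' < m; d $$ (r, c) \<noteq> 0; d $$ (r, c') \<noteq> 0\<rbrakk> \<Longrightarrow> c = c'"
    by (rule conjunct1[OF P3, rule_format]) simp_all
  show "\<And>r r' c. \<lbrakk>r < m; r' < m; c < m; d $$ (r, c) \<noteq> 0; d $$ (r', c) \<noteq> 0\<rbrakk> \<Longrightarrow> r = r'"
    by (rule conjunct1[OF conjunct2[OF P3], rule_format]) simp_all
qed

text \<open>If the edges crossed, the other two corners would be zero, as each row has at most one
  nonzero entry, and the forbidden submatrix would appear in columns \<open>c' < c\<close>.\<close>

lemma planar_mono:
  assumes d: "d \<in> planar_rook n m" and "r < r'" "r' < m" "c < m" "c' < m"
    and k: "d $$ (r, c) = u_elt k" "d $$ (r', c') = u_elt k"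
  shows "c < c'"
proof (rule ccontr)
  assume "\<not> c < c'"
  moreover have "c \<noteq> c'" using planar_rookD(5)[OF d, of r r' c] assms by auto
  ultimately have "c' < c" by simp
  have "d $$ (r, c') = 0" "d $$ (r', c) = 0"
    using planar_rookD(4)[OF d, of r c c'] planar_rookD(4)[OF d, of r' c c'] assms \<open>c' < c\<close> by auto
  moreover have "k \<in> {1..n}" using planar_rookD(3)[OF d, of r c k] assms by auto
  ultimately show False
    using conjunct2[OF conjunct2[OF conjunct2[OF conjunct2[OF d[unfolded planar_rook_def mem_Collect_eq]]]]]
      \<open>r < r'\<close> \<open>r' < m\<close> \<open>c' < c\<close> \<open>c < m\<close> k by blast
qed

text \<open>Planarity is asked for in the form of \<open>planar_mono\<close>, which composes and
  restricts more easily than the exclusion of a submatrix.\<close>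

lemma planar_rookI:
  assumes "d \<in> carrier_mat m m"
    "\<And>r c. \<lbrakk>r < m; c < m; d $$ (r, c) \<noteq> 0\<rbrakk> \<Longrightarrow> \<exists>k. 1 \<le> k \<and> k \<le> n \<and> d $$ (r, c) = u_elt k"
    "\<And>r c c'. \<lbrakk>r < m; c < m; c' < m; d $$ (r, c) \<noteq> 0; d $$ (r, c') \<noteq> 0\<rbrakk> \<Longrightarrow> c = c'"
    "\<And>r r' c. \<lbrakk>r < m; r' < m; c < m; d $$ (r, c) \<noteq> 0; d $$ (r', c) \<noteq> 0\<rbrakk> \<Longrightarrow> r = r'"
    "\<And>r r' c c' k. \<lbrakk>r < r'; r' < m; c < m; c' < m; d $$ (r, c) = u_elt k; d $$ (r', c') = u_elt k\<rbrakk> \<Longrightarrow>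
      c < c'"
  shows "d \<in> planar_rook n m"
proof -
  have "d $$ (r, c) \<in> insert 0 (u_elt ` {1..n})" if "r < m" "c < m" for r c
    using assms(2)[OF that] by (cases "d $$ (r, c) = 0") auto
  moreover have "\<not> (\<exists>i\<in>{1..n}. \<exists>r r' c c'. r < r' \<and> r' < m \<and> c < c' \<and> c' < m \<and>
          d $$ (r, c) = 0 \<and> d $$ (r, c') = u_elt i \<and>
          d $$ (r', c) = u_elt i \<and> d $$ (r', c') = 0)"
  proof safe
    fix i r r' c c'
    assume "r < r'" "r' < m" "c < c'" "c' < m" "d $$ (r, c') = u_elt i" "d $$ (r', c) = u_elt i"
    then have "c' < c" using assms(5)[of r r' c' c i] by auto
    then show False using \<open>c < c'\<close> by simp
  qed
  ultimately show ?thesis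
    unfolding planar_rook_def mem_Collect_eq
    by (intro conjI allI impI; (elim conjE)?) (use assms(1,3,4) in simp_all)
qed

lemma rook_planar:
  assumes "S \<in> colorings n m" "T \<in> colorings n m"
  shows "rook S T \<in> planar_rook n m"
proof (rule planar_rookI)
  have len [simp]: "length S = m" "length T = m"
    using assms by (auto simp: colorings_def)
  show "rook S T \<in> carrier_mat m m" using rook_carrier[of S T] by simp
  show "\<exists>k. 1 \<le> k \<and> k \<le> n \<and> rook S T $$ (r, c) = u_elt k"
    if "r < m" "c < m" "rook S T $$ (r, c) \<noteq> 0" for r c
  proof -
    have "S ! r \<le> n" using assms(1) that(1) by (auto simp: colorings_def subset_eq)
    then show ?thesis using that by (auto simp: rook_entry split: if_splits)
  qed
  show "\<And>r c c'. \<lbrakk>r < m; c < m; c' < m; rook S T $$ (r, c) \<noteq> 0; rook S T $$ (r, c') \<noteq> 0\<rbrakk> \<Longrightarrow> c = c'"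
    by (rule rank_inj[of _ T]) (simp_all add: rook_entry_nonzero)
  show "\<And>r r' c. \<lbrakk>r < m; r' < m; c < m; rook S T $$ (r, c) \<noteq> 0; rook S T $$ (r', c) \<noteq> 0\<rbrakk> \<Longrightarrow> r = r'"
    by (rule rank_inj[of _ S]) (simp_all add: rook_entry_nonzero)
  fix r r' c c' k
  assume *: "r < r'" "r' < m" "c < m" "c' < m" "rook S T $$ (r, c) = u_elt k"
    "rook S T $$ (r', c') = u_elt k"
  then have **: "S ! r = k" "S ! r' = k" "T ! c = k" "T ! c' = k" "rank S r = rank T c"
    "rank S r' = rank T c'"
    by (auto simp: rook_entry_u)
  then have "rank T c < rank T c'" using rank_less[of r r' S] * by auto
  then show "c < c'" using rank_less[of c' c T] ** * by (metis len(2) linorder_neqE_nat order_less_asym)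
qed

text \<open>The edges of a rook matrix are given as a relation between rows and columns rather than
  as a function; this form turns them into equalities of cardinalities.\<close>

lemma card_eq_relation:
  assumes "\<And>a. a \<in> A \<Longrightarrow> \<exists>b \<in> B. P a b" "\<And>b. b \<in> B \<Longrightarrow> \<exists>a \<in> A. P a b"
    "\<And>a b b'. \<lbrakk>a \<in> A; b \<in> B; b' \<in> B; P a b; P a b'\<rbrakk> \<Longrightarrow> b = b'"
    "\<And>a a' b. \<lbrakk>a \<in> A; a' \<in> A; b \<in> B; P a b; P a' b\<rbrakk> \<Longrightarrow> a = a'"
  shows "card A = card B"
proof -
  obtain f where f: "\<And>a. a \<in> A \<Longrightarrow> f a \<in> B \<and> P a (f a)" using assms(1) by metis
  have "bij_betw f A B"
    unfolding bij_betw_def inj_on_def using f assms by (auto simp: image_iff) metis+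
  then show ?thesis by (rule bij_betw_same_card)
qed

text \<open>Rows and columns are coloured by their nonzero entry, or by 0 if there is none.
  Planarity makes the two ends of an edge have equal rank, so \<open>d\<close> has the edges of
  \<open>rook S T\<close> and no others.\<close>

lemma planar_rook_rook:
  assumes d: "d \<in> planar_rook n m"
  obtains S T where "S \<in> colorings n m" "T \<in> colorings n m" "mset S = mset T" "d = rook S T"
proof -
  note D = planar_rookD[OF d]
  have "\<exists>k\<le>n. if k = 0 then \<forall>c<m. d $$ (r, c) = 0 else \<exists>c<m. d $$ (r, c) = u_elt k" if "r < m" for r
    using D(2)[OF that] by (cases "\<forall>c<m. d $$ (r, c) = 0") (force, metis not_one_le_zero)
  then obtain s where s: "\<And>r. r < m \<Longrightarrow> s r \<le> n \<and>
      (if s r = 0 then \<forall>c<m. d $$ (r, c) = 0 else \<exists>c<m. d $$ (r, c) = u_elt (s r))" by metis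
  have "\<exists>k\<le>n. if k = 0 then \<forall>r<m. d $$ (r, c) = 0 else \<exists>r<m. d $$ (r, c) = u_elt k" if "c < m" for c
    using D(2)[OF _ that] by (cases "\<forall>r<m. d $$ (r, c) = 0") (force, metis not_one_le_zero)
  then obtain t where t: "\<And>c. c < m \<Longrightarrow> t c \<le> n \<and>
      (if t c = 0 then \<forall>r<m. d $$ (r, c) = 0 else \<exists>r<m. d $$ (r, c) = u_elt (t c))" by metis
  define S where "S = map s [0..<m]"
  define T where "T = map t [0..<m]"
  have len: "length S = m" "length T = m" by (simp_all add: S_def T_def)
  have S_col: "S \<in> colorings n m" and T_col: "T \<in> colorings n m"
    using s t by (auto simp: colorings_def S_def T_def)
  have edge: "S ! r = k" "T ! c = k" "k \<noteq> 0" if rck: "r < m" "c < m" "d $$ (r, c) = u_elt k" for r c k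
  proof -
    have "s r \<noteq> 0" using s[OF rck(1)] rck by (auto split: if_splits)
    then obtain c' where "c' < m" "d $$ (r, c') = u_elt (s r)"
      using s[OF rck(1)] by auto
    then have "s r = k" using D(4)[of r c c'] rck by auto
    then show "S ! r = k" using rck by (simp add: S_def)
    have "t c \<noteq> 0" using t[OF rck(2)] rck by (auto split: if_splits)
    then obtain r' where "r' < m" "d $$ (r', c) = u_elt (t c)"
      using t[OF rck(2)] by auto
    then have "t c = k" using D(5)[of r r' c] rck by auto
    then show "T ! c = k" using rck by (simp add: T_def)
    show "k \<noteq> 0" using D(3) rck by force
  qed
  have exS: "\<exists>c<m. d $$ (r, c) = u_elt (S ! r)" if "r < m" "S ! r \<noteq> 0" for r
    using s[OF that(1)] that by (auto simp: S_def)
  have exT: "\<exists>r<m. d $$ (r, c) = u_elt (T ! c)" if "c < m" "T ! c \<noteq> 0" for c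
    using t[OF that(1)] that by (auto simp: T_def)
  \<comment> \<open>The edges of colour \<open>k\<close> match the rows of colour \<open>k\<close>
    above \<open>r\<close> with the columns of colour \<open>k\<close> left of \<open>c\<close>: by
    monotonicity none of them passes the edge \<open>(r, c)\<close>.\<close>
  have rank: "rank S r = rank T c" if rck: "r < m" "c < m" "d $$ (r, c) = u_elt k" for r c k
  proof -
    note e = edge[OF rck]
    have "card {i. i < r \<and> S ! i = k} = card {j. j < c \<and> T ! j = k}"
    proof (rule card_eq_relation[where P = "\<lambda>i j. d $$ (i, j) = u_elt k"])
      fix i assume i: "i \<in> {i. i < r \<and> S ! i = k}"
      then obtain j where j: "j < m" "d $$ (i, j) = u_elt k" using exS[of i] rck e by auto
      have "j < c" by (rule planar_mono[OF d, of i r]) (use i j rck in auto)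
      then show "\<exists>j\<in>{j. j < c \<and> T ! j = k}. d $$ (i, j) = u_elt k"
        using edge[of i j k] i j rck by auto
    next
      fix j assume j: "j \<in> {j. j < c \<and> T ! j = k}"
      then obtain i where i: "i < m" "d $$ (i, j) = u_elt k" using exT[of j] rck e by auto
      have "\<not> r < i" using planar_mono[OF d, of r i c j k] i j rck by auto
      moreover have "i \<noteq> r" using D(4)[of r c j] i j rck by auto
      ultimately show "\<exists>i\<in>{i. i < r \<and> S ! i = k}. d $$ (i, j) = u_elt k"
        using edge[of i j k] i j rck by (intro bexI[of _ i]) auto
    next
      show "j = j'" if "i \<in> {i. i < r \<and> S ! i = k}" "j \<in> {j. j < c \<and> T ! j = k}"
        "j' \<in> {j. j < c \<and> T ! j = k}"
        "d $$ (i, j) = u_elt k" "d $$ (i, j') = u_elt k" for i j j'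
        using D(4)[of i j j'] that \<open>r < m\<close> \<open>c < m\<close> by auto
      show "i = i'" if "i \<in> {i. i < r \<and> S ! i = k}" "i' \<in> {i. i < r \<and> S ! i = k}"
        "j \<in> {j. j < c \<and> T ! j = k}"
        "d $$ (i, j) = u_elt k" "d $$ (i', j) = u_elt k" for i i' j
        using D(5)[of i i' j] that \<open>r < m\<close> \<open>c < m\<close> by auto
    qed
    then show ?thesis unfolding rank_def using e that len by (simp add: count_list_take)
  qed
  have count: "count_list S k = count_list T k" for k
  proof -
    \<comment> \<open>The predicate \<open>Q\<close> allows two uses: one nonzero colour at a time,
      and all nonzero colours together.\<close>
    have *: "card {i. i < m \<and> S ! i \<noteq> 0 \<and> Q (S ! i)} = card {j. j < m \<and> T ! j \<noteq> 0 \<and> Q (T ! j)}" for Q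
    proof (rule card_eq_relation[where P = "\<lambda>i j. d $$ (i, j) \<noteq> 0"])
      fix i assume i: "i \<in> {i. i < m \<and> S ! i \<noteq> 0 \<and> Q (S ! i)}"
      then obtain j where j: "j < m" "d $$ (i, j) = u_elt (S ! i)" using exS[of i] by auto
      then show "\<exists>j\<in>{j. j < m \<and> T ! j \<noteq> 0 \<and> Q (T ! j)}. d $$ (i, j) \<noteq> 0"
        using edge[of i j "S ! i"] i by auto
    next
      fix j assume j: "j \<in> {j. j < m \<and> T ! j \<noteq> 0 \<and> Q (T ! j)}"
      then obtain i where i: "i < m" "d $$ (i, j) = u_elt (T ! j)" using exT[of j] by auto
      then show "\<exists>i\<in>{i. i < m \<and> S ! i \<noteq> 0 \<and> Q (S ! i)}. d $$ (i, j) \<noteq> 0"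
        using edge[of i j "T ! j"] j by auto
    qed (use D(4,5) in auto)
    have cl: "count_list S k = card {i. i < m \<and> S ! i = k}"
      "count_list T k = card {i. i < m \<and> T ! i = k}"
      using count_list_take[of m S k] count_list_take[of m T k] len by simp_all
    show ?thesis
    proof (cases "k = 0")
      case False
      have "{i. i < m \<and> S ! i \<noteq> 0 \<and> S ! i = k} = {i. i < m \<and> S ! i = k}"
        "{i. i < m \<and> T ! i \<noteq> 0 \<and> T ! i = k} = {i. i < m \<and> T ! i = k}"
        using False by auto
      then show ?thesis using *[of "\<lambda>l. l = k"] by (simp add: cl)
    next
      case True
      \<comment> \<open>Colour 0 has no edges to count; its multiplicity is the complement of all
        others in \<open>m\<close>, the same number for rows and for columns.\<close>
      have "{i. i < m \<and> S ! i = 0} = {..<m} - {i. i < m \<and> S ! i \<noteq> 0 \<and> True}"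
        "{i. i < m \<and> T ! i = 0} = {..<m} - {i. i < m \<and> T ! i \<noteq> 0 \<and> True}" by auto
      moreover have "card ({..<m} - {i. i < m \<and> S ! i \<noteq> 0 \<and> True}) = m - card {i. i < m \<and>
        S ! i \<noteq> 0 \<and> True}"
        "card ({..<m} - {i. i < m \<and> T ! i \<noteq> 0 \<and> True}) = m - card {i. i < m \<and> T ! i \<noteq> 0 \<and> True}"
        by (subst card_Diff_subset; auto)+
      ultimately show ?thesis unfolding cl unfolding True using *[of "\<lambda>_. True"] by metis
    qed
  qed
  have mset: "mset S = mset T"
    by (rule multiset_eqI) (simp add: count_mset count)
  have "d = rook S T"
  proof (rule eq_matI)
    fix r c assume "r < dim_row (rook S T)" "c < dim_col (rook S T)"
    then have rc: "r < m" "c < m" by (simp_all add: len)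
    show "d $$ (r, c) = rook S T $$ (r, c)"
    proof (cases "d $$ (r, c) = 0")
      case False
      then obtain k where k: "d $$ (r, c) = u_elt k" using D(2)[OF rc] by blast
      then show ?thesis using edge[OF rc k] rank[OF rc k] rc by (simp add: rook_entry len)
    next
      case True
      have "\<not> (S ! r = T ! c \<and> S ! r \<noteq> 0 \<and> rank S r = rank T c)"
      proof
        assume *: "S ! r = T ! c \<and> S ! r \<noteq> 0 \<and> rank S r = rank T c"
        then obtain c' where c': "c' < m" "d $$ (r, c') = u_elt (S ! r)" using exS rc by blast
        \<comment> \<open>The edge that row \<open>r\<close> does have ends in a column of the same
          colour and rank as \<open>c\<close>, so it would sit at the zero entry.\<close>
        have "c' = c"
          by (rule rank_inj[of _ T])
            (use rank[OF rc(1) c'] edge[OF rc(1) c'] rc c' * in \<open>simp_all add: len\<close>)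
        then show False using c' True by simp
      qed
      then show ?thesis using True rc by (simp add: rook_entry len)
    qed
  qed (use D(1) len in auto)
  then show ?thesis using that S_col T_col mset by blast
qed

lemma colorings_length: "T \<in> colorings n m \<Longrightarrow> length T = m"
  by (simp add: colorings_def)

lemma finite_colorings [simp]: "finite (colorings n m)"
  unfolding colorings_def using finite_lists_length_eq[of "{..n}" m] by (simp add: conj_commute)

definition col_pairs :: "nat \<Rightarrow> nat \<Rightarrow> (nat list \<times> nat list) set" where
  "col_pairs n m = {(S, T). S \<in> colorings n m \<and> T \<in> colorings n m \<and> mset S = mset T}"

lemma finite_col_pairs [simp]: "finite (col_pairs n m)"
  by (rule finite_subset[of _ "colorings n m \<times> colorings n m"]) (auto simp: col_pairs_def)

lemma bij_rook: "bij_betw (\<lambda>(S, T). rook S T) (col_pairs n m) (planar_rook n m)"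
  unfolding bij_betw_def
proof
  show "inj_on (\<lambda>(S, T). rook S T) (col_pairs n m)"
    by (rule inj_onI) (auto simp: col_pairs_def dest: rook_inj)
  show "(\<lambda>(S, T). rook S T) ` col_pairs n m = planar_rook n m"
    by (auto simp: col_pairs_def rook_planar image_iff elim!: planar_rook_rook)
qed

lemma finite_planar_rook [simp]: "finite (planar_rook n m)"
  using bij_betw_finite[OF bij_rook] by simp

section \<open>Sub-rooks and products of rooks\<close>

lemma sub_rooks_iff:
  "d \<in> carrier_mat m m \<Longrightarrow> d' \<in> sub_rooks d \<longleftrightarrow> d' \<in> carrier_mat m m \<and>
     (\<forall>r<m. \<forall>c<m. d' $$ (r, c) \<noteq> 0 \<longrightarrow> d' $$ (r, c) = d $$ (r, c))"
  unfolding sub_rooks_def by auto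

lemma sub_rooksD:
  assumes "d' \<in> sub_rooks d" "d \<in> carrier_mat m m"
  shows "d' \<in> carrier_mat m m" "\<And>r c. \<lbrakk>r < m; c < m; d' $$ (r, c) \<noteq> 0\<rbrakk> \<Longrightarrow> d' $$ (r, c) = d $$ (r, c)"
  using assms sub_rooks_iff by blast+

lemma sub_rooks_uD:
  assumes "d' \<in> sub_rooks d" "d \<in> carrier_mat m m" "r < m" "c < m" "d' $$ (r, c) = u_elt k"
  shows "d $$ (r, c) = u_elt k"
  using sub_rooksD(2)[OF assms(1-4)] assms(5) by simp

lemma sub_rooks_planar:
  assumes d: "d \<in> planar_rook n m" and d': "d' \<in> sub_rooks d"
  shows "d' \<in> planar_rook n m"
proof (rule planar_rookI)
  note D = planar_rookD[OF d]
  note S = sub_rooksD[OF d' D(1)]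
  have nz: "d $$ (r, c) \<noteq> 0" if "r < m" "c < m" "d' $$ (r, c) \<noteq> 0" for r c
    using S(2)[OF that] that by simp
  show "d' \<in> carrier_mat m m" by (rule S)
  show "\<exists>k. 1 \<le> k \<and> k \<le> n \<and> d' $$ (r, c) = u_elt k" if "r < m" "c < m" "d' $$ (r, c) \<noteq> 0" for r c
    using S(2)[OF that] D(2)[OF that(1,2) nz[OF that]] by simp
  show "\<And>r c c'. \<lbrakk>r < m; c < m; c' < m; d' $$ (r, c) \<noteq> 0; d' $$ (r, c') \<noteq> 0\<rbrakk> \<Longrightarrow> c = c'"
    using nz D(4) by meson
  show "\<And>r r' c. \<lbrakk>r < m; r' < m; c < m; d' $$ (r, c) \<noteq> 0; d' $$ (r', c) \<noteq> 0\<rbrakk> \<Longrightarrow> r = r'"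
    using nz D(5) by meson
  fix r r' c c' k
  assume *: "r < r'" "r' < m" "c < m" "c' < m" "d' $$ (r, c) = u_elt k" "d' $$ (r', c') = u_elt k"
  show "c < c'"
    by (rule planar_mono[OF d *(1-4)]; rule sub_rooks_uD[OF d' D(1)]) (use * in auto)
qed

text \<open>A row of \<open>d1\<close> has at most one nonzero entry, so the sum defining the
  product collapses to at most one term.\<close>

lemma prod_entry:
  assumes d1: "d1 \<in> planar_rook n m" and d2: "d2 \<in> carrier_mat m m" and r: "r < m" and c: "c < m"
  shows "(\<exists>j<m. d1 $$ (r, j) \<noteq> 0 \<and> (d1 * d2) $$ (r, c) = d1 $$ (r, j) * d2 $$ (j, c)) \<or>
    (\<forall>j<m. d1 $$ (r, j) = 0) \<and> (d1 * d2) $$ (r, c) = 0"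
proof -
  note D = planar_rookD[OF d1]
  have prod: "(d1 * d2) $$ (r, c) = (\<Sum>j<m. d1 $$ (r, j) * d2 $$ (j, c))"
    using D(1) d2 r c by (simp add: scalar_prod_def lessThan_atLeast0)
  show ?thesis
  proof (cases "\<forall>j<m. d1 $$ (r, j) = 0")
    case True
    then show ?thesis by (simp add: prod)
  next
    case False
    then obtain j where j: "j < m" "d1 $$ (r, j) \<noteq> 0" by blast
    have "(\<Sum>i<m. d1 $$ (r, i) * d2 $$ (i, c)) = (\<Sum>i\<in>{j}. d1 $$ (r, i) * d2 $$ (i, c))"
    proof (rule sum.mono_neutral_right)
      show "\<forall>i\<in>{..<m} - {j}. d1 $$ (r, i) * d2 $$ (i, c) = 0"
        using D(4)[OF r j(1) _ j(2)] by force
    qed (use j in auto)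
    then show ?thesis using j prod by auto
  qed
qed

text \<open>Since distinct \<open>u_elt\<close> multiply to 0, an edge of the product is a two-step
  path whose steps have the same colour.\<close>

lemma prod_entry_u:
  assumes d1: "d1 \<in> planar_rook n m" and d2: "d2 \<in> planar_rook n m" and r: "r < m" and c: "c < m"
  shows "(d1 * d2) $$ (r, c) = u_elt k \<longleftrightarrow> (\<exists>j<m. d1 $$ (r, j) = u_elt k \<and> d2 $$ (j, c) = u_elt k)"
proof
  assume k: "(d1 * d2) $$ (r, c) = u_elt k"
  then obtain j where j: "j < m" "d1 $$ (r, j) \<noteq> 0" "d1 $$ (r, j) * d2 $$ (j, c) = u_elt k"
    using prod_entry[OF d1 planar_rookD(1)[OF d2] r c] by auto
  then have "d2 $$ (j, c) \<noteq> 0" by (metis mult_zero_right u_elt_nonzero(1))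
  then obtain a b where ab: "d1 $$ (r, j) = u_elt a" "d2 $$ (j, c) = u_elt b"
    using planar_rookD(2)[OF d1 r j(1) j(2)] planar_rookD(2)[OF d2 j(1) c] by blast
  then have "a = k \<and> b = k" using j(3) by (auto simp: u_elt_mult split: if_splits)
  then show "\<exists>j<m. d1 $$ (r, j) = u_elt k \<and> d2 $$ (j, c) = u_elt k" using j ab by auto
next
  assume "\<exists>j<m. d1 $$ (r, j) = u_elt k \<and> d2 $$ (j, c) = u_elt k"
  then obtain j where j: "j < m" "d1 $$ (r, j) = u_elt k" "d2 $$ (j, c) = u_elt k" by blast
  from prod_entry[OF d1 planar_rookD(1)[OF d2] r c]
  show "(d1 * d2) $$ (r, c) = u_elt k"
  proof (elim disjE exE conjE)
    fix i assume "i < m" "d1 $$ (r, i) \<noteq> 0" "(d1 * d2) $$ (r, c) = d1 $$ (r, i) * d2 $$ (i, c)"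
    moreover have "i = j" using planar_rookD(4)[OF d1 r \<open>i < m\<close> j(1)] j \<open>d1 $$ (r, i) \<noteq> 0\<close> by simp
    ultimately show ?thesis using j by (simp add: u_elt_mult)
  next
    assume "\<forall>j<m. d1 $$ (r, j) = 0"
    then show ?thesis using j by auto
  qed
qed

lemma prod_entry_ex:
  assumes d1: "d1 \<in> planar_rook n m" and d2: "d2 \<in> planar_rook n m" and r: "r < m" and c: "c < m"
    and nz: "(d1 * d2) $$ (r, c) \<noteq> 0"
  obtains j k where "j < m" "1 \<le> k" "k \<le> n" "d1 $$ (r, j) = u_elt k" "d2 $$ (j, c) = u_elt k"
    "(d1 * d2) $$ (r, c) = u_elt k"
proof -
  obtain j where j: "j < m" "d1 $$ (r, j) \<noteq> 0" "(d1 * d2) $$ (r, c) = d1 $$ (r, j) * d2 $$ (j, c)"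
    using prod_entry[OF d1 planar_rookD(1)[OF d2] r c] nz by auto
  then have "d2 $$ (j, c) \<noteq> 0" using nz by (metis mult_zero_right)
  then obtain a b where ab: "1 \<le> a" "a \<le> n" "d1 $$ (r, j) = u_elt a" "d2 $$ (j, c) = u_elt b"
    using planar_rookD(2)[OF d1 r j(1) j(2)] planar_rookD(2)[OF d2 j(1) c] by blast
  moreover have "a = b" using nz j(3) ab by (auto simp: u_elt_mult split: if_splits)
  ultimately show ?thesis using that j by (simp add: u_elt_mult)
qed

text \<open>In each colour a planar rook is a partial order-preserving injection, and such maps
  compose.\<close>

lemma prod_planar:
  assumes d1: "d1 \<in> planar_rook n m" and d2: "d2 \<in> planar_rook n m"
  shows "d1 * d2 \<in> planar_rook n m"
proof (rule planar_rookI)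
  note D1 = planar_rookD[OF d1] and D2 = planar_rookD[OF d2]
  show "d1 * d2 \<in> carrier_mat m m" using D1(1) D2(1) by simp
  show "\<exists>k. 1 \<le> k \<and> k \<le> n \<and> (d1 * d2) $$ (r, c) = u_elt k"
    if "r < m" "c < m" "(d1 * d2) $$ (r, c) \<noteq> 0" for r c
    using prod_entry_ex[OF d1 d2 that] by metis
  show "c = c'" if rc: "r < m" "c < m" "c' < m" "(d1 * d2) $$ (r, c) \<noteq> 0" "(d1 * d2) $$ (r, c') \<noteq> 0"
    for r c c'
  proof -
    obtain j k where j: "j < m" "d1 $$ (r, j) = u_elt k" "d2 $$ (j, c) = u_elt k"
      using prod_entry_ex[OF d1 d2 rc(1,2,4)] by metis
    obtain j' k' where j': "j' < m" "d1 $$ (r, j') = u_elt k'" "d2 $$ (j', c') = u_elt k'"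
      using prod_entry_ex[OF d1 d2 rc(1,3,5)] by metis
    have "j = j'" using D1(4)[of r j j'] j j' rc by simp
    then show ?thesis using D2(4)[of j c c'] j j' rc by simp
  qed
  show "r = r'" if rc: "r < m" "r' < m" "c < m" "(d1 * d2) $$ (r, c) \<noteq> 0" "(d1 * d2) $$ (r', c) \<noteq> 0"
    for r r' c
  proof -
    obtain j k where j: "j < m" "d1 $$ (r, j) = u_elt k" "d2 $$ (j, c) = u_elt k"
      using prod_entry_ex[OF d1 d2 rc(1,3,4)] by metis
    obtain j' k' where j': "j' < m" "d1 $$ (r', j') = u_elt k'" "d2 $$ (j', c) = u_elt k'"
      using prod_entry_ex[OF d1 d2 rc(2,3,5)] by metis
    have "j = j'" using D2(5)[of j j' c] j j' rc by simp
    then show ?thesis using D1(5)[of r r' j] j j' rc by simp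
  qed
  fix r r' c c' k
  assume *: "r < r'" "r' < m" "c < m" "c' < m" "(d1 * d2) $$ (r, c) = u_elt k"
    "(d1 * d2) $$ (r', c') = u_elt k"
  obtain j where j: "j < m" "d1 $$ (r, j) = u_elt k" "d2 $$ (j, c) = u_elt k"
    using prod_entry_u[OF d1 d2, of r c k] * by auto
  obtain j' where j': "j' < m" "d1 $$ (r', j') = u_elt k" "d2 $$ (j', c') = u_elt k"
    using prod_entry_u[OF d1 d2, of r' c' k] * by auto
  have "j < j'" by (rule planar_mono[OF d1, of r r']) (use * j j' in auto)
  then show "c < c'" by (rule planar_mono[OF d2]) (use * j j' in auto)
qed

context
  notes colorings_length [simp]
begin

text \<open>An edge of \<open>rook S U\<close> factors through the index of \<open>T\<close> that
  has its colour and rank. With the next two lemmas this makes the indicator of lying below a rook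
  multiplicative, which becomes matrix multiplication in \<open>coef_mult\<close>.\<close>

lemma rook_sub_prod:
  assumes d1: "d1 \<in> planar_rook n m" and d2: "d2 \<in> planar_rook n m"
    and col: "S \<in> colorings n m" "T \<in> colorings n m" "U \<in> colorings n m"
    and ST: "mset S = mset T" and TU: "mset T = mset U"
    and sub: "rook S T \<in> sub_rooks d1" "rook T U \<in> sub_rooks d2"
  shows "rook S U \<in> sub_rooks (d1 * d2)"
proof -
  have c: "d1 * d2 \<in> carrier_mat m m" using planar_rookD(1)[OF prod_planar[OF d1 d2]] .
  show ?thesis
    unfolding sub_rooks_iff[OF c]
  proof (intro conjI allI impI)
    show "rook S U \<in> carrier_mat m m" using rook_carrier[of S U] col by simp
    fix r c assume rc: "r < m" "c < m" "rook S U $$ (r, c) \<noteq> 0"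
    define k where "k = S ! r"
    have k: "S ! r = k" "U ! c = k" "k \<noteq> 0" "rank S r = rank U c"
      using rc col by (auto simp: rook_entry_nonzero k_def)
    obtain j where j: "j < m" "T ! j = k" "rank T j = rank S r"
      using match_ex[OF ST, of r] rc k col by auto
    have "rook S T $$ (r, j) = u_elt k" "rook T U $$ (j, c) = u_elt k" "rook S U $$ (r, c) = u_elt k"
      using j k rc col by (auto simp: rook_entry_u)
    then have "(d1 * d2) $$ (r, c) = u_elt k"
      using prod_entry_u[OF d1 d2 rc(1,2)] j(1) rc
        sub_rooks_uD[OF sub(1) planar_rookD(1)[OF d1]] sub_rooks_uD[OF sub(2) planar_rookD(1)[OF d2]]
      by blast
    then show "rook S U $$ (r, c) = (d1 * d2) $$ (r, c)"
      using \<open>rook S U $$ (r, c) = u_elt k\<close> by simp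
  qed
qed

text \<open>Every edge of \<open>rook S U\<close> is a path through some middle index. Colouring
  these middle indices by the colours of the paths, and the remaining ones by 0, gives
  \<open>T\<close>.\<close>

lemma rook_sub_prod_ex:
  assumes d1: "d1 \<in> planar_rook n m" and d2: "d2 \<in> planar_rook n m"
    and col: "S \<in> colorings n m" "U \<in> colorings n m" and SU: "mset S = mset U"
    and sub: "rook S U \<in> sub_rooks (d1 * d2)"
  shows "\<exists>T \<in> colorings n m. mset S = mset T \<and> rook S T \<in> sub_rooks d1 \<and> rook T U \<in> sub_rooks d2"
proof -
  note D1 = planar_rookD[OF d1] and D2 = planar_rookD[OF d2]
  have len [simp]: "length S = m" "length U = m" using col by auto
  have c12: "d1 * d2 \<in> carrier_mat m m" using planar_rookD(1)[OF prod_planar[OF d1 d2]] .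
  have edge: "\<exists>j<m. d1 $$ (r, j) = u_elt k \<and> d2 $$ (j, c) = u_elt k"
    if "r < m" "c < m" "rook S U $$ (r, c) = u_elt k" for r c k
    using prod_entry_u[OF d1 d2 that(1,2)] sub_rooks_uD[OF sub c12 that] by blast
  \<comment> \<open>Keeps the edges of \<open>d1\<close> that leave a row in the colour which
    \<open>S\<close> gives it. The colouring form of \<open>b1\<close> will have row colours
    \<open>S\<close>; its column colours are the desired \<open>T\<close>. Likewise
    \<open>b2\<close> keeps what \<open>U\<close> needs.\<close>
  define b1 where "b1 = mat m m (\<lambda>(r, j). if S ! r \<noteq> 0 \<and> d1 $$ (r, j) =
    u_elt (S ! r) then d1 $$ (r, j) else 0)"
  define b2 where "b2 = mat m m (\<lambda>(j, c). if U ! c \<noteq> 0 \<and> d2 $$ (j, c) =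
    u_elt (U ! c) then d2 $$ (j, c) else 0)"
  have b1_u: "b1 $$ (r, j) = u_elt k \<longleftrightarrow> S ! r = k \<and> k \<noteq> 0 \<and> d1 $$ (r, j) = u_elt k"
    if "r < m" "j < m" for r j k
    using that by (auto simp: b1_def)
  have b2_u: "b2 $$ (j, c) = u_elt k \<longleftrightarrow> U ! c = k \<and> k \<noteq> 0 \<and> d2 $$ (j, c) = u_elt k"
    if "j < m" "c < m" for j c k
    using that by (auto simp: b2_def)
  have sub1: "b1 \<in> sub_rooks d1" unfolding sub_rooks_iff[OF D1(1)] by (auto simp: b1_def)
  have sub2: "b2 \<in> sub_rooks d2" unfolding sub_rooks_iff[OF D2(1)] by (auto simp: b2_def)
  obtain S' T where T: "S' \<in> colorings n m" "T \<in> colorings n m" "mset S' = mset T" "b1 = rook S' T"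
    by (rule planar_rook_rook[OF sub_rooks_planar[OF d1 sub1]])
  obtain T' U' where T': "T' \<in> colorings n m" "U' \<in> colorings n m" "mset T' = mset U'" "b2 = rook T' U'"
    by (rule planar_rook_rook[OF sub_rooks_planar[OF d2 sub2]])
  have rowS: "\<exists>c<m. rook S U $$ (r, c) = u_elt (S ! r)" if "r < m" "S ! r \<noteq> 0" for r
    using rook_row[OF SU, of r "S ! r"] that by auto
  have colU: "\<exists>r<m. rook S U $$ (r, c) = u_elt (U ! c)" if "c < m" "U ! c \<noteq> 0" for c
    using rook_col[OF SU, of c "U ! c"] that by auto
  have "S' = S"
  proof (rule list_eq_nonzeroI)
    fix r k assume r: "r < length S'" "k \<noteq> (0::nat)"
    then have r': "r < m" using T by simp
    have "S' ! r = k \<longleftrightarrow> (\<exists>j<m. b1 $$ (r, j) = u_elt k)"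
      using rook_row[OF T(3) r] T by simp
    also have "\<dots> \<longleftrightarrow> S ! r = k \<and> (\<exists>j<m. d1 $$ (r, j) = u_elt k)"
      using b1_u r' r(2) by auto
    also have "\<dots> \<longleftrightarrow> S ! r = k" using rowS[OF r'] edge[OF r'] r(2) by metis
    finally show "S' ! r = k \<longleftrightarrow> S ! r = k" .
  qed (use T in simp)
  have "U' = U"
  proof (rule list_eq_nonzeroI)
    fix c k assume c: "c < length U'" "k \<noteq> (0::nat)"
    then have c': "c < m" using T' by simp
    have "U' ! c = k \<longleftrightarrow> (\<exists>j<m. b2 $$ (j, c) = u_elt k)"
      using rook_col[OF T'(3) c] T' by simp
    also have "\<dots> \<longleftrightarrow> U ! c = k \<and> (\<exists>j<m. d2 $$ (j, c) = u_elt k)"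
      using b2_u c' c(2) by auto
    also have "\<dots> \<longleftrightarrow> U ! c = k" using colU[OF c'] edge[OF _ c'] c(2) by metis
    finally show "U' ! c = k \<longleftrightarrow> U ! c = k" .
  qed (use T' in simp)
  \<comment> \<open>In both colourings a middle index has colour \<open>k \<noteq> 0\<close> exactly
    when a path of colour \<open>k\<close> of \<open>rook S U\<close> runs through it.\<close>
  have "T' = T"
  proof (rule list_eq_nonzeroI)
    fix j k assume j: "j < length T'" "k \<noteq> (0::nat)"
    then have j': "j < m" "j < length T" using T T' by simp_all
    have "T' ! j = k \<longleftrightarrow> (\<exists>c<m. b2 $$ (j, c) = u_elt k)"
      using rook_row[OF T'(3) j] T' by simp
    also have "\<dots> \<longleftrightarrow> (\<exists>c<m. U ! c = k \<and> d2 $$ (j, c) = u_elt k)"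
      using b2_u j' j(2) by auto
    also have "\<dots> \<longleftrightarrow> (\<exists>r<m. S ! r = k \<and> d1 $$ (r, j) = u_elt k)"
    proof
      assume "\<exists>c<m. U ! c = k \<and> d2 $$ (j, c) = u_elt k"
      then obtain c where c: "c < m" "U ! c = k" "d2 $$ (j, c) = u_elt k" by blast
      then obtain r where r: "r < m" "rook S U $$ (r, c) = u_elt k" using colU[of c] j by auto
      then obtain i where i: "i < m" "d1 $$ (r, i) = u_elt k" "d2 $$ (i, c) = u_elt k"
        using edge[of r c k] c by auto
      have "i = j" using D2(5)[of i j c] i c j' by simp
      moreover have "S ! r = k" using r c by (simp add: rook_entry_u)
      ultimately show "\<exists>r<m. S ! r = k \<and> d1 $$ (r, j) = u_elt k" using r i by blast
    next
      assume "\<exists>r<m. S ! r = k \<and> d1 $$ (r, j) = u_elt k"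
      then obtain r where r: "r < m" "S ! r = k" "d1 $$ (r, j) = u_elt k" by blast
      then obtain c where c: "c < m" "rook S U $$ (r, c) = u_elt k" using rowS[of r] j by auto
      then obtain i where i: "i < m" "d1 $$ (r, i) = u_elt k" "d2 $$ (i, c) = u_elt k"
        using edge[of r c k] r by auto
      have "i = j" using D1(4)[of r i j] i r j' by simp
      moreover have "U ! c = k" using r c by (simp add: rook_entry_u)
      ultimately show "\<exists>c<m. U ! c = k \<and> d2 $$ (j, c) = u_elt k" using c i by blast
    qed
    also have "\<dots> \<longleftrightarrow> (\<exists>r<m. b1 $$ (r, j) = u_elt k)"
      using b1_u j' j(2) by auto
    also have "\<dots> \<longleftrightarrow> T ! j = k" using rook_col[OF T(3) j'(2) j(2)] T by simp
    finally show "T' ! j = k \<longleftrightarrow> T ! j = k" .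
  qed (use T T' in simp)
  show ?thesis
    using T T' sub1 sub2 \<open>S' = S\<close> \<open>U' = U\<close> \<open>T' = T\<close> by blast
qed

text \<open>A nonzero colour of row \<open>r\<close> travels along the only edge of \<open>d\<close>
  in that row, so \<open>d\<close> and \<open>S\<close> force the nonzero colours of the
  columns.\<close>

lemma rook_sub_unique:
  assumes d: "d \<in> planar_rook n m"
    and col: "S \<in> colorings n m" "T \<in> colorings n m" "T' \<in> colorings n m"
    and mset: "mset S = mset T" "mset S = mset T'"
    and sub: "rook S T \<in> sub_rooks d" "rook S T' \<in> sub_rooks d"
  shows "T = T'"
proof -
  note D = planar_rookD[OF d]
  have *: "T2 ! j = k" if th: "T1 \<in> colorings n m" "T2 \<in> colorings n m" "mset S = mset T1"
    "mset S = mset T2"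
     "rook S T1 \<in> sub_rooks d" "rook S T2 \<in> sub_rooks d" "j < m" "k \<noteq> 0" "T1 ! j = k" for T1 T2 j k
  proof -
    obtain r where r: "r < m" "rook S T1 $$ (r, j) = u_elt k"
      using rook_col[OF th(3), of j k] th col by auto
    then have "S ! r = k" using th col by (simp add: rook_entry_u)
    then obtain j' where j': "j' < m" "rook S T2 $$ (r, j') = u_elt k"
      using rook_row[OF th(4), of r k] r th col by auto
    have "d $$ (r, j) = u_elt k" "d $$ (r, j') = u_elt k"
      using sub_rooks_uD[OF _ D(1)] th r j' by blast+
    then have "j = j'" using D(4)[of r j j'] r j' th by simp
    then show ?thesis using j' r th col by (simp add: rook_entry_u)
  qed
  show ?thesis
  proof (rule list_eq_nonzeroI)
    fix j k assume "j < length T" "k \<noteq> (0::nat)"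
    then have j: "j < m" "k \<noteq> 0" using col by simp_all
    show "T ! j = k \<longleftrightarrow> T' ! j = k"
      using *[OF col(2,3) mset sub j] *[OF col(3,2) mset(2,1) sub(2,1) j] by blast
  qed (use col in simp)
qed

end

section \<open>Moebius inversion on the sub-rooks\<close>

lemma sub_rooks_refl: "d \<in> sub_rooks d"
  by (simp add: sub_rooks_def)

definition supp :: "rook \<Rightarrow> (nat \<times> nat) set" where
  "supp d = {(r, c). r < dim_row d \<and> c < dim_col d \<and> d $$ (r, c) \<noteq> 0}"

lemma finite_supp: "finite (supp d)"
  by (rule finite_subset[of _ "{..<dim_row d} \<times> {..<dim_col d}"]) (auto simp: supp_def)

lemma rook_size_supp: "rook_size d = card (supp d)"
  by (simp add: rook_size_def supp_def)

lemma supp_iff: "(r, c) \<in> supp d \<longleftrightarrow> r < dim_row d \<and> c < dim_col d \<and> d $$ (r, c) \<noteq> 0"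
  by (simp add: supp_def)

lemma sub_rooks_supp_char:
  "d' \<in> sub_rooks d \<longleftrightarrow> dim_row d' = dim_row d \<and> dim_col d' = dim_col d \<and>
     (\<forall>r c. (r, c) \<in> supp d' \<longrightarrow> d' $$ (r, c) = d $$ (r, c))"
  unfolding sub_rooks_def supp_iff mem_Collect_eq carrier_mat_def
    by (intro iffI conjI) (elim conjE; metis)+

lemma sub_rooks_supp: "d' \<in> sub_rooks d \<Longrightarrow> supp d' \<subseteq> supp d"
  unfolding sub_rooks_supp_char by (intro subrelI) (simp add: supp_iff)

text \<open>With \<open>sub_rooks_eq\<close> this embeds the sub-rooks of \<open>d\<close> into the
  Boolean lattice of subsets of \<open>supp d\<close>, where the signs of \<open>x_elt\<close> are
  the Moebius function.\<close>

lemma sub_rooks_supp_iff: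
  assumes "a \<in> sub_rooks d" "b \<in> sub_rooks d"
  shows "a \<in> sub_rooks b \<longleftrightarrow> supp a \<subseteq> supp b"
proof
  assume "supp a \<subseteq> supp b"
  then show "a \<in> sub_rooks b"
    using assms unfolding sub_rooks_supp_char by (simp add: subset_eq)
qed (rule sub_rooks_supp)

lemma sub_rooks_eq:
  assumes "a \<in> sub_rooks d" "b \<in> sub_rooks d" "supp a = supp b"
  shows "a = b"
proof (rule eq_matI)
  show dim: "dim_row a = dim_row b" "dim_col a = dim_col b"
    using assms by (simp_all add: sub_rooks_supp_char)
  fix r c assume rc: "r < dim_row b" "c < dim_col b"
  show "a $$ (r, c) = b $$ (r, c)"
  proof (cases "(r, c) \<in> supp a")
    case True
    then show ?thesis using assms unfolding sub_rooks_supp_char by simp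
  next
    case False
    then have "(r, c) \<notin> supp b" using assms(3) by simp
    then show ?thesis using False rc dim by (simp add: supp_iff)
  qed
qed

lemma sub_rooks_trans: "\<lbrakk>a \<in> sub_rooks b; b \<in> sub_rooks d\<rbrakk> \<Longrightarrow> a \<in> sub_rooks d"
  using sub_rooks_supp[of a b] unfolding sub_rooks_supp_char by (simp add: subset_eq)

text \<open>This is the expansion of \<open>(1 - 1) ^ card A\<close>: subsets with and without a
  fixed element cancel.\<close>

lemma sum_Pow_alternating:
  "finite A \<Longrightarrow> (\<Sum>Y\<in>Pow A. (-1) ^ card Y) = (if A = {} then 1 else (0 :: 'a :: comm_ring_1))"
proof (induction A rule: finite_induct)
  case (insert x A)
  have "(\<Sum>Y\<in>Pow (insert x A). (-1) ^ card Y) =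
     (\<Sum>Y\<in>Pow A. (-1 :: 'a) ^ card Y) + (\<Sum>Y\<in>insert x ` Pow A. (-1) ^ card Y)"
    unfolding Pow_insert by (rule sum.union_disjoint) (use insert in auto)
  also have "(\<Sum>Y\<in>insert x ` Pow A. (-1 :: 'a) ^ card Y) = (\<Sum>Y\<in>Pow A. (-1) ^ card (insert x Y))"
    by (rule sum.reindex_cong[OF _ refl refl])
      (use insert in \<open>auto simp: inj_on_def\<close>)
  also have "\<dots> = (\<Sum>Y\<in>Pow A. - ((-1) ^ card Y))"
  proof (rule sum.cong[OF refl])
    fix Y assume "Y \<in> Pow A"
    then have "finite Y" "x \<notin> Y" using insert finite_subset by auto
    then show "(-1 :: 'a) ^ card (insert x Y) = - ((-1) ^ card Y)" by simp
  qed
  finally show ?case by (simp add: sum_negf)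
qed simp

text \<open>The rooks between \<open>b\<close> and \<open>d\<close> correspond, by what they lack of
  \<open>supp d\<close>, to the subsets of \<open>supp d - supp b\<close>, and the exponent is the
  size of that subset.\<close>

lemma moebius_rook:
  assumes b: "b \<in> sub_rooks d"
  shows "(\<Sum>d' \<in> {d' \<in> sub_rooks d. b \<in> sub_rooks d'}. (-1) ^ (rook_size d - rook_size d')) =
    (if b = d then 1 else (0 :: 'a :: comm_ring_1))"
proof -
  let ?g = "\<lambda>d'. supp d - supp d'"
  have bij: "bij_betw ?g {d' \<in> sub_rooks d. b \<in> sub_rooks d'} (Pow (supp d - supp b))"
    unfolding bij_betw_def
  proof
    show "inj_on ?g {d' \<in> sub_rooks d. b \<in> sub_rooks d'}"
    proof (rule inj_onI)
      fix x y assume x: "x \<in> {d' \<in> sub_rooks d. b \<in> sub_rooks d'}" and y: "y \<in> {d' \<in> sub_rooks d. b \<in> sub_rooks d'}"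
        and eq: "?g x = ?g y"
      have "supp x \<subseteq> supp d" "supp y \<subseteq> supp d" using x y sub_rooks_supp by auto
      then have "supp x = supp y" using eq by blast
      then show "x = y" using x y sub_rooks_eq by blast
    qed
    have "Y \<in> ?g ` {d' \<in> sub_rooks d. b \<in> sub_rooks d'}" if Y: "Y \<subseteq> supp d - supp b" for Y
    proof -
      define d' where "d' = mat (dim_row d) (dim_col d) (\<lambda>p. if p \<in> Y then 0 else d $$ p)"
      have d': "d' \<in> sub_rooks d" by (auto simp: d'_def sub_rooks_def)
      have "supp d' = supp d - Y" by (auto simp: d'_def supp_def)
      then have "?g d' = Y" "supp b \<subseteq> supp d'" using Y sub_rooks_supp[OF b] by auto
      then show ?thesis using d' sub_rooks_supp_iff[OF b d'] by blast
    qed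
    then show "?g ` {d' \<in> sub_rooks d. b \<in> sub_rooks d'} = Pow (supp d - supp b)"
      using sub_rooks_supp by blast
  qed
  have "(\<Sum>d' \<in> {d' \<in> sub_rooks d. b \<in> sub_rooks d'}. (-1 :: 'a) ^ (rook_size d - rook_size d')) =
    (\<Sum>d' \<in> {d' \<in> sub_rooks d. b \<in> sub_rooks d'}. (-1) ^ card (?g d'))"
    by (rule sum.cong[OF refl]) (auto simp: rook_size_supp card_Diff_subset finite_supp sub_rooks_supp)
  also have "\<dots> = (\<Sum>Y\<in>Pow (supp d - supp b). (-1) ^ card Y)"
    by (rule sum.reindex_bij_betw[OF bij])
  also have "\<dots> = (if b = d then 1 else 0)"
  proof -
    have "supp d - supp b = {} \<longleftrightarrow> b = d"
      using sub_rooks_eq[OF b sub_rooks_refl] sub_rooks_supp[OF b] by auto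
    then show ?thesis by (simp add: sum_Pow_alternating finite_supp)
  qed
  finally show ?thesis .
qed

section \<open>Block sums and appending one colour\<close>

lemma diag_block2:
  assumes "d1 \<in> carrier_mat m m" "d2 \<in> carrier_mat 1 1"
  shows "diag_block_mat [d1, d2] \<in> carrier_mat (Suc m) (Suc m)"
    "\<And>r c. \<lbrakk>r < Suc m; c < Suc m\<rbrakk> \<Longrightarrow> diag_block_mat [d1, d2] $$ (r, c) =
      (if r < m \<and> c < m then d1 $$ (r, c) else if r = m \<and> c = m then d2 $$ (0, 0) else 0)"
proof -
  show "diag_block_mat [d1, d2] \<in> carrier_mat (Suc m) (Suc m)"
    using assms by (auto simp: Let_def)
  fix r c assume rc: "r < Suc m" "c < Suc m"
  then show "diag_block_mat [d1, d2] $$ (r, c) =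
      (if r < m \<and> c < m then d1 $$ (r, c) else if r = m \<and> c = m then d2 $$ (0, 0) else 0)"
    using assms by (auto simp: Let_def less_Suc_eq)
qed

lemma rank_append: "r < length S \<Longrightarrow> rank (S @ [i]) r = rank S r"
  by (simp add: rank_def nth_append)

lemma rank_last: "rank (S @ [i]) (length S) = count_list S i"
  by (simp add: rank_def)

text \<open>The appended index has as its rank the whole number of earlier indices of colour
  \<open>i\<close>, the same on both sides as the multisets agree. Earlier indices have smaller
  rank, so no edge joins old and new ones.\<close>

lemma rook_append_diag:
  assumes ST: "mset S = mset T"
  shows "rook (S @ [i]) (T @ [i]) = diag_block_mat [rook S T, rook [i] [i]]"
proof -
  define m where "m = length S"
  have len: "length S = m" "length T = m" using ST by (auto simp: m_def dest: mset_eq_length)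
  have carr: "rook S T \<in> carrier_mat m m" "rook [i] [i] \<in> carrier_mat 1 1"
    using rook_carrier[of S T] rook_carrier[of "[i]" "[i]"] len by simp_all
  note B = diag_block2[OF carr]
  let ?R = "rook (S @ [i]) (T @ [i])"
  have inner: "?R $$ (r, c) = rook S T $$ (r, c)" if "r < m" "c < m" for r c
    using that len by (simp add: rook_entry nth_append rank_append)
  have corner: "?R $$ (m, m) = rook [i] [i] $$ (0, 0)"
    using len count_list_mset[OF ST, of i] rank_last[of S i] rank_last[of T i]
    by (simp add: rook_entry nth_append)
  have off1: "?R $$ (r, m) = 0" if "r < m" for r
    using that len count_list_mset[OF ST, of i] rank_last[of T i] rank_count[of r S]
    by (auto simp: rook_entry nth_append rank_append)
  have off2: "?R $$ (m, c) = 0" if "c < m" for c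
    using that len count_list_mset[OF ST, of i] rank_last[of S i] rank_count[of c T]
    by (auto simp: rook_entry nth_append rank_append)
  show ?thesis
  proof (rule eq_matI)
    show dims: "dim_row ?R = dim_row (diag_block_mat [rook S T, rook [i] [i]])"
      "dim_col ?R = dim_col (diag_block_mat [rook S T, rook [i] [i]])"
      using B(1) len by (metis carrier_matD length_append_singleton rook_dims)+
    fix r c
    assume "r < dim_row (diag_block_mat [rook S T, rook [i] [i]])"
      "c < dim_col (diag_block_mat [rook S T, rook [i] [i]])"
    then have rc: "r < Suc m" "c < Suc m" using B(1) by (metis carrier_matD)+
    show "?R $$ (r, c) = diag_block_mat [rook S T, rook [i] [i]] $$ (r, c)"
      unfolding B(2)[OF rc] using rc inner corner off1 off2 by (auto simp: less_Suc_eq)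
  qed
qed

text \<open>For equal last colours both matrices are block sums and the comparison splits over the
  blocks. For distinct ones an edge leaves the blocks.\<close>

lemma rook_append_sub:
  assumes d1: "d1 \<in> carrier_mat m m" and d2: "d2 \<in> carrier_mat 1 1"
    and len: "length S = m" "length T = m" and mset: "mset (S @ [i]) = mset (T @ [j])"
  shows "rook (S @ [i]) (T @ [j]) \<in> sub_rooks (diag_block_mat [d1, d2]) \<longleftrightarrow>
    i = j \<and> rook S T \<in> sub_rooks d1 \<and> rook [i] [i] \<in> sub_rooks d2"
proof -
  note B = diag_block2[OF d1 d2]
  let ?R = "rook (S @ [i]) (T @ [j])"
  show ?thesis
  proof (cases "i = j")
    case False
    have "?R \<notin> sub_rooks (diag_block_mat [d1, d2])"
    proof
      assume sub: "?R \<in> sub_rooks (diag_block_mat [d1, d2])"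
      note nz = sub_rooksD(2)[OF sub B(1)]
      \<comment> \<open>One of two distinct colours is nonzero. The last row or column of that
        colour has an edge that does not end in the corner, where the block sum is zero.\<close>
      show False
      proof (cases "i = 0")
        case True
        then have "j \<noteq> 0" using False by simp
        then obtain r where r: "r < Suc m" "?R $$ (r, m) = u_elt j"
          using rook_col[OF mset, of m j] len by (auto simp: nth_append)
        then have "r \<noteq> m" using False len by (auto simp: rook_entry_u nth_append)
        then show False using nz[of r m] r B(2)[of r m] by auto
      next
        case i: False
        then obtain c where c: "c < Suc m" "?R $$ (m, c) = u_elt i"
          using rook_row[OF mset, of m i] len by (auto simp: nth_append)
        then have "c \<noteq> m" using False len by (auto simp: rook_entry_u nth_append)
        then show False using nz[of m c] c B(2)[of m c] by auto
      qed
    qed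
    then show ?thesis using False by simp
  next
    case True
    then have ST: "mset S = mset T" using mset by simp
    have carr: "rook S T \<in> carrier_mat m m" "rook [i] [i] \<in> carrier_mat 1 1"
      using rook_carrier[of S T] rook_carrier[of "[i]" "[i]"] len by simp_all
    define R where "R = diag_block_mat [rook S T, rook [i] [i]]"
    define D where "D = diag_block_mat [d1, d2]"
    note R = diag_block2[OF carr, folded R_def]
    define Q where "Q r c \<longleftrightarrow> (R $$ (r, c) \<noteq> 0 \<longrightarrow> R $$ (r, c) = D $$ (r, c))" for r c
    have "?R = R" unfolding R_def using rook_append_diag[OF ST] True by simp
    then have "?R \<in> sub_rooks (diag_block_mat [d1, d2]) \<longleftrightarrow> (\<forall>r<Suc m. \<forall>c<Suc m. Q r c)"
      unfolding sub_rooks_iff[OF B(1)] Q_def D_def using R(1) by simp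
    also have "\<dots> \<longleftrightarrow> (\<forall>r<m. \<forall>c<m. Q r c) \<and> (\<forall>r<m. Q r m) \<and> (\<forall>c<m. Q m c) \<and> Q m m"
      by (auto simp: less_Suc_eq)
    also have "(\<forall>r<m. Q r m) \<longleftrightarrow> True" by (simp add: Q_def R(2))
    also have "(\<forall>c<m. Q m c) \<longleftrightarrow> True" by (simp add: Q_def R(2))
    also have "Q m m \<longleftrightarrow> rook [i] [i] \<in> sub_rooks d2"
      unfolding sub_rooks_iff[OF d2] Q_def D_def B(2)[OF lessI lessI] R(2)[OF lessI lessI]
        using carr(2) by simp
    also have "(\<forall>r<m. \<forall>c<m. Q r c) \<longleftrightarrow> rook S T \<in> sub_rooks d1"
      unfolding sub_rooks_iff[OF d1] Q_def D_def using carr(1) B(2) R(2) by simp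
    finally show ?thesis using True by simp
  qed
qed

text \<open>A planar rook of size 1 is \<open>rook [i] [i]\<close> for a colour \<open>i\<close>, so
  the block sum is again of the form \<open>rook\<close>.\<close>

lemma diag_planar:
  assumes d1: "d1 \<in> planar_rook n m" and d2: "d2 \<in> planar_rook n 1"
  shows "diag_block_mat [d1, d2] \<in> planar_rook n (Suc m)"
proof -
  obtain S T where ST: "S \<in> colorings n m" "T \<in> colorings n m" "mset S = mset T" "d1 = rook S T"
    by (rule planar_rook_rook[OF d1])
  obtain S' T' where S': "S' \<in> colorings n 1" "T' \<in> colorings n 1" "mset S' = mset T'" "d2 = rook S' T'"
    by (rule planar_rook_rook[OF d2])
  define i where "i = hd S'"
  have "length S' = 1" "length T' = 1" "set S' \<subseteq> {..n}" using S'(1,2)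
    by (simp_all only: colorings_def mem_Collect_eq)
  then have S'i: "S' = [i]" and T': "T' = [hd T']" and "i \<le> n"
    unfolding i_def by (cases S'; cases T'; simp)+
  have "T' = [i]" using S'(3) unfolding S'i by (subst T', subst (asm) T') simp
  then have i: "d2 = rook [i] [i]" using S'(4) S'i by metis
  have "rook (S @ [i]) (T @ [i]) \<in> planar_rook n (Suc m)"
  proof (rule rook_planar)
    show "S @ [i] \<in> colorings n (Suc m)" using ST(1) \<open>i \<le> n\<close> unfolding colorings_def by simp
    show "T @ [i] \<in> colorings n (Suc m)" using ST(2) \<open>i \<le> n\<close> unfolding colorings_def by simp
  qed
  then show ?thesis unfolding ST(4) i rook_append_diag[OF ST(3)] .
qed

text \<open>The column colouring \<open>T\<close> is thus the same data as the tuple of column sets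
  that indexes the modules \<open>W_module\<close>.\<close>

lemma col_set_rook:
  assumes "mset S = mset T" "length T = m"
  shows "col_set k (rook S T) = {j. j < m \<and> T ! j = k}"
proof (cases "k = 0")
  case False
  have "length S = m" using assms by (metis size_mset)
  then show ?thesis using False rook_col[OF assms(1), of _ k] assms(2) by (auto simp: col_set_def)
next
  case True
  have "(\<forall>r<length S. rook S T $$ (r, j) = 0) \<longleftrightarrow> T ! j = 0" if j: "j < m" for j
  proof
    assume *: "\<forall>r<length S. rook S T $$ (r, j) = 0"
    show "T ! j = 0"
    proof (rule ccontr)
      assume "T ! j \<noteq> 0"
      then show False using rook_col[OF assms(1), of j "T ! j"] * j assms(2) by auto
    qed
  next
    assume "T ! j = 0"
    then show "\<forall>r<length S. rook S T $$ (r, j) = 0"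
      using j assms(2) by (auto simp: rook_entry)
  qed
  then show ?thesis using True assms(2) by (auto simp: col_set_def)
qed

section \<open>The matrix unit structure of the rook algebra\<close>

text \<open>These rules turn indicator factors into restrictions of the index set; the computations
  below keep indicators as factors.\<close>

declare sum_mult_of_bool_eq [simp del] sum_of_bool_mult_eq [simp del]

text \<open>
  The coefficient of \<open>x\<^sub>d\<close> in \<open>x\<close>, as \<open>b\<close> is the sum of the \<open>x\<^sub>d\<close> with \<open>d \<subseteq> b\<close>.
\<close>

definition x_coef :: "nat \<Rightarrow> nat \<Rightarrow> rook_alg \<Rightarrow> rook \<Rightarrow> complex" where
  "x_coef n m x d = (\<Sum>b\<in>planar_rook n m. of_bool (d \<in> sub_rooks b) * x b)"

definition coef :: "nat \<Rightarrow> nat \<Rightarrow> rook_alg \<Rightarrow> nat list \<Rightarrow> nat list \<Rightarrow> complex" where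
  "coef n m x S T = x_coef n m x (rook S T)"

text \<open>The index set of the matrix block that contains \<open>S\<close>.\<close>

definition col_class :: "nat \<Rightarrow> nat \<Rightarrow> nat list \<Rightarrow> nat list set" where
  "col_class n m S = {T \<in> colorings n m. mset T = mset S}"

lemma finite_col_class [simp]: "finite (col_class n m S)"
  unfolding col_class_def by simp

lemma CP_carrier: "x \<in> carrier (CP n m) \<longleftrightarrow> (\<forall>d. d \<notin> planar_rook n m \<longrightarrow> x d = 0)"
  by (simp add: CP_def)

lemma CP_simps: "\<zero>\<^bsub>CP n m\<^esub> = 0" "\<one>\<^bsub>CP n m\<^esub> = e_elt n m" "x \<oplus>\<^bsub>CP n m\<^esub> y = x + y"
  by (simp_all add: CP_def)

lemma CP_mult: "(x \<otimes>\<^bsub>CP n m\<^esub> y) d =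
   (\<Sum>(d1, d2) \<in> {(d1, d2) \<in> planar_rook n m \<times> planar_rook n m. d1 * d2 = d}. x d1 * y d2)"
  by (simp add: CP_def)

lemma x_coef_add: "x_coef n m (x + y) d = x_coef n m x d + x_coef n m y d"
  by (simp add: x_coef_def algebra_simps sum.distrib)

lemma x_coef_diff: "x_coef n m (x - y) d = x_coef n m x d - x_coef n m y d"
  by (simp add: x_coef_def algebra_simps sum_subtractf)

lemma x_coef_zero: "x_coef n m 0 d = 0"
  by (simp add: x_coef_def)

lemma x_coef_scale: "x_coef n m (\<lambda>b. c * x b) d = c * x_coef n m x d"
  by (simp add: x_coef_def sum_distrib_left mult.left_commute)

lemma x_coef_sum: "x_coef n m (\<lambda>b. \<Sum>i\<in>I. f i b) d = (\<Sum>i\<in>I. x_coef n m (f i) d)"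
  unfolding x_coef_def sum_distrib_left by (rule sum.swap)

lemma x_coef_basis: "d \<in> planar_rook n m \<Longrightarrow> x_coef n m (basis_elt d) b = of_bool (b \<in> sub_rooks d)"
proof -
  assume d: "d \<in> planar_rook n m"
  have "x_coef n m (basis_elt d) b = (\<Sum>d'\<in>planar_rook n m. if d' =
    d then of_bool (b \<in> sub_rooks d') else 0)"
    unfolding x_coef_def basis_elt_def by (rule sum.cong) auto
  then show ?thesis using d by simp
qed

lemma finite_sub_rooks: "d \<in> planar_rook n m \<Longrightarrow> finite (sub_rooks d)"
  by (rule finite_subset[OF _ finite_planar_rook[of n m]]) (auto dest: sub_rooks_planar)

lemma x_elt_CP: "d \<in> planar_rook n m \<Longrightarrow> x_elt d \<in> carrier (CP n m)"
  unfolding CP_carrier x_elt_def basis_elt_def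
  by (auto intro!: sum.neutral dest: sub_rooks_planar)

lemma basis_elt_CP: "d \<in> planar_rook n m \<Longrightarrow> basis_elt d \<in> carrier (CP n m)"
  unfolding CP_carrier basis_elt_def by auto

text \<open>The functionals \<open>x_coef\<close> are dual to the \<open>x_elt\<close>: exchanging
  the sums leaves the alternating sum over the rooks between \<open>b\<close> and
  \<open>d\<close>.\<close>

lemma x_coef_x_elt:
  assumes d: "d \<in> planar_rook n m"
  shows "x_coef n m (x_elt d) b = of_bool (b = d)"
proof -
  have "x_coef n m (x_elt d) b =
    (\<Sum>d' \<in> sub_rooks d. (-1) ^ (rook_size d - rook_size d') * x_coef n m (basis_elt d') b)"
    unfolding x_elt_def by (simp add: x_coef_sum x_coef_scale)
  also have "\<dots> = (\<Sum>d' \<in> sub_rooks d. if b \<in> sub_rooks d' then (-1) ^ (rook_size d - rook_size d') else 0)"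
    by (rule sum.cong[OF refl]) (simp add: x_coef_basis[OF sub_rooks_planar[OF d]])
  also have "\<dots> = (\<Sum>d' \<in> {d' \<in> sub_rooks d. b \<in> sub_rooks d'}. (-1) ^ (rook_size d - rook_size d'))"
    by (simp add: sum.inter_filter finite_sub_rooks[OF d])
  also have "\<dots> = of_bool (b = d)"
  proof (cases "b \<in> sub_rooks d")
    case True
    show ?thesis unfolding moebius_rook[OF True] by simp
  next
    case False
    then have e: "{d' \<in> sub_rooks d. b \<in> sub_rooks d'} = {}" using sub_rooks_trans by blast
    have "b \<noteq> d" using False sub_rooks_refl by blast
    then show ?thesis unfolding e by simp
  qed
  finally show ?thesis .
qed

text \<open>Triangularity with respect to size: at a rook \<open>d\<close> of maximal size among
  those with a nonzero coefficient, all proper enlargements have coefficient 0, so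
  \<open>x_coef n m x d\<close> is \<open>x d\<close>.\<close>

lemma x_coef_inj:
  assumes x: "x \<in> carrier (CP n m)" and 0: "\<And>d. d \<in> planar_rook n m \<Longrightarrow> x_coef n m x d = 0"
  shows "x = 0"
proof (rule ccontr)
  assume "x \<noteq> 0"
  then obtain d0 where "x d0 \<noteq> 0" by (auto simp: fun_eq_iff)
  define X where "X = {d \<in> planar_rook n m. x d \<noteq> 0}"
  have "finite X" "X \<noteq> {}" using \<open>x d0 \<noteq> 0\<close> x by (auto simp: X_def CP_carrier)
  then have "Max (rook_size ` X) \<in> rook_size ` X" by (intro Max_in) simp_all
  then obtain d where d1: "d \<in> X" "Max (rook_size ` X) = rook_size d" by blast
  have "rook_size b \<le> rook_size d" if "b \<in> X" for b
    unfolding d1(2)[symmetric] by (rule Max_ge) (use \<open>finite X\<close> that in simp_all)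
  note d = d1(1) this
  have "x_coef n m x d = (\<Sum>b\<in>{d}. of_bool (d \<in> sub_rooks b) * x b)"
    unfolding x_coef_def
  proof (rule sum.mono_neutral_right)
    show "\<forall>b\<in>planar_rook n m - {d}. of_bool (d \<in> sub_rooks b) * x b = 0"
    proof
      fix b assume b: "b \<in> planar_rook n m - {d}"
      have "x b = 0" if s: "d \<in> sub_rooks b"
      proof (rule ccontr)
        assume "x b \<noteq> 0"
        then have "card (supp b) \<le> card (supp d)" using d(2)[of b] b by (auto simp: X_def rook_size_supp)
        then have "supp d = supp b" using card_seteq[OF finite_supp sub_rooks_supp[OF s]] by simp
        then have "d = b" by (rule sub_rooks_eq[OF s sub_rooks_refl])
        then show False using b by simp
      qed
      then show "of_bool (d \<in> sub_rooks b) * x b = 0" by simp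
    qed
  qed (use d in \<open>auto simp: X_def\<close>)
  then have "x d = 0" using 0[of d] d sub_rooks_refl by (simp add: X_def)
  then show False using d by (simp add: X_def)
qed

lemma CP_diff: "x \<in> carrier (CP n m) \<Longrightarrow> y \<in> carrier (CP n m) \<Longrightarrow> x - y \<in> carrier (CP n m)"
  by (simp add: CP_carrier)

lemma CP_add: "x \<in> carrier (CP n m) \<Longrightarrow> y \<in> carrier (CP n m) \<Longrightarrow> x + y \<in> carrier (CP n m)"
  by (simp add: CP_carrier)

lemma CP_zero: "0 \<in> carrier (CP n m)"
  by (simp add: CP_carrier)

lemma CP_scale: "x \<in> carrier (CP n m) \<Longrightarrow> (\<lambda>d. c * x d) \<in> carrier (CP n m)"
  by (simp add: CP_carrier)

lemma CP_sum: "(\<And>i. i \<in> I \<Longrightarrow> f i \<in> carrier (CP n m)) \<Longrightarrow> (\<lambda>d. \<Sum>i\<in>I. f i d) \<in> carrier (CP n m)"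
  by (simp add: CP_carrier)

lemma CP_mult_closed: "x \<otimes>\<^bsub>CP n m\<^esub> y \<in> carrier (CP n m)"
  unfolding CP_carrier CP_mult
  by (auto intro!: sum.neutral simp: prod_planar)

lemma x_coef_eqI:
  assumes "x \<in> carrier (CP n m)" "y \<in> carrier (CP n m)"
    "\<And>d. d \<in> planar_rook n m \<Longrightarrow> x_coef n m x d = x_coef n m y d"
  shows "x = y"
  using x_coef_inj[of "x - y" n m] assms by (simp add: CP_diff x_coef_diff)

lemma coef_eqI:
  assumes "x \<in> carrier (CP n m)" "y \<in> carrier (CP n m)"
    "\<And>S T. \<lbrakk>S \<in> colorings n m; T \<in> colorings n m; mset S = mset T\<rbrakk> \<Longrightarrow> coef n m x S T = coef n m y S T"
  shows "x = y"
  by (rule x_coef_eqI[OF assms(1,2)]) (use assms(3) planar_rook_rook in \<open>metis coef_def\<close>)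

text \<open>Product and block sum of algebra elements are both defined by sums over fibres of a map
  on pairs; summing over all fibres gives back one sum over pairs.\<close>

lemma sum_pairs_fibre:
  assumes "finite A" "finite B"
  shows "(\<Sum>d\<in>B. of_bool (P d) * (\<Sum>p\<in>{p\<in>A. g p = d}. f p)) =
    (\<Sum>p\<in>{p\<in>A. g p \<in> B}. of_bool (P (g p)) * (f p :: complex))"
proof -
  have "(\<Sum>p\<in>{p\<in>A. g p \<in> B}. of_bool (P (g p)) * f p) =
     (\<Sum>d\<in>B. \<Sum>p\<in>{p\<in>{p\<in>A. g p \<in> B}. g p = d}. of_bool (P (g p)) * f p)"
    by (rule sum.group[symmetric]) (use assms in auto)
  also have "\<dots> = (\<Sum>d\<in>B. of_bool (P d) * (\<Sum>p\<in>{p\<in>A. g p = d}. f p))"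
  proof (rule sum.cong[OF refl])
    fix d assume "d \<in> B"
    then have "{p\<in>{p\<in>A. g p \<in> B}. g p = d} = {p\<in>A. g p = d}" by auto
    then show "(\<Sum>p\<in>{p\<in>{p\<in>A. g p \<in> B}. g p = d}. of_bool (P (g p)) * f p) = of_bool (P d) *
      (\<Sum>p\<in>{p\<in>A. g p = d}. f p)"
      by (simp add: sum_distrib_left)
  qed
  finally show ?thesis by simp
qed

lemma sum_split_pairs:
  "(\<Sum>(a, b) \<in> {(a, b) \<in> A \<times> B. h a b = d}. f a b) =
    (\<Sum>p\<in>{p\<in>A \<times> B. h (fst p) (snd p) = d}. f (fst p) (snd p))"
  by (rule sum.cong) auto

text \<open>By bilinearity this reduces to basis elements, where it is the statement that a middle
  colouring \<open>T\<close> exists, uniquely, exactly when \<open>rook S U\<close> lies below the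
  product.\<close>

lemma coef_mult:
  assumes S: "S \<in> colorings n m" and U: "U \<in> colorings n m" and SU: "mset S = mset U"
  shows "coef n m (x \<otimes>\<^bsub>CP n m\<^esub> y) S U = (\<Sum>T\<in>col_class n m S. coef n m x S T * coef n m y T U)"
proof -
  let ?P = "planar_rook n m"
  \<comment> \<open>At most one summand is nonzero, by \<open>rook_sub_unique\<close>; whether one
    is, by \<open>rook_sub_prod\<close> and \<open>rook_sub_prod_ex\<close>.\<close>
  have key: "of_bool (rook S U \<in> sub_rooks (d1 * d2)) =
     (\<Sum>T\<in>col_class n m S. of_bool (rook S T \<in> sub_rooks d1) *
       of_bool (rook T U \<in> sub_rooks d2) :: complex)"
    if d: "d1 \<in> ?P" "d2 \<in> ?P" for d1 d2
  proof (cases "rook S U \<in> sub_rooks (d1 * d2)")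
    case True
    then obtain T where T: "T \<in> colorings n m" "mset S = mset T" "rook S T \<in> sub_rooks d1"
      "rook T U \<in> sub_rooks d2"
      using rook_sub_prod_ex[OF d S U SU] by blast
    have "(\<Sum>T\<in>col_class n m S. of_bool (rook S T \<in> sub_rooks d1) *
      of_bool (rook T U \<in> sub_rooks d2) :: complex) =
       (\<Sum>T'\<in>{T}. of_bool (rook S T' \<in> sub_rooks d1) * of_bool (rook T' U \<in> sub_rooks d2))"
    proof (rule sum.mono_neutral_right)
      show "{T} \<subseteq> col_class n m S" using T by (simp add: col_class_def)
      show "\<forall>T'\<in>col_class n m S - {T}. of_bool (rook S T' \<in> sub_rooks d1) *
        of_bool (rook T' U \<in> sub_rooks d2) = (0::complex)"
      proof
        fix T' assume T': "T' \<in> col_class n m S - {T}"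
        then have "rook S T' \<notin> sub_rooks d1"
          using rook_sub_unique[OF d(1) S T(1) _ T(2) _ T(3), of T'] by (auto simp: col_class_def)
        then show "of_bool (rook S T' \<in> sub_rooks d1) * of_bool (rook T' U \<in> sub_rooks d2) =
          (0::complex)" by simp
      qed
    qed simp
    then show ?thesis using T True by simp
  next
    case False
    have "\<not> (rook S T \<in> sub_rooks d1 \<and> rook T U \<in> sub_rooks d2)" if "T \<in> col_class n m S" for T
    proof -
      have "T \<in> colorings n m" "mset S = mset T" "mset T = mset U" using that SU
        by (simp_all add: col_class_def)
      then show ?thesis using rook_sub_prod[OF d S _ U] False by blast
    qed
    then have "(\<Sum>T\<in>col_class n m S. of_bool (rook S T \<in> sub_rooks d1) *
      of_bool (rook T U \<in> sub_rooks d2) :: complex) = 0"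
      by (intro sum.neutral) auto
    then show ?thesis using False by simp
  qed
  have "coef n m (x \<otimes>\<^bsub>CP n m\<^esub> y) S U = (\<Sum>d\<in>?P. of_bool (rook S U \<in> sub_rooks d) *
     (\<Sum>p\<in>{p\<in>?P \<times> ?P. fst p * snd p = d}. x (fst p) * y (snd p)))"
    unfolding coef_def x_coef_def CP_mult sum_split_pairs ..
  also have "\<dots> = (\<Sum>p\<in>{p\<in>?P \<times> ?P. fst p * snd p \<in> ?P}. of_bool (rook S U \<in> sub_rooks (fst p *
    snd p)) * (x (fst p) * y (snd p)))"
    by (rule sum_pairs_fibre) auto
  also have "{p\<in>?P \<times> ?P. fst p * snd p \<in> ?P} = ?P \<times> ?P" using prod_planar by auto
  also have "(\<Sum>p\<in>?P \<times> ?P. of_bool (rook S U \<in> sub_rooks (fst p * snd p)) * (x (fst p) * y (snd p))) =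
     (\<Sum>p\<in>?P \<times> ?P. \<Sum>T\<in>col_class n m S. (of_bool (rook S T \<in> sub_rooks (fst p)) * x (fst p)) *
        (of_bool (rook T U \<in> sub_rooks (snd p)) * y (snd p)))"
  proof (rule sum.cong[OF refl])
    fix p assume "p \<in> ?P \<times> ?P"
    then have p: "fst p \<in> ?P" "snd p \<in> ?P" by auto
    show "of_bool (rook S U \<in> sub_rooks (fst p * snd p)) * (x (fst p) * y (snd p)) =
      (\<Sum>T\<in>col_class n m S. (of_bool (rook S T \<in> sub_rooks (fst p)) * x (fst p)) *
        (of_bool (rook T U \<in> sub_rooks (snd p)) * y (snd p)))"
      unfolding key[OF p] sum_distrib_right by (simp only: mult_ac)
  qed
  also have "\<dots> = (\<Sum>T\<in>col_class n m S. \<Sum>p\<in>?P \<times> ?P. (of_bool (rook S T \<in> sub_rooks (fst p)) * x (fst p)) *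
        (of_bool (rook T U \<in> sub_rooks (snd p)) * y (snd p)))"
    by (rule sum.swap)
  also have "\<dots> = (\<Sum>T\<in>col_class n m S. coef n m x S T * coef n m y T U)"
    by (rule sum.cong[OF refl]) (simp add: coef_def x_coef_def sum_product sum.cartesian_product case_prod_beta)
  finally show ?thesis .
qed

lemma alg_tensor_CP: "alg_tensor n m 1 x y \<in> carrier (CP n (Suc m))"
  unfolding CP_carrier alg_tensor_def
  by (intro allI impI sum.neutral) (auto simp: diag_planar simp del: diag_block_mat.simps)

text \<open>On basis elements this is \<open>rook_append_sub\<close>; the second factor enters only
  through its diagonal entry at the common last colour.\<close>

lemma coef_tensor:
  assumes "S \<in> colorings n m" "T \<in> colorings n m" "i \<le> n" "j \<le> n" "mset (S @ [i]) = mset (T @ [j])"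
  shows "coef n (Suc m) (alg_tensor n m 1 x y) (S @ [i]) (T @ [j]) =
    of_bool (i = j) * (coef n m x S T * coef n 1 y [i] [i])"
proof -
  let ?P = "planar_rook n m" and ?Q = "planar_rook n 1"
  have "coef n (Suc m) (alg_tensor n m 1 x y) (S @ [i]) (T @ [j]) =
    (\<Sum>d\<in>planar_rook n (Suc m). of_bool (rook (S @ [i]) (T @ [j]) \<in> sub_rooks d) *
     (\<Sum>p\<in>{p\<in>?P \<times> ?Q. diag_block_mat [fst p, snd p] = d}. x (fst p) * y (snd p)))"
    unfolding coef_def x_coef_def alg_tensor_def sum_split_pairs ..
  also have "\<dots> = (\<Sum>p\<in>{p\<in>?P \<times> ?Q. diag_block_mat [fst p, snd p] \<in> planar_rook n (Suc m)}.
      of_bool (rook (S @ [i]) (T @ [j]) \<in> sub_rooks (diag_block_mat [fst p, snd p])) * (x (fst p) *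
        y (snd p)))"
    by (rule sum_pairs_fibre) auto
  also have "{p\<in>?P \<times> ?Q. diag_block_mat [fst p, snd p] \<in> planar_rook n (Suc m)} = ?P \<times> ?Q"
    using diag_planar by (auto simp del: diag_block_mat.simps)
  also have "(\<Sum>p\<in>?P \<times> ?Q. of_bool (rook (S @ [i]) (T @ [j]) \<in> sub_rooks (diag_block_mat [fst p, snd p])) * (x (fst p) * y (snd p))) =
     (\<Sum>p\<in>?P \<times> ?Q. of_bool (i = j) * ((of_bool (rook S T \<in> sub_rooks (fst p)) * x (fst p)) *
        (of_bool (rook [i] [i] \<in> sub_rooks (snd p)) * y (snd p))))"
  proof (rule sum.cong[OF refl])
    fix p assume "p \<in> ?P \<times> ?Q"
    then have p: "fst p \<in> carrier_mat m m" "snd p \<in> carrier_mat 1 1"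
      using planar_rookD(1) by auto
    show "of_bool (rook (S @ [i]) (T @ [j]) \<in> sub_rooks (diag_block_mat [fst p, snd p])) *
      (x (fst p) * y (snd p)) =
      of_bool (i = j) * ((of_bool (rook S T \<in> sub_rooks (fst p)) * x (fst p)) *
        (of_bool (rook [i] [i] \<in> sub_rooks (snd p)) * y (snd p)))"
      unfolding rook_append_sub[OF p colorings_length[OF assms(1)] colorings_length[OF assms(2)] assms(5)]
      by (simp only: of_bool_conj mult_ac)
  qed
  also have "\<dots> = of_bool (i = j) * (coef n m x S T * coef n 1 y [i] [i])"
    unfolding coef_def x_coef_def sum_product sum.cartesian_product case_prod_beta
      by (simp only: sum_distrib_left)
  finally show ?thesis .
qed

section \<open>The identity and the embeddings in coordinates\<close>

definition I_mat :: "nat \<Rightarrow> rook" where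
  "I_mat i = mat 1 1 (\<lambda>_. if i = 0 then 0 else u_elt i)"

lemma I_mat_planar: "i \<le> n \<Longrightarrow> I_mat i \<in> planar_rook n 1"
  by (rule planar_rookI) (auto simp: I_mat_def)

text \<open>The sub-rooks of the 1 by 1 matrix \<open>I_mat i\<close> are itself and the zero
  matrix, so \<open>I_elt i\<close> is the sum of the matrix units of the colours \<open>i\<close>
  and 0.\<close>

lemma coef_I:
  assumes "i \<le> n"
  shows "coef n 1 (I_elt i) [k] [k] = of_bool (k = 0 \<or> k = i)"
proof -
  have "I_elt i = basis_elt (I_mat i)" by (simp add: I_elt_def I_mat_def)
  moreover have "rook [k] [k] \<in> sub_rooks (I_mat i) \<longleftrightarrow> k = 0 \<or> k = i"
    unfolding sub_rooks_def by (auto simp: I_mat_def rook_def rank_def)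
  ultimately show ?thesis
    by (simp only: coef_def x_coef_basis[OF I_mat_planar[OF assms]])
qed

text \<open>By \<open>coef_I\<close>, subtracting \<open>I_elt 0\<close> leaves exactly the matrix
  unit of colour \<open>i\<close> in size 1.\<close>

definition step_elt :: "nat \<Rightarrow> rook_alg" where
  "step_elt i = (if i = 0 then I_elt 0 else I_elt i - I_elt 0)"

lemma coef_step: "i \<le> n \<Longrightarrow> coef n 1 (step_elt i) [k] [k] = of_bool (k = i)"
  using coef_I[of i n k] coef_I[of 0 n k]
  by (auto simp: step_elt_def coef_def x_coef_diff)

lemma coef_e1:
  assumes "k \<le> n"
  shows "coef n 1 (e1_elt n) [k] [k] = 1"
proof -
  have "e1_elt n = (\<lambda>d. \<Sum>i = 1..n. I_elt i d) - (\<lambda>d. (of_nat n - 1) * I_elt 0 d)"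
    by (auto simp: e1_elt_def fun_eq_iff)
  then have "coef n 1 (e1_elt n) [k] [k] = (\<Sum>i =
    1..n. coef n 1 (I_elt i) [k] [k]) - (of_nat n - 1) * coef n 1 (I_elt 0) [k] [k]"
    by (simp add: coef_def x_coef_diff x_coef_sum x_coef_scale)
  also have "(\<Sum>i = 1..n. coef n 1 (I_elt i) [k] [k]) = (\<Sum>i = 1..n. of_bool (k = 0 \<or> k = i))"
    by (rule sum.cong[OF refl]; rule coef_I) simp
  \<comment> \<open>Each of the \<open>n\<close> elements contributes at colour 0, and the
    \<open>n - 1\<close> copies of \<open>I_elt 0\<close> correct this to 1; at a colour
    \<open>k \<noteq> 0\<close> only \<open>I_elt k\<close> contributes.\<close>
  also have "(\<Sum>i = 1..n. of_bool (k = 0 \<or> k = i)) = (if k = 0 then of_nat n else (1::complex))"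
  proof (cases "k = 0")
    case False
    then have "(\<Sum>i = 1..n. of_bool (k = 0 \<or> k = i)) = (\<Sum>i = 1..n. if k = i then 1 else (0::complex))"
      by (intro sum.cong) auto
    then show ?thesis using False assms by simp
  qed simp
  finally show ?thesis using coef_I[of 0 n k] by (cases "k = 0") simp_all
qed

lemma colorings_Suc:
  assumes "S \<in> colorings n (Suc m)"
  obtains S' i where "S = S' @ [i]" "S' \<in> colorings n m" "i \<le> n"
  using assms by (cases S rule: rev_cases) (auto simp: colorings_def)

lemma e_elt_CP: "e_elt n m \<in> carrier (CP n m)"
proof (cases m)
  case 0
  have "0\<^sub>m 0 0 \<in> planar_rook n 0" by (rule planar_rookI) auto
  then show ?thesis using 0 by (simp add: basis_elt_CP)
qed (use alg_tensor_CP in simp)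

text \<open>Induction by splitting off the last colour: \<open>e1_elt\<close> has entry 1 at every
  colour, so a block sum with it preserves identity matrices.\<close>

lemma coef_e:
  "\<lbrakk>S \<in> colorings n m; T \<in> colorings n m; mset S = mset T\<rbrakk> \<Longrightarrow> coef n m (e_elt n m) S T = of_bool (S = T)"
proof (induction m arbitrary: S T)
  case 0
  have "0\<^sub>m 0 0 \<in> planar_rook n 0" by (rule planar_rookI) auto
  moreover have "S = []" "T = []" using 0 by (auto simp: colorings_def)
  moreover have "rook [] [] \<in> sub_rooks (0\<^sub>m 0 0)" by (simp add: sub_rooks_def rook_def)
  ultimately show ?case by (simp add: coef_def x_coef_basis)
next
  case (Suc m)
  obtain S' i where S: "S = S' @ [i]" "S' \<in> colorings n m" "i \<le> n" using colorings_Suc[OF Suc.prems(1)] .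
  obtain T' j where T: "T = T' @ [j]" "T' \<in> colorings n m" "j \<le> n" using colorings_Suc[OF Suc.prems(2)] .
  have "coef n (Suc m) (e_elt n (Suc m)) S T = of_bool (i = j) * (coef n m (e_elt n m) S' T' * 1)"
    unfolding S(1) T(1) e_elt.simps
    by (subst coef_tensor) (use S T Suc.prems coef_e1 in auto)
  also have "\<dots> = of_bool (S = T)"
  proof (cases "i = j")
    case True
    then have "mset S' = mset T'" using Suc.prems(3) S T by simp
    then show ?thesis using Suc.IH[OF S(2) T(2)] S T True by simp
  qed (simp add: S T)
  finally show ?case .
qed

lemma psi_step: "psi n i (Suc m) x = alg_tensor n m 1 x (step_elt i)"
  by (simp add: psi_def step_elt_def)

lemma psi_CP: "psi n i (Suc m) x \<in> carrier (CP n (Suc m))"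
  unfolding psi_step by (rule alg_tensor_CP)

text \<open>In coordinates \<open>psi\<close> places \<open>x\<close> in the corner whose row and
  column colourings both end in \<open>i\<close>.\<close>

lemma coef_psi:
  assumes "S \<in> colorings n m" "T \<in> colorings n m" "a \<le> n" "b \<le> n" "mset (S @ [a]) = mset (T @ [b])"
    "i \<le> n"
  shows "coef n (Suc m) (psi n i (Suc m) x) (S @ [a]) (T @ [b]) = of_bool (a = i \<and> b = i) *
    coef n m x S T"
  unfolding psi_step coef_tensor[OF assms(1-5)] coef_step[OF assms(6)] by auto

lemma col_class_self: "S \<in> colorings n m \<Longrightarrow> S \<in> col_class n m S"
  by (simp add: col_class_def)

text \<open>All colourings in a product of entries have the same multiset, so this is associativity
  of matrices indexed by one \<open>col_class\<close>.\<close>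

lemma CP_assoc:
  "(x \<otimes>\<^bsub>CP n m\<^esub> y) \<otimes>\<^bsub>CP n m\<^esub> z = x \<otimes>\<^bsub>CP n m\<^esub> (y \<otimes>\<^bsub>CP n m\<^esub> z)"
proof (rule coef_eqI[of _ n m])
  fix S V assume S: "S \<in> colorings n m" and V: "V \<in> colorings n m" and SV: "mset S = mset V"
  have cc: "col_class n m T = col_class n m S" "mset T = mset S" "T \<in> colorings n m"
    if "T \<in> col_class n m S" for T
    using that by (auto simp: col_class_def)
  have "coef n m ((x \<otimes>\<^bsub>CP n m\<^esub> y) \<otimes>\<^bsub>CP n m\<^esub> z) S V =
    (\<Sum>U\<in>col_class n m S. (\<Sum>T\<in>col_class n m S. coef n m x S T * coef n m y T U) * coef n m z U V)"
    unfolding coef_mult[OF S V SV]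
    by (rule sum.cong[OF refl]) (use S cc in \<open>simp add: coef_mult\<close>)
  also have "\<dots> = (\<Sum>T\<in>col_class n m S. coef n m x S T *
    (\<Sum>U\<in>col_class n m S. coef n m y T U * coef n m z U V))"
    unfolding sum_distrib_left sum_distrib_right by (subst sum.swap) (simp add: mult.assoc)
  also have "\<dots> = coef n m (x \<otimes>\<^bsub>CP n m\<^esub> (y \<otimes>\<^bsub>CP n m\<^esub> z)) S V"
    unfolding coef_mult[OF S V SV]
    by (rule sum.cong[OF refl]) (use V cc SV in \<open>simp add: coef_mult\<close>)
  finally show "coef n m ((x \<otimes>\<^bsub>CP n m\<^esub> y) \<otimes>\<^bsub>CP n m\<^esub> z) S V =
    coef n m (x \<otimes>\<^bsub>CP n m\<^esub> (y \<otimes>\<^bsub>CP n m\<^esub> z)) S V" .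
qed (simp_all add: CP_mult_closed)

lemma sum_of_bool_delta:
  fixes f :: "'a \<Rightarrow> complex"
  assumes "finite A"
  shows "(\<Sum>T\<in>A. of_bool (S = T) * f T) = of_bool (S \<in> A) * f S"
    "(\<Sum>T\<in>A. f T * of_bool (T = S)) = f S * of_bool (S \<in> A)"
proof -
  have "(\<Sum>T\<in>A. of_bool (S = T) * f T) = (\<Sum>T\<in>A. if S = T then f T else 0)"
    "(\<Sum>T\<in>A. f T * of_bool (T = S)) = (\<Sum>T\<in>A. if T = S then f T else 0)"
    by (rule sum.cong; simp)+
  then show "(\<Sum>T\<in>A. of_bool (S = T) * f T) = of_bool (S \<in> A) * f S"
    "(\<Sum>T\<in>A. f T * of_bool (T = S)) = f S * of_bool (S \<in> A)"
    using assms by simp_all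
qed

lemma CP_one:
  assumes "x \<in> carrier (CP n m)"
  shows "e_elt n m \<otimes>\<^bsub>CP n m\<^esub> x = x" "x \<otimes>\<^bsub>CP n m\<^esub> e_elt n m = x"
proof -
  show "e_elt n m \<otimes>\<^bsub>CP n m\<^esub> x = x"
  proof (rule coef_eqI[OF CP_mult_closed assms])
    fix S T assume ST: "S \<in> colorings n m" "T \<in> colorings n m" "mset S = mset T"
    have "coef n m (e_elt n m \<otimes>\<^bsub>CP n m\<^esub> x) S T = (\<Sum>U\<in>col_class n m S. of_bool (S = U) * coef n m x U T)"
      unfolding coef_mult[OF ST] by (rule sum.cong[OF refl]) (use ST
        in \<open>auto simp: col_class_def coef_e\<close>)
    then show "coef n m (e_elt n m \<otimes>\<^bsub>CP n m\<^esub> x) S T = coef n m x S T"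
      using ST by (simp add: sum_of_bool_delta col_class_self)
  qed
  show "x \<otimes>\<^bsub>CP n m\<^esub> e_elt n m = x"
  proof (rule coef_eqI[OF CP_mult_closed assms])
    fix S T assume ST: "S \<in> colorings n m" "T \<in> colorings n m" "mset S = mset T"
    have "coef n m (x \<otimes>\<^bsub>CP n m\<^esub> e_elt n m) S T = (\<Sum>U\<in>col_class n m S. coef n m x S U * of_bool (U = T))"
      unfolding coef_mult[OF ST] by (rule sum.cong[OF refl]) (use ST
        in \<open>auto simp: col_class_def coef_e\<close>)
    then show "coef n m (x \<otimes>\<^bsub>CP n m\<^esub> e_elt n m) S T = coef n m x S T"
      using ST by (simp add: sum_of_bool_delta col_class_def)
  qed
qed

lemma CP_distrib:
  "(x + y) \<otimes>\<^bsub>CP n m\<^esub> z = x \<otimes>\<^bsub>CP n m\<^esub> z + y \<otimes>\<^bsub>CP n m\<^esub> z"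
  "z \<otimes>\<^bsub>CP n m\<^esub> (x + y) = z \<otimes>\<^bsub>CP n m\<^esub> x + z \<otimes>\<^bsub>CP n m\<^esub> y"
  by (auto simp: fun_eq_iff CP_mult case_prod_beta algebra_simps sum.distrib)

lemma ring_CP: "ring (CP n m)"
proof (rule ringI)
  show "abelian_group (CP n m)"
  proof (rule abelian_groupI)
    fix x assume "x \<in> carrier (CP n m)"
    then show "\<exists>y\<in>carrier (CP n m). y \<oplus>\<^bsub>CP n m\<^esub> x = \<zero>\<^bsub>CP n m\<^esub>"
      by (intro bexI[of _ "0 - x"] CP_diff CP_zero) (simp_all add: CP_simps)
  qed (simp_all add: CP_simps CP_add CP_zero algebra_simps)
  show "Group.monoid (CP n m)"
    by (rule monoidI) (simp_all add: CP_simps CP_mult_closed e_elt_CP CP_assoc CP_one)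
qed (simp_all add: CP_simps CP_distrib)

section \<open>Simple modules\<close>

interpretation CP: ring "CP n m" for n m by (rule ring_CP)

section \<open>Matrix units\<close>

definition munit :: "nat list \<Rightarrow> nat list \<Rightarrow> rook_alg" where
  "munit S T = x_elt (rook S T)"

definition scale :: "complex \<Rightarrow> rook_alg \<Rightarrow> rook_alg" where
  "scale c x = (\<lambda>d. c * x d)"

lemma scale_CP: "x \<in> carrier (CP n m) \<Longrightarrow> scale c x \<in> carrier (CP n m)"
  unfolding scale_def by (rule CP_scale)

lemma coef_scale: "coef n m (scale c x) S T = c * coef n m x S T"
  by (simp add: scale_def coef_def x_coef_scale)

lemma scale_mult: "scale c x \<otimes>\<^bsub>CP n m\<^esub> y = scale c (x \<otimes>\<^bsub>CP n m\<^esub> y)"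
  by (auto simp: fun_eq_iff CP_mult scale_def sum_distrib_left case_prod_beta mult.assoc)

lemma coef_add: "coef n m (x + y) S T = coef n m x S T + coef n m y S T"
  by (simp add: coef_def x_coef_add)

lemma coef_zero: "coef n m 0 S T = 0"
  by (simp add: coef_def x_coef_zero)

lemma munit_CP: "\<lbrakk>S \<in> colorings n m; T \<in> colorings n m\<rbrakk> \<Longrightarrow> munit S T \<in> carrier (CP n m)"
  unfolding munit_def by (intro x_elt_CP rook_planar)

lemma coef_munit:
  assumes "S \<in> colorings n m" "T \<in> colorings n m" "mset S = mset T" "mset S' = mset T'"
  shows "coef n m (munit S T) S' T' = of_bool (S = S' \<and> T = T')"
proof -
  have "rook S' T' = rook S T \<longleftrightarrow> S = S' \<and> T = T'"
    using rook_inj[OF assms(4,3)] by blast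
  then show ?thesis
    unfolding coef_def munit_def x_coef_x_elt[OF rook_planar[OF assms(1,2)]] by simp
qed

text \<open>Left multiplication by a matrix unit moves row \<open>T\<close> of \<open>x\<close> to
  row \<open>S\<close> and erases everything else.\<close>

lemma coef_munit_mult_left:
  assumes ST: "S \<in> colorings n m" "T \<in> colorings n m" "mset S = mset T"
    and SU: "S' \<in> colorings n m" "U \<in> colorings n m" "mset S' = mset U"
  shows "coef n m (munit S T \<otimes>\<^bsub>CP n m\<^esub> x) S' U = of_bool (S = S') * coef n m x T U"
proof -
  have "coef n m (munit S T \<otimes>\<^bsub>CP n m\<^esub> x) S' U =
    (\<Sum>V\<in>col_class n m S'. of_bool (T = V) * (of_bool (S = S') * coef n m x V U))"
    unfolding coef_mult[OF SU]
  proof (rule sum.cong[OF refl])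
    fix V assume "V \<in> col_class n m S'"
    then have "mset S' = mset V" by (simp add: col_class_def)
    then show "coef n m (munit S T) S' V * coef n m x V U = of_bool (T = V) *
      (of_bool (S = S') * coef n m x V U)"
      by (auto simp: coef_munit[OF ST])
  qed
  also have "\<dots> = of_bool (T \<in> col_class n m S') * (of_bool (S = S') * coef n m x T U)"
    by (simp only: sum_of_bool_delta finite_col_class)
  also have "\<dots> = of_bool (S = S') * coef n m x T U"
    using ST by (auto simp: col_class_def)
  finally show ?thesis .
qed

lemma coef_munit_mult_right:
  assumes ST: "S \<in> colorings n m" "T \<in> colorings n m" "mset S = mset T"
    and SU: "S' \<in> colorings n m" "U \<in> colorings n m" "mset S' = mset U"
  shows "coef n m (x \<otimes>\<^bsub>CP n m\<^esub> munit S T) S' U = coef n m x S' S * of_bool (T = U)"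
proof -
  have "coef n m (x \<otimes>\<^bsub>CP n m\<^esub> munit S T) S' U =
    (\<Sum>V\<in>col_class n m S'. (coef n m x S' V * of_bool (T = U)) * of_bool (V = S))"
    unfolding coef_mult[OF SU]
  proof (rule sum.cong[OF refl])
    fix V assume "V \<in> col_class n m S'"
    then have "mset V = mset U" using SU by (simp add: col_class_def)
    then show "coef n m x S' V * coef n m (munit S T) V U = (coef n m x S' V * of_bool (T = U)) *
      of_bool (V = S)"
      by (auto simp: coef_munit[OF ST])
  qed
  also have "\<dots> = (coef n m x S' S * of_bool (T = U)) * of_bool (S \<in> col_class n m S')"
    by (simp only: sum_of_bool_delta finite_col_class)
  also have "\<dots> = coef n m x S' S * of_bool (T = U)"
    using ST SU by (auto simp: col_class_def)
  finally show ?thesis .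
qed

lemma munit_mult:
  assumes ST: "S \<in> colorings n m" "T \<in> colorings n m" "mset S = mset T"
    and TU: "T' \<in> colorings n m" "U \<in> colorings n m" "mset T' = mset U"
  shows "munit S T \<otimes>\<^bsub>CP n m\<^esub> munit T' U = (if T = T' then munit S U else 0)"
proof (rule coef_eqI[of _ n m])
  show "(if T = T' then munit S U else 0) \<in> carrier (CP n m)"
    using munit_CP[OF ST(1) TU(2)] CP_zero by simp
  fix A B assume AB: "A \<in> colorings n m" "B \<in> colorings n m" "mset A = mset B"
  have "coef n m (munit S T \<otimes>\<^bsub>CP n m\<^esub> munit T' U) A B = of_bool (S = A) * coef n m (munit T' U) T B"
    by (rule coef_munit_mult_left[OF ST AB])
  also have "\<dots> = of_bool (S = A \<and> T = T' \<and> U = B)"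
  proof (cases "S = A")
    case True
    then have "mset T = mset B" using ST AB by simp
    then show ?thesis unfolding coef_munit[OF TU \<open>mset T = mset B\<close>] using True by auto
  qed simp
  also have "\<dots> = coef n m (if T = T' then munit S U else 0) A B"
  proof (cases "T = T'")
    case True
    then have "mset S = mset U" using ST TU by simp
    then show ?thesis using True by (simp add: coef_munit[OF ST(1) TU(2) _ AB(3)])
  qed (simp add: coef_zero)
  finally show "coef n m (munit S T \<otimes>\<^bsub>CP n m\<^esub> munit T' U) A B =
    coef n m (if T = T' then munit S U else 0) A B" .
qed (rule CP_mult_closed)

lemma munit_mult_same:
  "\<lbrakk>S \<in> colorings n m; T \<in> colorings n m; U \<in> colorings n m; mset S = mset T; mset T = mset U\<rbrakk>
    \<Longrightarrow> munit S T \<otimes>\<^bsub>CP n m\<^esub> munit T U = munit S U"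
  using munit_mult[of S n m T T U] by simp

lemma munit_nonzero:
  assumes "T \<in> colorings n m" shows "munit T T \<noteq> 0"
  using coef_munit[OF assms assms refl refl[of "mset T"]] coef_zero[of n m T T] by auto

text \<open>
  The left ideal generated by \<open>E\<^sub>T\<^sub>T\<close> is minimal.
\<close>

lemma munit_left_inverse:
  assumes T: "T \<in> colorings n m" and nz: "z \<otimes>\<^bsub>CP n m\<^esub> munit T T \<noteq> 0"
  shows "\<exists>y \<in> carrier (CP n m). y \<otimes>\<^bsub>CP n m\<^esub> (z \<otimes>\<^bsub>CP n m\<^esub> munit T T) = munit T T"
proof -
  let ?z = "z \<otimes>\<^bsub>CP n m\<^esub> munit T T"
  have hz: "coef n m ?z S U = coef n m z S T * of_bool (T = U)"
    if "S \<in> colorings n m" "U \<in> colorings n m" "mset S = mset U" for S U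
    by (rule coef_munit_mult_right[OF T T refl that])
  obtain S where S: "S \<in> colorings n m" "mset S = mset T" "coef n m z S T \<noteq> 0"
  proof (rule ccontr)
    assume "\<not> thesis"
    then have 0: "coef n m z S T = 0" if "S \<in> colorings n m" "mset S = mset T" for S
      using \<open>\<And>S. \<lbrakk>S \<in> colorings n m; mset S = mset T; coef n m z S T \<noteq> 0\<rbrakk> \<Longrightarrow> thesis\<close> that by blast
    have "?z = 0"
      by (rule coef_eqI[OF CP_mult_closed CP_zero]) (use hz 0 in \<open>auto simp: coef_zero\<close>)
    then show False using nz by simp
  qed
  \<comment> \<open>Column \<open>T\<close> has a nonzero entry in some row \<open>S\<close>; this
    multiple of a matrix unit moves that row to row \<open>T\<close> and normalises the entry to
    1.\<close>
  define y where "y = scale (1 / coef n m z S T) (munit T S)"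
  have y: "y \<in> carrier (CP n m)" unfolding y_def by (intro scale_CP munit_CP T S)
  have "y \<otimes>\<^bsub>CP n m\<^esub> ?z = munit T T"
  proof (rule coef_eqI[OF CP_mult_closed munit_CP[OF T T]])
    fix A B assume AB: "A \<in> colorings n m" "B \<in> colorings n m" "mset A = mset B"
    have "coef n m (y \<otimes>\<^bsub>CP n m\<^esub> ?z) A B = (1 / coef n m z S T) * (of_bool (T = A) * coef n m ?z S B)"
      unfolding y_def scale_mult coef_scale
      by (simp only: coef_munit_mult_left[OF T S(1) S(2)[symmetric] AB])
    also have "\<dots> = of_bool (T = A \<and> T = B)"
    proof (cases "T = A")
      case True
      then have "mset S = mset B" using S AB by simp
      then show ?thesis using hz[OF S(1) AB(2)] True S(3) by simp
    qed simp
    finally show "coef n m (y \<otimes>\<^bsub>CP n m\<^esub> ?z) A B = coef n m (munit T T) A B"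
      by (simp add: coef_munit[OF T T refl AB(3)])
  qed
  then show ?thesis using y by blast
qed

lemma finsum_CP:
  assumes "finite I" "\<And>i. i \<in> I \<Longrightarrow> f i \<in> carrier (CP n m)"
  shows "finsum (CP n m) f I = (\<lambda>d. \<Sum>i\<in>I. f i d)"
  using assms
proof (induction I rule: finite_induct)
  case empty
  then show ?case by (simp add: CP_simps fun_eq_iff)
next
  case (insert i I)
  have "f \<in> I \<rightarrow> carrier (CP n m)" using insert.prems by auto
  then show ?case using insert by (simp add: CP_simps fun_eq_iff)
qed

lemma coef_sum: "coef n m (\<lambda>b. \<Sum>i\<in>I. f i b) S T = (\<Sum>i\<in>I. coef n m (f i) S T)"
  by (simp add: coef_def x_coef_sum)

text \<open>The identity decomposes into orthogonal idempotents, so every nonzero vector survives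
  under at least one of them.\<close>

lemma e_elt_sum: "e_elt n m = finsum (CP n m) (\<lambda>T. munit T T) (colorings n m)"
proof -
  have *: "finsum (CP n m) (\<lambda>T. munit T T) (colorings n m) = (\<lambda>d. \<Sum>T\<in>colorings n m. munit T T d)"
    by (rule finsum_CP) (auto intro: munit_CP)
  show ?thesis
    unfolding *
  proof (rule coef_eqI[OF e_elt_CP CP_sum])
    fix S T assume ST: "S \<in> colorings n m" "T \<in> colorings n m" "mset S = mset T"
    have "coef n m (\<lambda>d. \<Sum>U\<in>colorings n m. munit U U d) S T =
      (\<Sum>U\<in>colorings n m. of_bool (S = T) * of_bool (U = S))"
      unfolding coef_sum by (rule sum.cong[OF refl]) (auto simp: coef_munit[OF _ _ refl ST(3)])
    then show "coef n m (e_elt n m) S T = coef n m (\<lambda>d. \<Sum>U\<in>colorings n m. munit U U d) S T"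
      using ST by (simp only: coef_e sum_of_bool_delta finite_colorings) simp
  qed (auto intro: munit_CP)
qed

lemma mult_munit_expand:
  assumes T: "T \<in> colorings n m" and x: "x \<in> carrier (CP n m)"
  shows "x \<otimes>\<^bsub>CP n m\<^esub> munit T T =
    finsum (CP n m) (\<lambda>S. scale (coef n m x S T) (munit S T)) (col_class n m T)"
proof -
  have *: "finsum (CP n m) (\<lambda>S. scale (coef n m x S T) (munit S T)) (col_class n m T) =
     (\<lambda>d. \<Sum>S\<in>col_class n m T. scale (coef n m x S T) (munit S T) d)"
    by (rule finsum_CP) (use T in \<open>auto simp: col_class_def intro: munit_CP scale_CP\<close>)
  show ?thesis
    unfolding *
  proof (rule coef_eqI[OF CP_mult_closed CP_sum])
    fix A B assume AB: "A \<in> colorings n m" "B \<in> colorings n m" "mset A = mset B"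
    have "coef n m (\<lambda>d. \<Sum>S\<in>col_class n m T. scale (coef n m x S T) (munit S T) d) A B =
      (\<Sum>S\<in>col_class n m T. (coef n m x S T * of_bool (T = B)) * of_bool (S = A))"
      unfolding coef_sum
    proof (rule sum.cong[OF refl])
      fix S assume "S \<in> col_class n m T"
      then have "S \<in> colorings n m" "mset S = mset T" by (auto simp: col_class_def)
      then show "coef n m (scale (coef n m x S T) (munit S T)) A B =
        (coef n m x S T * of_bool (T = B)) * of_bool (S = A)"
        using coef_munit[OF _ T _ AB(3), of S] by (auto simp: coef_scale)
    qed
    also have "\<dots> = (coef n m x A T * of_bool (T = B)) * of_bool (A \<in> col_class n m T)"
      by (simp only: sum_of_bool_delta finite_col_class)
    also have "\<dots> = coef n m (x \<otimes>\<^bsub>CP n m\<^esub> munit T T) A B"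
      unfolding coef_munit_mult_right[OF T T refl AB] using AB by (auto simp: col_class_def)
    finally show "coef n m (x \<otimes>\<^bsub>CP n m\<^esub> munit T T) A B =
      coef n m (\<lambda>d. \<Sum>S\<in>col_class n m T. scale (coef n m x S T) (munit S T) d) A B" by simp
  qed (use T in \<open>auto simp: col_class_def intro: munit_CP scale_CP\<close>)
qed

section \<open>The modules \<open>W\<close> as left ideals\<close>

definition W_col :: "nat \<Rightarrow> nat \<Rightarrow> nat list \<Rightarrow> rook_module" where
  "W_col n m T = W_module n m (\<lambda>k. {j. j < m \<and> T ! j = k})"

lemma W_module_cong: "(\<And>k. k \<le> n \<Longrightarrow> F k = G k) \<Longrightarrow> W_module n m F = W_module n m G"
  unfolding W_module_def by (simp cong: conj_cong)

lemma W_simps: "\<zero>\<^bsub>W_col n m T\<^esub> = 0" "x \<oplus>\<^bsub>W_col n m T\<^esub> y = x + y" "x \<odot>\<^bsub>W_col n m T\<^esub> y = x \<otimes>\<^bsub>CP n m\<^esub> y"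
  by (simp_all add: W_col_def W_module_def)

lemma W_index:
  assumes T: "T \<in> colorings n m"
  shows "{d \<in> planar_rook n m. \<forall>k\<le>n. col_set k d = {j. j < m \<and> T ! j = k}} =
    (\<lambda>S. rook S T) ` col_class n m T"
proof (intro equalityI subsetI)
  fix d assume "d \<in> {d \<in> planar_rook n m. \<forall>k\<le>n. col_set k d = {j. j < m \<and> T ! j = k}}"
  then have d: "d \<in> planar_rook n m" and k: "\<And>k. k \<le> n \<Longrightarrow> col_set k d = {j. j < m \<and> T ! j = k}" by auto
  obtain S U where SU: "S \<in> colorings n m" "U \<in> colorings n m" "mset S = mset U" "d = rook S U"
    by (rule planar_rook_rook[OF d])
  have "U = T"
  proof (rule nth_equalityI)
    show "length U = length T" using SU T by (simp add: colorings_def)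
    fix j assume "j < length U"
    then have j: "j < m" "U ! j \<le> n" using SU(2) by (auto simp: colorings_def subset_eq)
    have "col_set (U ! j) d = {i. i < m \<and> U ! i = U ! j}"
      unfolding SU(4) by (rule col_set_rook[OF SU(3) colorings_length[OF SU(2)]])
    then have "j \<in> {i. i < m \<and> T ! i = U ! j}" unfolding k[OF j(2), symmetric] using j(1) by simp
    then show "U ! j = T ! j" by simp
  qed
  then show "d \<in> (\<lambda>S. rook S T) ` col_class n m T" using SU by (auto simp: col_class_def)
next
  fix d assume "d \<in> (\<lambda>S. rook S T) ` col_class n m T"
  then obtain S where S: "S \<in> colorings n m" "mset S = mset T" "d = rook S T"
    by (auto simp: col_class_def)
  then show "d \<in> {d \<in> planar_rook n m. \<forall>k\<le>n. col_set k d = {j. j < m \<and> T ! j = k}}"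
    using rook_planar[OF S(1) T] col_set_rook[OF S(2) colorings_length[OF T]] by simp
qed

text \<open>The span defining \<open>W\<close> is column \<open>T\<close> of its matrix block.
  Describing it as the fixed points of right multiplication by the idempotent makes the module
  axioms immediate.\<close>

lemma W_carrier:
  assumes T: "T \<in> colorings n m"
  shows "carrier (W_col n m T) = {x \<in> carrier (CP n m). x \<otimes>\<^bsub>CP n m\<^esub> munit T T = x}"
proof -
  have inj: "inj_on (\<lambda>S. rook S T) (col_class n m T)"
    by (rule inj_onI) (auto simp: col_class_def dest: rook_inj)
  have expand: "(\<lambda>b. \<Sum>d \<in> {d \<in> planar_rook n m. \<forall>k\<le>n. col_set k d = {j. j < m \<and> T ! j = k}}. a d *
    x_elt d b) =
     (\<lambda>b. \<Sum>S\<in>col_class n m T. scale (a (rook S T)) (munit S T) b)" for a :: "rook \<Rightarrow> complex"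
    unfolding W_index[OF T] sum.reindex[OF inj] by (simp add: scale_def munit_def)
  have clS: "S \<in> colorings n m" "mset S = mset T" if "S \<in> col_class n m T" for S
    using that by (auto simp: col_class_def)
  show ?thesis
  proof (intro equalityI subsetI)
    fix x assume "x \<in> carrier (W_col n m T)"
    then obtain a where x: "x = (\<lambda>b. \<Sum>S\<in>col_class n m T. scale (a (rook S T)) (munit S T) b)"
      unfolding W_col_def W_module_def expand by auto
    have xCP: "x \<in> carrier (CP n m)"
      unfolding x by (rule CP_sum) (use T in \<open>auto intro: scale_CP munit_CP dest: clS\<close>)
    have "x \<otimes>\<^bsub>CP n m\<^esub> munit T T = x"
    proof (rule coef_eqI[OF CP_mult_closed xCP])
      fix A B assume AB: "A \<in> colorings n m" "B \<in> colorings n m" "mset A = mset B"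
      have "coef n m x A B = 0" if "B \<noteq> T"
        unfolding x coef_sum coef_scale
      proof (rule sum.neutral, rule ballI)
        fix S assume "S \<in> col_class n m T"
        then show "a (rook S T) * coef n m (munit S T) A B = 0"
          using coef_munit[OF clS(1) T clS(2) AB(3)] that by auto
      qed
      then show "coef n m (x \<otimes>\<^bsub>CP n m\<^esub> munit T T) A B = coef n m x A B"
        unfolding coef_munit_mult_right[OF T T refl AB] by (cases "T = B") auto
    qed
    then show "x \<in> {x \<in> carrier (CP n m). x \<otimes>\<^bsub>CP n m\<^esub> munit T T = x}" using xCP by simp
  next
    fix x assume "x \<in> {x \<in> carrier (CP n m). x \<otimes>\<^bsub>CP n m\<^esub> munit T T = x}"
    then have x: "x \<in> carrier (CP n m)" "x \<otimes>\<^bsub>CP n m\<^esub> munit T T = x" by auto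
    have "x = finsum (CP n m) (\<lambda>S. scale (coef n m x S T) (munit S T)) (col_class n m T)"
      using mult_munit_expand[OF T x(1)] x(2) by simp
    also have "\<dots> = (\<lambda>d. \<Sum>S\<in>col_class n m T. scale (x_coef n m x (rook S T)) (munit S T) d)"
      unfolding coef_def by (rule finsum_CP) (use T in \<open>auto intro: scale_CP munit_CP dest: clS\<close>)
    finally show "x \<in> carrier (W_col n m T)"
      unfolding W_col_def W_module_def expand by auto
  qed
qed

lemma left_module_W:
  assumes T: "T \<in> colorings n m"
  shows "left_module (CP n m) (W_col n m T)"
proof -
  have W_col: "x \<in> carrier (W_col n m T) \<longleftrightarrow> x \<in> carrier (CP n m) \<and> x \<otimes>\<^bsub>CP n m\<^esub> munit T T = x" for x
    by (simp add: W_carrier[OF T])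
  have z: "0 \<otimes>\<^bsub>CP n m\<^esub> y = 0" for y by (simp add: fun_eq_iff CP_mult case_prod_beta)
  have d: "(x - y) \<otimes>\<^bsub>CP n m\<^esub> u = x \<otimes>\<^bsub>CP n m\<^esub> u - y \<otimes>\<^bsub>CP n m\<^esub> u" for x y u
    using CP_distrib(1)[of n m "x - y" y u] by (simp add: algebra_simps)
  have ab: "abelian_group (W_col n m T)"
  proof (rule abelian_groupI)
    fix x assume "x \<in> carrier (W_col n m T)"
    then show "\<exists>y\<in>carrier (W_col n m T). y \<oplus>\<^bsub>W_col n m T\<^esub> x = \<zero>\<^bsub>W_col n m T\<^esub>"
      by (intro bexI[of _ "0 - x"]) (simp_all only: W_col W_simps d z CP_diff CP_zero, auto)
  qed (simp_all add: W_col W_simps CP_add CP_zero CP_distrib z algebra_simps)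
  interpret W_col: abelian_group "W_col n m T" by (rule ab)
  show ?thesis
    by unfold_locales
      (auto simp: W_col W_simps CP_mult_closed CP_distrib CP_assoc CP_simps CP_one munit_CP[OF T T])
qed

text \<open>A working substitute for "simple of type \<open>T\<close>": it implies irreducibility
  and finite dimension, determines the module up to isomorphism, and can be followed through
  induction and restriction.\<close>

definition cyclic_at :: "nat \<Rightarrow> nat \<Rightarrow> nat list \<Rightarrow> (rook_alg, 'v, 's) module_scheme \<Rightarrow> 'v \<Rightarrow> bool" where
  "cyclic_at n m T M w \<longleftrightarrow> left_module (CP n m) M \<and> T \<in> colorings n m \<and> w \<in> carrier M \<and>
     munit T T \<odot>\<^bsub>M\<^esub> w = w \<and> w \<noteq> \<zero>\<^bsub>M\<^esub> \<and>
     (\<forall>v \<in> carrier M. \<exists>x \<in> carrier (CP n m). v = x \<odot>\<^bsub>M\<^esub> w)"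

lemma cyclic_at_W:
  assumes T: "T \<in> colorings n m"
  shows "cyclic_at n m T (W_col n m T) (munit T T)"
proof -
  have m: "munit T T \<otimes>\<^bsub>CP n m\<^esub> munit T T = munit T T"
    by (rule munit_mult_same) (simp_all add: T)
  show ?thesis
    unfolding cyclic_at_def W_simps W_carrier[OF T]
    using left_module_W[OF T] T munit_CP[OF T T] munit_nonzero[OF T] m by auto metis
qed

locale cyclic =
  fixes n m :: nat and T :: "nat list" and M :: "(rook_alg, 'v, 's) module_scheme" and w :: 'v
  assumes cyclic: "cyclic_at n m T M w"
begin

sublocale left_module "CP n m" M
  using cyclic by (simp add: cyclic_at_def)

lemma T: "T \<in> colorings n m" and w: "w \<in> carrier M" and Tw: "munit T T \<odot>\<^bsub>M\<^esub> w = w" and w0: "w \<noteq> \<zero>\<^bsub>M\<^esub>"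
  and gen: "v \<in> carrier M \<Longrightarrow> \<exists>x \<in> carrier (CP n m). v = x \<odot>\<^bsub>M\<^esub> w"
  using cyclic by (auto simp: cyclic_at_def)

lemma mT: "munit T T \<in> carrier (CP n m)"
  by (rule munit_CP[OF T T])

lemma smult_right_T: "x \<in> carrier (CP n m) \<Longrightarrow> (x \<otimes>\<^bsub>CP n m\<^esub> munit T T) \<odot>\<^bsub>M\<^esub> w = x \<odot>\<^bsub>M\<^esub> w"
  by (simp add: smult_assoc mT w Tw)

text \<open>If \<open>x\<close> does not kill the idempotent, \<open>munit_left_inverse\<close>
  provides an element that recovers \<open>w\<close> from \<open>x w\<close>, and \<open>w\<close>
  is nonzero.\<close>

lemma smult_zero_iff:
  assumes x: "x \<in> carrier (CP n m)"
  shows "x \<odot>\<^bsub>M\<^esub> w = \<zero>\<^bsub>M\<^esub> \<longleftrightarrow> x \<otimes>\<^bsub>CP n m\<^esub> munit T T = 0"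
proof
  assume "x \<otimes>\<^bsub>CP n m\<^esub> munit T T = 0"
  then show "x \<odot>\<^bsub>M\<^esub> w = \<zero>\<^bsub>M\<^esub>" using smult_right_T[OF x] smult_l_null[OF w] by (simp add: CP_simps)
next
  assume xw: "x \<odot>\<^bsub>M\<^esub> w = \<zero>\<^bsub>M\<^esub>"
  show "x \<otimes>\<^bsub>CP n m\<^esub> munit T T = 0"
  proof (rule ccontr)
    assume "x \<otimes>\<^bsub>CP n m\<^esub> munit T T \<noteq> 0"
    then obtain y where y: "y \<in> carrier (CP n m)" "y \<otimes>\<^bsub>CP n m\<^esub> (x \<otimes>\<^bsub>CP n m\<^esub> munit T T) = munit T T"
      using munit_left_inverse[OF T] by blast
    have "w = (y \<otimes>\<^bsub>CP n m\<^esub> (x \<otimes>\<^bsub>CP n m\<^esub> munit T T)) \<odot>\<^bsub>M\<^esub> w" using y Tw by simp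
    also have "\<dots> = y \<odot>\<^bsub>M\<^esub> (x \<odot>\<^bsub>M\<^esub> w)"
      using x y(1) w by (simp add: smult_assoc CP_mult_closed smult_right_T mT Tw)
    finally show False using xw y w0 by (simp add: smult_r_null)
  qed
qed

text \<open>Evaluation at \<open>w\<close> is onto because \<open>w\<close> generates and is fixed
  by the idempotent; its kernel is trivial by \<open>smult_zero_iff\<close>.\<close>

lemma iso_W_map:
  "(\<lambda>x. x \<odot>\<^bsub>M\<^esub> w) \<in> iso (add_monoid (W_col n m T)) (add_monoid M)"
proof (rule isoI)
  show "(\<lambda>x. x \<odot>\<^bsub>M\<^esub> w) \<in> hom (add_monoid (W_col n m T)) (add_monoid M)"
    by (rule homI) (use w in \<open>auto simp: W_carrier[OF T] W_simps smult_closed smult_l_distr[simplified CP_simps]\<close>)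
  have "inj_on (\<lambda>x. x \<odot>\<^bsub>M\<^esub> w) (carrier (W_col n m T))"
  proof (rule inj_onI)
    fix x y assume "x \<in> carrier (W_col n m T)" "y \<in> carrier (W_col n m T)" and eq: "x \<odot>\<^bsub>M\<^esub> w = y \<odot>\<^bsub>M\<^esub> w"
    then have x: "x \<in> carrier (CP n m)" "x \<otimes>\<^bsub>CP n m\<^esub> munit T T = x"
      and y: "y \<in> carrier (CP n m)" "y \<otimes>\<^bsub>CP n m\<^esub> munit T T = y" by (auto simp: W_carrier[OF T])
    have "(x - y) \<odot>\<^bsub>M\<^esub> w \<oplus>\<^bsub>M\<^esub> y \<odot>\<^bsub>M\<^esub> w = \<zero>\<^bsub>M\<^esub> \<oplus>\<^bsub>M\<^esub> y \<odot>\<^bsub>M\<^esub> w"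
      using smult_l_distr[OF CP_diff[OF x(1) y(1)] y(1) w] eq x y w by (simp add: CP_simps smult_closed)
    then have "(x - y) \<odot>\<^bsub>M\<^esub> w = \<zero>\<^bsub>M\<^esub>"
      using x y w by (simp add: smult_closed CP_diff)
    then have "(x - y) \<otimes>\<^bsub>CP n m\<^esub> munit T T = 0" using smult_zero_iff[OF CP_diff[OF x(1) y(1)]] by simp
    moreover have "(x - y) \<otimes>\<^bsub>CP n m\<^esub> munit T T + y = x"
      using CP_distrib(1)[of n m "x - y" y "munit T T"] x y by simp
    ultimately show "x = y" by simp
  qed
  moreover have "(\<lambda>x. x \<odot>\<^bsub>M\<^esub> w) ` carrier (W_col n m T) = carrier M"
  proof (intro equalityI subsetI)
    fix v assume "v \<in> carrier M"
    then obtain x where x: "x \<in> carrier (CP n m)" "v = x \<odot>\<^bsub>M\<^esub> w" using gen by blast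
    have "x \<otimes>\<^bsub>CP n m\<^esub> munit T T \<in> carrier (W_col n m T)"
      unfolding W_carrier[OF T] using x mT
      by (simp add: CP_mult_closed CP_assoc munit_mult_same[OF T T T refl refl])
    then show "v \<in> (\<lambda>x. x \<odot>\<^bsub>M\<^esub> w) ` carrier (W_col n m T)"
      by (rule image_eqI[rotated]) (simp add: smult_right_T[OF x(1)] x(2))
  qed (auto simp: W_carrier[OF T] smult_closed w)
  ultimately show "bij_betw (\<lambda>x. x \<odot>\<^bsub>M\<^esub> w) (carrier (add_monoid (W_col n m T))) (carrier (add_monoid M))"
    by (simp add: bij_betw_def)
qed

lemma iso_W: "modules_isomorphic (CP n m) (W_col n m T) M"
  unfolding modules_isomorphic_def
  by (rule bexI[OF _ iso_W_map]) (simp add: W_simps W_carrier[OF T] smult_assoc w)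

lemma W_iso: "modules_isomorphic (CP n m) M (W_col n m T)"
  by (rule modules_isomorphic_sym[OF left_module_W[OF T] iso_W])

text \<open>Any nonzero vector \<open>x w\<close> generates \<open>w\<close> again, by the same left
  inverse as in \<open>smult_zero_iff\<close>.\<close>

lemma irreducible: "irreducible_module (CP n m) M"
  unfolding irreducible_module_def
proof (intro conjI allI impI)
  show "left_module (CP n m) M" ..
  show "carrier M \<noteq> {\<zero>\<^bsub>M\<^esub>}" using w w0 by auto
  fix H assume "submodule H (CP n m) M"
  then interpret H: submodule H "CP n m" M .
  show "H = {\<zero>\<^bsub>M\<^esub>} \<or> H = carrier M"
  proof (cases "H = {\<zero>\<^bsub>M\<^esub>}")
    case False
    moreover have "\<zero>\<^bsub>M\<^esub> \<in> H" using H.one_closed by simp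
    ultimately obtain v where v: "v \<in> H" "v \<noteq> \<zero>\<^bsub>M\<^esub>" by blast
    then have "v \<in> carrier M" using H.mem_carrier[OF v(1)] by simp
    then obtain x where x: "x \<in> carrier (CP n m)" "v = x \<odot>\<^bsub>M\<^esub> w" using gen by blast
    then have "x \<otimes>\<^bsub>CP n m\<^esub> munit T T \<noteq> 0" using smult_zero_iff v by simp
    then obtain y where y: "y \<in> carrier (CP n m)" "y \<otimes>\<^bsub>CP n m\<^esub> (x \<otimes>\<^bsub>CP n m\<^esub> munit T T) = munit T T"
      using munit_left_inverse[OF T] by blast
    have "w = (y \<otimes>\<^bsub>CP n m\<^esub> (x \<otimes>\<^bsub>CP n m\<^esub> munit T T)) \<odot>\<^bsub>M\<^esub> w" using y Tw by simp
    also have "\<dots> = y \<odot>\<^bsub>M\<^esub> v"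
      using x y(1) w by (simp add: smult_assoc CP_mult_closed smult_right_T mT Tw)
    finally have "w \<in> H" using H.smult_closed[OF y(1) v(1)] by simp
    then have "carrier M \<subseteq> H" using gen H.smult_closed by blast
    moreover have "H \<subseteq> carrier M" using H.subset by simp
    ultimately show ?thesis by blast
  qed simp
qed

lemma findim: "findim_module n m M"
  unfolding findim_module_def
proof (intro conjI)
  show "left_module (CP n m) M" ..
  define h where "h S = munit S T \<odot>\<^bsub>M\<^esub> w" for S
  have cl: "S \<in> colorings n m" "mset S = mset T" "munit S T \<in> carrier (CP n m)"
    if "S \<in> col_class n m T" for S
    using that T by (auto simp: col_class_def intro: munit_CP)
  \<comment> \<open>\<open>findim_module\<close> attaches coefficients to vectors, not to indices,
    so the vectors \<open>h S\<close> have to be distinct.\<close>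
  have inj: "inj_on h (col_class n m T)"
  proof (rule inj_onI, rule ccontr)
    fix S S' assume S: "S \<in> col_class n m T" "S' \<in> col_class n m T" and eq: "h S = h S'" and ne: "S \<noteq> S'"
    have m: "munit T S \<in> carrier (CP n m)" by (rule munit_CP[OF T cl(1)[OF S(1)]])
    have "w = munit T S \<odot>\<^bsub>M\<^esub> h S"
      unfolding h_def using m cl[OF S(1)] w T Tw by (simp add: smult_assoc[symmetric] munit_mult_same)
    also have "\<dots> = (munit T S \<otimes>\<^bsub>CP n m\<^esub> munit S' T) \<odot>\<^bsub>M\<^esub> w"
      unfolding eq unfolding h_def using m cl[OF S(2)] w by (simp add: smult_assoc)
    also have "\<dots> = \<zero>\<^bsub>M\<^esub>"
      using munit_mult[OF T cl(1)[OF S(1)] cl(2)[OF S(1), symmetric] cl(1)[OF S(2)] T cl(2)[OF S(2)]] ne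
        smult_l_null[OF w] by (simp add: CP_simps)
    finally show False using w0 by simp
  qed
  show "\<exists>S. finite S \<and> S \<subseteq> carrier M \<and> (\<forall>v \<in> carrier M. \<exists>a :: 'v \<Rightarrow> complex.
          v = finsum M (\<lambda>s. (\<lambda>d. a s * e_elt n m d) \<odot>\<^bsub>M\<^esub> s) S)"
  proof (intro exI[of _ "h ` col_class n m T"] conjI ballI)
    show "finite (h ` col_class n m T)" by simp
    show sub: "h ` col_class n m T \<subseteq> carrier M" unfolding h_def using cl w smult_closed by auto
    fix v assume "v \<in> carrier M"
    then obtain x where x: "x \<in> carrier (CP n m)" "v = x \<odot>\<^bsub>M\<^esub> w" using gen by blast
    define a where "a s = coef n m x (inv_into (col_class n m T) h s) T" for s
    have "v = (x \<otimes>\<^bsub>CP n m\<^esub> munit T T) \<odot>\<^bsub>M\<^esub> w" using x by (simp add: smult_right_T)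
    also have "\<dots> = finsum M (\<lambda>S. scale (coef n m x S T) (munit S T) \<odot>\<^bsub>M\<^esub> w) (col_class n m T)"
      unfolding mult_munit_expand[OF T x(1)]
      by (rule smult_finsum_left) (use cl w in \<open>auto intro: scale_CP\<close>)
    also have "\<dots> = finsum M (\<lambda>S. scale (a (h S)) (e_elt n m) \<odot>\<^bsub>M\<^esub> h S) (col_class n m T)"
    proof (rule finsum_cong'[OF refl])
      show "(\<lambda>S. scale (a (h S)) (e_elt n m) \<odot>\<^bsub>M\<^esub> h S) \<in> col_class n m T \<rightarrow> carrier M"
        using sub by (auto intro!: smult_closed scale_CP e_elt_CP)
      fix S assume S: "S \<in> col_class n m T"
      have "scale c (e_elt n m) \<odot>\<^bsub>M\<^esub> h S = scale c (munit S T) \<odot>\<^bsub>M\<^esub> w" for c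
        unfolding h_def using cl[OF S] w
        by (simp add: smult_assoc[symmetric] scale_CP e_elt_CP scale_mult CP_one)
      then show "scale (coef n m x S T) (munit S T) \<odot>\<^bsub>M\<^esub> w = scale (a (h S)) (e_elt n m) \<odot>\<^bsub>M\<^esub> h S"
        using S inj by (simp add: a_def)
    qed
    also have "\<dots> = finsum M (\<lambda>s. scale (a s) (e_elt n m) \<odot>\<^bsub>M\<^esub> s) (h ` col_class n m T)"
      by (rule add.finprod_reindex[symmetric, OF _ inj]) (use sub
        in \<open>auto intro!: smult_closed scale_CP e_elt_CP\<close>)
    finally show "\<exists>a :: 'v \<Rightarrow> complex. v = finsum M (\<lambda>s. (\<lambda>d. a s *
      e_elt n m d) \<odot>\<^bsub>M\<^esub> s) (h ` col_class n m T)"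
      unfolding scale_def by blast
  qed
qed

text \<open>\<open>munit T T'\<close> carries the new generator back to \<open>w\<close>, so nothing
  is lost by passing to another colouring in the same block.\<close>

lemma change_T:
  assumes T': "T' \<in> colorings n m" "mset T' = mset T"
  shows "cyclic_at n m T' M (munit T' T \<odot>\<^bsub>M\<^esub> w)"
proof -
  have u: "munit T' T \<in> carrier (CP n m)" "munit T T' \<in> carrier (CP n m)"
    "munit T' T' \<in> carrier (CP n m)"
    using T T' by (auto intro: munit_CP)
  have ret: "munit T T' \<odot>\<^bsub>M\<^esub> (munit T' T \<odot>\<^bsub>M\<^esub> w) = w"
    using u w T T' Tw by (simp add: smult_assoc[symmetric] munit_mult_same)
  have "munit T' T' \<odot>\<^bsub>M\<^esub> (munit T' T \<odot>\<^bsub>M\<^esub> w) = munit T' T \<odot>\<^bsub>M\<^esub> w"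
    using u w T T' by (simp add: smult_assoc[symmetric] munit_mult_same)
  moreover have "munit T' T \<odot>\<^bsub>M\<^esub> w \<noteq> \<zero>\<^bsub>M\<^esub>"
    using ret w0 u by (auto simp: smult_r_null)
  moreover have "\<exists>x\<in>carrier (CP n m). v = x \<odot>\<^bsub>M\<^esub> (munit T' T \<odot>\<^bsub>M\<^esub> w)" if v: "v \<in> carrier M" for v
  proof -
    obtain x where x: "x \<in> carrier (CP n m)" "v = x \<odot>\<^bsub>M\<^esub> w" using gen[OF v] by blast
    then have "v = (x \<otimes>\<^bsub>CP n m\<^esub> munit T T') \<odot>\<^bsub>M\<^esub> (munit T' T \<odot>\<^bsub>M\<^esub> w)"
      using ret u w by (simp add: smult_assoc smult_closed)
    then show ?thesis using CP_mult_closed by blast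
  qed
  ultimately show ?thesis
    unfolding cyclic_at_def using left_module_axioms T'(1) u w smult_closed by blast
qed

text \<open>The idempotent at \<open>T'\<close> belongs to a different matrix block, hence kills the
  module; this is what separates the isomorphism classes.\<close>

lemma other_T:
  assumes T': "T' \<in> colorings n m" "mset T' \<noteq> mset T" and v: "v \<in> carrier M"
  shows "munit T' T' \<odot>\<^bsub>M\<^esub> v = \<zero>\<^bsub>M\<^esub>"
proof -
  obtain x where x: "x \<in> carrier (CP n m)" "v = x \<odot>\<^bsub>M\<^esub> w" using gen[OF v] by blast
  have u: "munit T' T' \<in> carrier (CP n m)" by (rule munit_CP[OF T'(1) T'(1)])
  have "(munit T' T' \<otimes>\<^bsub>CP n m\<^esub> x) \<otimes>\<^bsub>CP n m\<^esub> munit T T = 0"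
  proof (rule coef_eqI[OF CP_mult_closed CP_zero])
    fix A B assume AB: "A \<in> colorings n m" "B \<in> colorings n m" "mset A = mset B"
    show "coef n m ((munit T' T' \<otimes>\<^bsub>CP n m\<^esub> x) \<otimes>\<^bsub>CP n m\<^esub> munit T T) A B = coef n m 0 A B"
    proof (cases "T = B")
      case True
      then have "T' \<noteq> A" using AB T' by auto
      then show ?thesis
        unfolding coef_munit_mult_right[OF T T refl AB]
        using True coef_munit_mult_left[OF T'(1) T'(1) refl AB] by (simp add: coef_zero)
    next
      case False
      then show ?thesis unfolding coef_munit_mult_right[OF T T refl AB] by (simp add: coef_zero)
    qed
  qed
  then have "(munit T' T' \<otimes>\<^bsub>CP n m\<^esub> x) \<odot>\<^bsub>M\<^esub> w = \<zero>\<^bsub>M\<^esub>"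
    using smult_zero_iff[OF CP_mult_closed] by simp
  then show ?thesis unfolding x(2) smult_assoc[OF u x(1) w] .
qed

end

lemma cyclic_at_iso:
  assumes M: "cyclic_at n m T M w" and iso: "modules_isomorphic (CP n m) M N" and N: "left_module (CP n m) N"
  shows "\<exists>w'. cyclic_at n m T N w'"
proof -
  interpret M: cyclic n m T M w by (rule cyclic.intro[OF M])
  interpret N: left_module "CP n m" N by (rule N)
  obtain f where f: "f \<in> iso (add_monoid M) (add_monoid N)"
    and lin: "\<And>a v. \<lbrakk>a \<in> carrier (CP n m); v \<in> carrier M\<rbrakk> \<Longrightarrow> f (a \<odot>\<^bsub>M\<^esub> v) = a \<odot>\<^bsub>N\<^esub> f v"
    using iso by (auto simp: modules_isomorphic_def)
  have bij: "bij_betw f (carrier M) (carrier N)" using f by (simp add: iso_def)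
  have fw: "f w \<in> carrier N" using bij M.w by (auto simp: bij_betw_def)
  have f0: "f \<zero>\<^bsub>M\<^esub> = \<zero>\<^bsub>N\<^esub>"
    using lin[OF CP_zero M.w] M.smult_l_null[OF M.w] N.smult_l_null[OF fw] by (simp add: CP_simps)
  have "f w \<noteq> \<zero>\<^bsub>N\<^esub>"
    using bij M.w M.w0 M.M.zero_closed f0 by (metis bij_betw_def inj_onD)
  moreover have "munit T T \<odot>\<^bsub>N\<^esub> f w = f w"
    using lin[OF M.mT M.w] M.Tw by simp
  moreover have "\<exists>x\<in>carrier (CP n m). v = x \<odot>\<^bsub>N\<^esub> f w" if v: "v \<in> carrier N" for v
  proof -
    obtain u where "u \<in> carrier M" "v = f u" using bij v by (metis bij_betw_imp_surj_on imageE)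
    then obtain x where "x \<in> carrier (CP n m)" "v = f (x \<odot>\<^bsub>M\<^esub> w)" using M.gen by blast
    then show ?thesis using lin M.w by auto
  qed
  ultimately have "cyclic_at n m T N (f w)"
    unfolding cyclic_at_def using N M.T fw by blast
  then show ?thesis by blast
qed

text \<open>Some idempotent of the decomposition of the identity does not kill a given nonzero
  vector \<open>v\<close>. The image of \<open>v\<close> generates a nonzero submodule, which is
  everything.\<close>

lemma irreducible_cyclic:
  assumes "irreducible_module (CP n m) M"
  shows "\<exists>T w. cyclic_at n m T M w"
proof -
  interpret left_module "CP n m" M using assms by (simp add: irreducible_module_def)
  have nz: "carrier M \<noteq> {\<zero>\<^bsub>M\<^esub>}" and sub: "\<And>H. submodule H (CP n m) M \<Longrightarrow> H = {\<zero>\<^bsub>M\<^esub>} \<or> H = carrier M"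
    using assms by (auto simp: irreducible_module_def)
  obtain v where v: "v \<in> carrier M" "v \<noteq> \<zero>\<^bsub>M\<^esub>" using nz M.zero_closed by blast
  have "\<exists>T \<in> colorings n m. munit T T \<odot>\<^bsub>M\<^esub> v \<noteq> \<zero>\<^bsub>M\<^esub>"
  proof (rule ccontr)
    assume "\<not> (\<exists>T \<in> colorings n m. munit T T \<odot>\<^bsub>M\<^esub> v \<noteq> \<zero>\<^bsub>M\<^esub>)"
    then have 0: "munit T T \<odot>\<^bsub>M\<^esub> v = \<zero>\<^bsub>M\<^esub>" if "T \<in> colorings n m" for T using that by blast
    have "v = e_elt n m \<odot>\<^bsub>M\<^esub> v" using smult_one[OF v(1)] by (simp add: CP_simps)
    also have "\<dots> = finsum M (\<lambda>T. munit T T \<odot>\<^bsub>M\<^esub> v) (colorings n m)"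
      unfolding e_elt_sum by (rule smult_finsum_left) (auto intro: munit_CP v)
    also have "\<dots> = finsum M (\<lambda>T. \<zero>\<^bsub>M\<^esub>) (colorings n m)"
      by (rule finsum_cong') (simp_all add: 0)
    finally show False using v by simp
  qed
  then obtain T where T: "T \<in> colorings n m" "munit T T \<odot>\<^bsub>M\<^esub> v \<noteq> \<zero>\<^bsub>M\<^esub>" by blast
  define w where "w = munit T T \<odot>\<^bsub>M\<^esub> v"
  have mT: "munit T T \<in> carrier (CP n m)" by (rule munit_CP[OF T(1) T(1)])
  have w: "w \<in> carrier M" unfolding w_def by (rule smult_closed[OF mT v(1)])
  have Tw: "munit T T \<odot>\<^bsub>M\<^esub> w = w"
    unfolding w_def using mT v T by (simp add: smult_assoc[symmetric] munit_mult_same)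
  define H where "H = (\<lambda>x. x \<odot>\<^bsub>M\<^esub> w) ` carrier (CP n m)"
  have "submodule H (CP n m) M"
  proof (intro submodule.intro subgroup.intro submodule_axioms.intro)
    show "H \<subseteq> carrier (add_monoid M)" by (auto simp: H_def smult_closed w)
    show "x \<otimes>\<^bsub>add_monoid M\<^esub> y \<in> H" if "x \<in> H" "y \<in> H" for x y
      using that smult_l_distr[OF _ _ w] unfolding H_def
        by (auto simp: image_iff) (metis CP.add.m_closed)
    show "\<one>\<^bsub>add_monoid M\<^esub> \<in> H"
      unfolding H_def using smult_l_null[OF w] by (auto simp: image_iff intro!: bexI[of _ "\<zero>\<^bsub>CP n m\<^esub>"])
    show "inv\<^bsub>add_monoid M\<^esub> x \<in> H" if "x \<in> H" for x
    proof -
      obtain a where a: "a \<in> carrier (CP n m)" "x = a \<odot>\<^bsub>M\<^esub> w" using \<open>x \<in> H\<close> by (auto simp: H_def)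
      have "inv\<^bsub>add_monoid M\<^esub> x = (\<ominus>\<^bsub>CP n m\<^esub> a) \<odot>\<^bsub>M\<^esub> w"
        using smult_l_minus[OF a(1) w] a(2) by (simp add: a_inv_def)
      then show ?thesis using a by (auto simp: H_def)
    qed
    show "a \<odot>\<^bsub>M\<^esub> x \<in> H" if "a \<in> carrier (CP n m)" "x \<in> H" for a x
      using that unfolding H_def by (auto simp: smult_assoc[symmetric] w CP_mult_closed)
  qed
  moreover have "w \<in> H" unfolding H_def using Tw mT by (metis imageI)
  ultimately have "H = carrier M" using sub T(2) by (auto simp: w_def)
  then have "cyclic_at n m T M w"
    unfolding cyclic_at_def using left_module_axioms T w Tw by (auto simp: w_def H_def)
  then show ?thesis by blast
qed

section \<open>Induction and restriction of simple modules\<close>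

lemma coef_eqI_Suc:
  assumes "x \<in> carrier (CP n (Suc m))" "y \<in> carrier (CP n (Suc m))"
    "\<And>S T a b. \<lbrakk>S \<in> colorings n m; T \<in> colorings n m; a \<le> n; b \<le> n; mset (S @ [a]) = mset (T @ [b])\<rbrakk> \<Longrightarrow>
       coef n (Suc m) x (S @ [a]) (T @ [b]) = coef n (Suc m) y (S @ [a]) (T @ [b])"
  shows "x = y"
proof (rule coef_eqI[OF assms(1,2)])
  fix A B assume AB: "A \<in> colorings n (Suc m)" "B \<in> colorings n (Suc m)" "mset A = mset B"
  obtain S a where S: "A = S @ [a]" "S \<in> colorings n m" "a \<le> n" by (rule colorings_Suc[OF AB(1)])
  obtain T b where T: "B = T @ [b]" "T \<in> colorings n m" "b \<le> n" by (rule colorings_Suc[OF AB(2)])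
  show "coef n (Suc m) x A B = coef n (Suc m) y A B"
    unfolding S(1) T(1) by (rule assms(3)[OF S(2) T(2) S(3) T(3)]) (use AB(3) S(1) T(1) in simp)
qed

lemma colorings_snoc: "S @ [a] \<in> colorings n (Suc m) \<longleftrightarrow> S \<in> colorings n m \<and> a \<le> n"
  by (auto simp: colorings_def)

lemma psi_add:
  assumes "i \<le> n"
  shows "psi n i (Suc m) (x + y) = psi n i (Suc m) x + psi n i (Suc m) y"
  by (rule coef_eqI_Suc[OF psi_CP CP_add[OF psi_CP psi_CP]])
    (use assms in \<open>simp add: coef_psi coef_add distrib_left\<close>)

lemma psi_munit:
  assumes "i \<le> n" "S \<in> colorings n m" "T \<in> colorings n m" "mset S = mset T"
  shows "psi n i (Suc m) (munit S T) = munit (S @ [i]) (T @ [i])"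
proof (rule coef_eqI_Suc[OF psi_CP munit_CP])
  show *: "S @ [i] \<in> colorings n (Suc m)" "T @ [i] \<in> colorings n (Suc m)"
    using assms by (simp_all add: colorings_snoc)
  fix A B a b assume A: "A \<in> colorings n m" "B \<in> colorings n m" "a \<le> n" "b \<le> n"
    "mset (A @ [a]) = mset (B @ [b])"
  have "coef n (Suc m) (psi n i (Suc m) (munit S T)) (A @ [a]) (B @ [b]) = of_bool (a = i \<and> b = i) *
    coef n m (munit S T) A B"
    by (rule coef_psi[OF A assms(1)])
  also have "\<dots> = of_bool (S @ [i] = A @ [a] \<and> T @ [i] = B @ [b])"
  proof (cases "a = i \<and> b = i")
    case True
    then have "mset A = mset B" using A by simp
    then show ?thesis using True by (simp add: coef_munit[OF assms(2-4)])
  qed auto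
  also have "\<dots> = coef n (Suc m) (munit (S @ [i]) (T @ [i])) (A @ [a]) (B @ [b])"
    by (rule coef_munit[OF * _ A(5), symmetric]) (simp add: assms)
  finally show "coef n (Suc m) (psi n i (Suc m) (munit S T)) (A @ [a]) (B @ [b]) =
    coef n (Suc m) (munit (S @ [i]) (T @ [i])) (A @ [a]) (B @ [b])" .
qed

text \<open>In the matrix product over colourings of size \<open>Suc m\<close>, only middle
  colourings that end in \<open>i\<close> contribute, and dropping this last colour leaves the
  product in size \<open>m\<close>.\<close>

lemma psi_mult:
  assumes i: "i \<le> n"
  shows "psi n i (Suc m) (x \<otimes>\<^bsub>CP n m\<^esub> y) = psi n i (Suc m) x \<otimes>\<^bsub>CP n (Suc m)\<^esub> psi n i (Suc m) y"
proof (rule coef_eqI_Suc[OF psi_CP CP_mult_closed])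
  fix S T a b assume A: "S \<in> colorings n m" "T \<in> colorings n m" "a \<le> n" "b \<le> n"
    "mset (S @ [a]) = mset (T @ [b])"
  let ?C = "col_class n (Suc m) (S @ [a])"
  have Sa: "S @ [a] \<in> colorings n (Suc m)" "T @ [b] \<in> colorings n (Suc m)"
    using A by (simp_all add: colorings_snoc)
  have summand: "coef n (Suc m) (psi n i (Suc m) x) (S @ [a]) (U @ [c]) *
    coef n (Suc m) (psi n i (Suc m) y) (U @ [c]) (T @ [b]) =
     of_bool (a = i \<and> b = i \<and> c = i) * (coef n m x S U * coef n m y U T)" if U: "U @ [c] \<in> ?C" for U c
  proof -
    have U': "U \<in> colorings n m" "c \<le> n" "mset (S @ [a]) = mset (U @ [c])"
      "mset (U @ [c]) = mset (T @ [b])"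
      using U A(5) by (auto simp: col_class_def colorings_snoc)
    show ?thesis
      unfolding coef_psi[OF A(1) U'(1) A(3) U'(2,3) i] coef_psi[OF U'(1) A(2) U'(2) A(4) U'(4) i] by auto
  qed
  have "coef n (Suc m) (psi n i (Suc m) x \<otimes>\<^bsub>CP n (Suc m)\<^esub> psi n i (Suc m) y) (S @ [a]) (T @ [b]) =
    (\<Sum>V\<in>?C. coef n (Suc m) (psi n i (Suc m) x) (S @ [a]) V *
      coef n (Suc m) (psi n i (Suc m) y) V (T @ [b]))"
    by (rule coef_mult[OF Sa A(5)])
  also have "\<dots> = of_bool (a = i \<and> b = i) * coef n m (x \<otimes>\<^bsub>CP n m\<^esub> y) S T"
  proof (cases "a = i \<and> b = i")
    case False
    have "coef n (Suc m) (psi n i (Suc m) x) (S @ [a]) V *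
      coef n (Suc m) (psi n i (Suc m) y) V (T @ [b]) = 0"
      if V: "V \<in> ?C" for V
    proof -
      have "V \<in> colorings n (Suc m)" using V by (simp add: col_class_def)
      then obtain U c where Uc: "V = U @ [c]" by (rule colorings_Suc)
      then show ?thesis using summand[of U c] V False by auto
    qed
    then have "(\<Sum>V\<in>?C. coef n (Suc m) (psi n i (Suc m) x) (S @ [a]) V *
        coef n (Suc m) (psi n i (Suc m) y) V (T @ [b])) = 0"
      by (rule sum.neutral[OF ballI])
    then show ?thesis using False by simp
  next
    case True
    then have ST: "mset S = mset T" using A by simp
    have inj: "inj_on (\<lambda>U. U @ [i]) (col_class n m S)" by (rule inj_onI) simp
    have sub: "(\<lambda>U. U @ [i]) ` col_class n m S \<subseteq> ?C"
      using True i by (auto simp: col_class_def colorings_snoc)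
    have "(\<Sum>V\<in>?C. coef n (Suc m) (psi n i (Suc m) x) (S @ [a]) V *
      coef n (Suc m) (psi n i (Suc m) y) V (T @ [b])) =
      (\<Sum>V\<in>(\<lambda>U. U @ [i]) ` col_class n m S. coef n (Suc m) (psi n i (Suc m) x) (S @ [a]) V *
        coef n (Suc m) (psi n i (Suc m) y) V (T @ [b]))"
    proof (rule sum.mono_neutral_right[OF finite_col_class sub], rule ballI)
      fix V assume V: "V \<in> ?C - (\<lambda>U. U @ [i]) ` col_class n m S"
      then have "V \<in> colorings n (Suc m)" by (simp add: col_class_def)
      then obtain U c where Uc: "V = U @ [c]" "U \<in> colorings n m" by (rule colorings_Suc)
      have "c \<noteq> i"
      proof
        assume "c = i"
        then have "U \<in> col_class n m S" using V Uc True by (auto simp: col_class_def)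
        then show False using V Uc \<open>c = i\<close> by auto
      qed
      then show "coef n (Suc m) (psi n i (Suc m) x) (S @ [a]) V *
        coef n (Suc m) (psi n i (Suc m) y) V (T @ [b]) = 0"
        using summand[of U c] V Uc by simp
    qed
    also have "\<dots> = (\<Sum>U\<in>col_class n m S. coef n m x S U * coef n m y U T)"
      unfolding sum.reindex[OF inj] o_def
    proof (rule sum.cong[OF refl])
      fix U assume "U \<in> col_class n m S"
      then have "U @ [i] \<in> ?C" using sub by blast
      then show "coef n (Suc m) (psi n i (Suc m) x) (S @ [a]) (U @ [i]) *
        coef n (Suc m) (psi n i (Suc m) y) (U @ [i]) (T @ [b]) = coef n m x S U * coef n m y U T"
        using summand True by simp
    qed
    also have "\<dots> = coef n m (x \<otimes>\<^bsub>CP n m\<^esub> y) S T" by (rule coef_mult[OF A(1,2) ST, symmetric])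
    finally show ?thesis using True by simp
  qed
  also have "\<dots> = coef n (Suc m) (psi n i (Suc m) (x \<otimes>\<^bsub>CP n m\<^esub> y)) (S @ [a]) (T @ [b])"
    by (rule coef_psi[OF A i, symmetric])
  finally show "coef n (Suc m) (psi n i (Suc m) (x \<otimes>\<^bsub>CP n m\<^esub> y)) (S @ [a]) (T @ [b]) =
    coef n (Suc m) (psi n i (Suc m) x \<otimes>\<^bsub>CP n (Suc m)\<^esub> psi n i (Suc m) y) (S @ [a]) (T @ [b])" by simp
qed

text \<open>The image of the identity under \<open>psi\<close> is not the identity but the
  projection onto the rows whose colouring ends in \<open>i\<close>.\<close>

lemma coef_psi_e_mult:
  assumes i: "i \<le> n" and S: "S \<in> colorings n m" "a \<le> n" and B: "B \<in> colorings n (Suc m)"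
    "mset (S @ [a]) = mset B"
  shows "coef n (Suc m) (psi n i (Suc m) (e_elt n m) \<otimes>\<^bsub>CP n (Suc m)\<^esub> y) (S @ [a]) B =
    of_bool (a = i) * coef n (Suc m) y (S @ [a]) B"
proof -
  have Sa: "S @ [a] \<in> colorings n (Suc m)" using S by (simp add: colorings_snoc)
  have "coef n (Suc m) (psi n i (Suc m) (e_elt n m) \<otimes>\<^bsub>CP n (Suc m)\<^esub> y) (S @ [a]) B =
    (\<Sum>V\<in>col_class n (Suc m) (S @ [a]). of_bool (S @ [a] = V) * (of_bool (a = i) * coef n (Suc m) y V B))"
    unfolding coef_mult[OF Sa B]
  proof (rule sum.cong[OF refl])
    fix V assume V: "V \<in> col_class n (Suc m) (S @ [a])"
    then have "V \<in> colorings n (Suc m)" by (simp add: col_class_def)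
    then obtain U c where U: "V = U @ [c]" "U \<in> colorings n m" "c \<le> n" by (rule colorings_Suc)
    have mU: "mset (S @ [a]) = mset (U @ [c])" using V U by (simp add: col_class_def)
    have "coef n (Suc m) (psi n i (Suc m) (e_elt n m)) (S @ [a]) V = of_bool (a = i \<and> c = i) *
      coef n m (e_elt n m) S U"
      unfolding U(1) by (rule coef_psi[OF S(1) U(2) S(2) U(3) mU i])
    also have "\<dots> = of_bool (S @ [a] = V) * of_bool (a = i)"
    proof (cases "a = i \<and> c = i")
      case True
      then have "mset S = mset U" using mU by simp
      then show ?thesis using True U by (simp add: coef_e[OF S(1) U(2)])
    qed (use U in auto)
    finally show "coef n (Suc m) (psi n i (Suc m) (e_elt n m)) (S @ [a]) V * coef n (Suc m) y V B =
      of_bool (S @ [a] = V) * (of_bool (a = i) * coef n (Suc m) y V B)" by simp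
  qed
  also have "\<dots> = of_bool (S @ [a] \<in> col_class n (Suc m) (S @ [a])) *
    (of_bool (a = i) * coef n (Suc m) y (S @ [a]) B)"
    by (simp only: sum_of_bool_delta finite_col_class)
  finally show ?thesis using col_class_self[OF Sa] by simp
qed

text \<open>The generator is the tensor of 1 and \<open>w\<close>. \<open>tens_cyclic\<close> shows
  that it generates, and \<open>tens_nonzero\<close> that it is not 0.\<close>

lemma cyclic_Ind:
  fixes M :: "(rook_alg, 'v) module"
  assumes M: "cyclic_at n m T M w" and j: "j \<le> n"
  shows "\<exists>w'. cyclic_at n (Suc m) (T @ [j]) (Ind n j (Suc m) M) w'"
proof -
  interpret M: cyclic n m T M w by (rule cyclic.intro[OF M])
  interpret X: scalar_extension "CP n m" M "CP n (Suc m)" "psi n j (Suc m)"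
    by (intro scalar_extension.intro scalar_extension_axioms.intro M.left_module_axioms ring_CP psi_CP)
  have E: "Ind n j (Suc m) M = X.E" by (simp add: Ind_def X.E_def)
  let ?t = "X.tens \<one>\<^bsub>CP n (Suc m)\<^esub> w"
  have Tj: "T @ [j] \<in> colorings n (Suc m)" using M.T j by (simp add: colorings_snoc)
  have u: "munit (T @ [j]) (T @ [j]) = psi n j (Suc m) (munit T T)"
    by (rule psi_munit[OF j M.T M.T refl, symmetric])
  have t: "?t \<in> carrier X.E" by (simp add: X.tens_closed M.w)
  \<comment> \<open>The idempotent is the image under \<open>psi\<close> of the one fixing
    \<open>w\<close>, so it can be moved across the tensor sign.\<close>
  have "munit (T @ [j]) (T @ [j]) \<odot>\<^bsub>X.E\<^esub> ?t =
    X.tens (munit (T @ [j]) (T @ [j]) \<otimes>\<^bsub>CP n (Suc m)\<^esub> \<one>\<^bsub>CP n (Suc m)\<^esub>) w"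
    using X.smult_tens[OF munit_CP[OF Tj Tj] _ M.w] by simp
  also have "\<dots> = X.tens (\<one>\<^bsub>CP n (Suc m)\<^esub> \<otimes>\<^bsub>CP n (Suc m)\<^esub> psi n j (Suc m) (munit T T)) w"
    using munit_CP[OF Tj Tj] unfolding u by simp
  also have "\<dots> = ?t"
    using X.tens_balanced[OF _ M.mT M.w] M.Tw by simp
  finally have Tt: "munit (T @ [j]) (T @ [j]) \<odot>\<^bsub>X.E\<^esub> ?t = ?t" .
  \<comment> \<open>Identifies \<open>M\<close> with the left ideal \<open>W_col n m T\<close>
    inside the algebra, where a vector can be fed into \<open>psi\<close>.\<close>
  define ph where "ph = inv_into (carrier (W_col n m T)) (\<lambda>x. x \<odot>\<^bsub>M\<^esub> w)"
  have bij: "bij_betw (\<lambda>x. x \<odot>\<^bsub>M\<^esub> w) (carrier (W_col n m T)) (carrier M)"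
    using M.iso_W_map by (simp add: iso_def)
  have ph: "ph (x \<odot>\<^bsub>M\<^esub> w) = x" if "x \<in> carrier (W_col n m T)" for x
    unfolding ph_def by (rule bij_betw_inv_into_left[OF bij that])
  have ex: "\<exists>x \<in> carrier (W_col n m T). v = x \<odot>\<^bsub>M\<^esub> w" if "v \<in> carrier M" for v
    using bij that by (metis bij_betw_imp_surj_on imageE)
  interpret WT: left_module "CP n m" "W_col n m T" by (rule left_module_W[OF M.T])
  have WCP: "x \<in> carrier (W_col n m T) \<Longrightarrow> x \<in> carrier (CP n m)" for x
    by (simp add: W_carrier[OF M.T])
  have ph_add: "ph (v \<oplus>\<^bsub>M\<^esub> v') = ph v + ph v'" if "v \<in> carrier M" "v' \<in> carrier M" for v v'
  proof -
    obtain x y where x: "x \<in> carrier (W_col n m T)"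
      "v = x \<odot>\<^bsub>M\<^esub> w" and y: "y \<in> carrier (W_col n m T)" "v' = y \<odot>\<^bsub>M\<^esub> w"
      using ex \<open>v \<in> carrier M\<close> \<open>v' \<in> carrier M\<close> by metis
    have "v \<oplus>\<^bsub>M\<^esub> v' = (x + y) \<odot>\<^bsub>M\<^esub> w"
      using M.smult_l_distr[OF WCP[OF x(1)] WCP[OF y(1)] M.w] x y by (simp add: CP_simps)
    moreover have "x + y \<in> carrier (W_col n m T)" using WT.M.add.m_closed[OF x(1) y(1)]
      by (simp add: W_simps)
    ultimately show ?thesis using ph x y by simp
  qed
  have ph_smult: "ph (r \<odot>\<^bsub>M\<^esub> v) = r \<otimes>\<^bsub>CP n m\<^esub> ph v" if r: "r \<in> carrier (CP n m)" and v: "v \<in> carrier M" for r v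
  proof -
    obtain x where x: "x \<in> carrier (W_col n m T)" "v = x \<odot>\<^bsub>M\<^esub> w" using ex v by blast
    have "r \<odot>\<^bsub>M\<^esub> v = (r \<otimes>\<^bsub>CP n m\<^esub> x) \<odot>\<^bsub>M\<^esub> w"
      using M.smult_assoc[OF r WCP[OF x(1)] M.w] x by simp
    moreover have "r \<otimes>\<^bsub>CP n m\<^esub> x \<in> carrier (W_col n m T)" using WT.smult_closed[OF r x(1)]
      by (simp add: W_simps)
    ultimately show ?thesis using ph x by simp
  qed
  \<comment> \<open>Balanced because \<open>ph\<close> is a module map and \<open>psi\<close> is
    multiplicative. The diagonal entry at \<open>T @ [j]\<close> is chosen since \<open>B\<close> at
    1 and \<open>w\<close> is the entry of a matrix unit there.\<close>
  define B where "B a v = coef n (Suc m) (a \<otimes>\<^bsub>CP n (Suc m)\<^esub> psi n j (Suc m) (ph v)) (T @ [j]) (T @ [j])" for a v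
  have phw: "ph w = munit T T"
    using ph[of "munit T T"] cyclic_at_W[OF M.T] M.Tw by (simp add: cyclic_at_def)
  have "?t \<noteq> \<zero>\<^bsub>X.E\<^esub>"
  proof (rule X.tens_nonzero[where B = B])
    show "B (a \<oplus>\<^bsub>CP n (Suc m)\<^esub> b) v = B a v + B b v" for a b v
      by (simp add: B_def CP_simps CP_distrib coef_add)
    show "B a (v \<oplus>\<^bsub>M\<^esub> v') = B a v + B a v'" if "v \<in> carrier M" "v' \<in> carrier M" for a v v'
      using ph_add[OF that] by (simp add: B_def CP_distrib coef_add psi_add[OF j])
    show "B (a \<otimes>\<^bsub>CP n (Suc m)\<^esub> psi n j (Suc m) r) v = B a (r \<odot>\<^bsub>M\<^esub> v)"
      if "a \<in> carrier (CP n (Suc m))" "r \<in> carrier (CP n m)" "v \<in> carrier M" for a r v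
      using ph_smult[OF that(2,3)] that by (simp add: B_def psi_mult[OF j] CP_assoc psi_CP)
    have "B \<one>\<^bsub>CP n (Suc m)\<^esub> w = coef n (Suc m) (munit (T @ [j]) (T @ [j])) (T @ [j]) (T @ [j])"
      unfolding B_def phw u by (simp add: psi_CP)
    then show "B \<one>\<^bsub>CP n (Suc m)\<^esub> w \<noteq> 0"
      using coef_munit[OF Tj Tj refl refl] by simp
  qed (use M.w in simp_all)
  moreover have "\<exists>x\<in>carrier (CP n (Suc m)). v = x \<odot>\<^bsub>X.E\<^esub> ?t" if "v \<in> carrier X.E" for v
    by (rule X.tens_cyclic[OF M.w M.gen that])
  ultimately have "cyclic_at n (Suc m) (T @ [j]) X.E ?t"
    unfolding cyclic_at_def using X.left_module_E Tj t Tt by blast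
  then show ?thesis unfolding E by blast
qed

section \<open>Restriction along the non-unital embeddings\<close>

lemma Res_simps:
  "\<zero>\<^bsub>Res n i m M\<^esub> = \<zero>\<^bsub>M\<^esub>" "x \<oplus>\<^bsub>Res n i m M\<^esub> y = x \<oplus>\<^bsub>M\<^esub> y" "a \<odot>\<^bsub>Res n i m M\<^esub> x = psi n i m a \<odot>\<^bsub>M\<^esub> x"
  by (simp_all add: Res_def)

lemma Res_carrier:
  assumes M: "left_module (CP n (Suc m)) M" and i: "i \<le> n"
  shows "carrier (Res n i (Suc m) M) = {v \<in> carrier M. psi n i (Suc m) (e_elt n m) \<odot>\<^bsub>M\<^esub> v = v}"
proof -
  interpret M: left_module "CP n (Suc m)" M by (rule M)
  let ?p = "psi n i (Suc m) (e_elt n m)"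
  have pp: "?p \<otimes>\<^bsub>CP n (Suc m)\<^esub> ?p = ?p"
    unfolding psi_mult[OF i, symmetric] by (simp add: CP_one e_elt_CP)
  have "?p \<odot>\<^bsub>M\<^esub> v \<in> carrier M \<and> ?p \<odot>\<^bsub>M\<^esub> (?p \<odot>\<^bsub>M\<^esub> v) = ?p \<odot>\<^bsub>M\<^esub> v" if "v \<in> carrier M" for v
    using that M.smult_assoc[OF psi_CP psi_CP that, of i "e_elt n m" i "e_elt n m"] pp
    by (simp add: M.smult_closed psi_CP)
  then show ?thesis by (auto simp: Res_def image_iff) metis
qed

lemma left_module_Res:
  assumes M: "left_module (CP n (Suc m)) M" and i: "i \<le> n"
  shows "left_module (CP n m) (Res n i (Suc m) M)"
proof -
  interpret M: left_module "CP n (Suc m)" M by (rule M)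
  let ?p = "psi n i (Suc m) (e_elt n m)" and ?R = "Res n i (Suc m) M"
  note C = Res_carrier[OF M i]
  have px: "?p \<otimes>\<^bsub>CP n (Suc m)\<^esub> psi n i (Suc m) x = psi n i (Suc m) x" if "x \<in> carrier (CP n m)" for x
    unfolding psi_mult[OF i, symmetric] using that by (simp add: CP_one)
  have ab: "abelian_group ?R"
  proof (rule abelian_groupI)
    fix x assume x: "x \<in> carrier ?R"
    then have "\<ominus>\<^bsub>M\<^esub> x \<in> carrier ?R" by (simp add: C M.smult_r_minus psi_CP)
    then show "\<exists>y\<in>carrier ?R. y \<oplus>\<^bsub>?R\<^esub> x = \<zero>\<^bsub>?R\<^esub>"
      using x by (intro bexI[of _ "\<ominus>\<^bsub>M\<^esub> x"]) (simp_all add: C Res_simps M.l_neg)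
  qed (simp_all add: C Res_simps M.smult_r_distr M.smult_r_null psi_CP M.a_ac)
  interpret R: abelian_group ?R by (rule ab)
  show ?thesis
  proof
    fix a x assume a: "a \<in> carrier (CP n m)" and x: "x \<in> carrier ?R"
    then have xM: "x \<in> carrier M" by (simp add: C)
    show "a \<odot>\<^bsub>?R\<^esub> x \<in> carrier ?R"
      using xM M.smult_assoc[OF psi_CP psi_CP xM, of i "e_elt n m" i a] px[OF a]
      by (simp add: C Res_simps M.smult_closed psi_CP)
    show "(a \<oplus>\<^bsub>CP n m\<^esub> b) \<odot>\<^bsub>?R\<^esub> x = a \<odot>\<^bsub>?R\<^esub> x \<oplus>\<^bsub>?R\<^esub> b \<odot>\<^bsub>?R\<^esub> x" for b
      using M.smult_l_distr[OF psi_CP psi_CP xM, of i a i b]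
        by (simp add: Res_simps CP_simps psi_add[OF i])
    show "(a \<otimes>\<^bsub>CP n m\<^esub> b) \<odot>\<^bsub>?R\<^esub> x = a \<odot>\<^bsub>?R\<^esub> (b \<odot>\<^bsub>?R\<^esub> x)" for b
      using M.smult_assoc[OF psi_CP psi_CP xM, of i a i b] by (simp add: Res_simps psi_mult[OF i])
    show "a \<odot>\<^bsub>?R\<^esub> (x \<oplus>\<^bsub>?R\<^esub> y) = a \<odot>\<^bsub>?R\<^esub> x \<oplus>\<^bsub>?R\<^esub> a \<odot>\<^bsub>?R\<^esub> y" if "y \<in> carrier ?R" for y
      using that xM by (simp add: C Res_simps M.smult_r_distr psi_CP)
  next
    fix x assume "x \<in> carrier ?R"
    then show "\<one>\<^bsub>CP n m\<^esub> \<odot>\<^bsub>?R\<^esub> x = x" by (simp add: C Res_simps CP_simps)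
  qed
qed

text \<open>Elements supported in column \<open>V\<close> have only rows with the colours of
  \<open>V\<close>. None of these rows ends in \<open>i\<close>, so the projection defining the
  restriction kills them.\<close>

lemma Res_zero:
  assumes M: "cyclic_at n (Suc m) V M w" and i: "i \<le> n" "i \<notin># mset V"
  shows "carrier (Res n i (Suc m) M) = {\<zero>\<^bsub>Res n i (Suc m) M\<^esub>}"
proof -
  interpret M: cyclic n "Suc m" V M w by (rule cyclic.intro[OF M])
  let ?p = "psi n i (Suc m) (e_elt n m)"
  have "?p \<odot>\<^bsub>M\<^esub> v = \<zero>\<^bsub>M\<^esub>" if v: "v \<in> carrier M" for v
  proof -
    obtain y where y: "y \<in> carrier (CP n (Suc m))" "v = y \<odot>\<^bsub>M\<^esub> w" using M.gen[OF v] by blast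
    have "(?p \<otimes>\<^bsub>CP n (Suc m)\<^esub> y) \<otimes>\<^bsub>CP n (Suc m)\<^esub> munit V V = 0"
    proof (rule coef_eqI_Suc[OF CP_mult_closed CP_zero])
      fix S T a b assume A: "S \<in> colorings n m" "T \<in> colorings n m" "a \<le> n" "b \<le> n"
        "mset (S @ [a]) = mset (T @ [b])"
      have Sa: "S @ [a] \<in> colorings n (Suc m)" "T @ [b] \<in> colorings n (Suc m)"
        using A by (simp_all add: colorings_snoc)
      show "coef n (Suc m) ((?p \<otimes>\<^bsub>CP n (Suc m)\<^esub> y) \<otimes>\<^bsub>CP n (Suc m)\<^esub> munit V V) (S @ [a]) (T @ [b]) =
        coef n (Suc m) 0 (S @ [a]) (T @ [b])"
      proof (cases "V = T @ [b]")
        case True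
        then have mV: "mset (S @ [a]) = mset V" using A by simp
        have "a \<in># mset (S @ [a])" by simp
        then have "a \<noteq> i" using i(2) unfolding mV by blast
        then show ?thesis
          unfolding coef_munit_mult_right[OF M.T M.T refl Sa A(5)]
          using coef_psi_e_mult[OF i(1) A(1,3) M.T mV] \<open>a \<noteq> i\<close> by (simp add: coef_zero)
      next
        case False
        then show ?thesis
          unfolding coef_munit_mult_right[OF M.T M.T refl Sa A(5)] by (simp add: coef_zero)
      qed
    qed
    then have "(?p \<otimes>\<^bsub>CP n (Suc m)\<^esub> y) \<odot>\<^bsub>M\<^esub> w = \<zero>\<^bsub>M\<^esub>"
      using M.smult_zero_iff[OF CP_mult_closed] by simp
    then show ?thesis unfolding y(2) M.smult_assoc[OF psi_CP y(1) M.w] .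
  qed
  then show ?thesis
    unfolding Res_carrier[OF M.left_module_axioms i(1)] Res_simps by auto
qed

text \<open>After moving the generator to the colouring \<open>U @ [i]\<close>, it is fixed by the
  projection and lies in the restriction. What remains to be shown is that elements of the image of
  \<open>psi\<close> suffice to generate.\<close>

lemma cyclic_Res:
  assumes M: "cyclic_at n (Suc m) V M w" and i: "i \<le> n" and U: "U \<in> colorings n m"
    and V: "mset V = add_mset i (mset U)"
  shows "\<exists>w'. cyclic_at n m U (Res n i (Suc m) M) w'"
proof -
  let ?V = "U @ [i]" and ?p = "psi n i (Suc m) (e_elt n m)" and ?R = "Res n i (Suc m) M"
  have Vc: "?V \<in> colorings n (Suc m)" using U i by (simp add: colorings_snoc)
  interpret M0: cyclic n "Suc m" V M w by (rule cyclic.intro[OF M])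
  obtain w' where w': "cyclic_at n (Suc m) ?V M w'"
    using M0.change_T[OF Vc] V by auto
  interpret M: cyclic n "Suc m" ?V M w' by (rule cyclic.intro[OF w'])
  have UU: "munit U U \<in> carrier (CP n m)" by (rule munit_CP[OF U U])
  have u: "munit ?V ?V = psi n i (Suc m) (munit U U)"
    by (rule psi_munit[OF i U U refl, symmetric])
  have "?p \<odot>\<^bsub>M\<^esub> w' = ?p \<odot>\<^bsub>M\<^esub> (munit ?V ?V \<odot>\<^bsub>M\<^esub> w')" by (simp add: M.Tw)
  also have "\<dots> = (?p \<otimes>\<^bsub>CP n (Suc m)\<^esub> munit ?V ?V) \<odot>\<^bsub>M\<^esub> w'"
    by (rule M0.smult_assoc[OF psi_CP M.mT M.w, symmetric])
  also have "?p \<otimes>\<^bsub>CP n (Suc m)\<^esub> munit ?V ?V = munit ?V ?V"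
    unfolding u psi_mult[OF i, symmetric] by (simp add: CP_one UU)
  finally have pw: "?p \<odot>\<^bsub>M\<^esub> w' = w'" by (simp add: M.Tw)
  have gen: "\<exists>x\<in>carrier (CP n m). v = x \<odot>\<^bsub>?R\<^esub> w'" if v: "v \<in> carrier ?R" for v
  proof -
    have vM: "v \<in> carrier M" "?p \<odot>\<^bsub>M\<^esub> v = v" using v
      by (simp_all add: Res_carrier[OF M0.left_module_axioms i])
    obtain y where y: "y \<in> carrier (CP n (Suc m))" "v = y \<odot>\<^bsub>M\<^esub> w'" using M.gen[OF vM(1)] by blast
    \<comment> \<open>Only column \<open>U @ [i]\<close> of \<open>y\<close> acts on
      \<open>w'\<close>, and the projection keeps its rows ending in \<open>i\<close>; removing
      \<open>i\<close> from these rows and from the column gives \<open>x\<close>.\<close>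
    define x where "x = (\<lambda>d. \<Sum>S\<in>col_class n m U. scale (coef n (Suc m) y (S @ [i]) ?V) (munit S U) d)"
    have x: "x \<in> carrier (CP n m)"
      unfolding x_def by (rule CP_sum) (use U in \<open>auto simp: col_class_def intro: scale_CP munit_CP\<close>)
    have hx: "coef n m x S B = of_bool (U = B) * coef n (Suc m) y (S @ [i]) ?V"
      if SB: "S \<in> colorings n m" "mset S = mset B" for S B
    proof -
      have "coef n m x S B = (\<Sum>S'\<in>col_class n m U. (coef n (Suc m) y (S' @ [i]) ?V *
        of_bool (U = B)) * of_bool (S' = S))"
        unfolding x_def coef_sum
      proof (rule sum.cong[OF refl])
        fix S' assume "S' \<in> col_class n m U"
        then have "S' \<in> colorings n m" "mset S' = mset U" by (auto simp: col_class_def)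
        then show "coef n m (scale (coef n (Suc m) y (S' @ [i]) ?V) (munit S' U)) S B =
          (coef n (Suc m) y (S' @ [i]) ?V * of_bool (U = B)) * of_bool (S' = S)"
          using coef_munit[OF _ U _ SB(2), of S'] by (auto simp: coef_scale)
      qed
      also have "\<dots> = (coef n (Suc m) y (S @ [i]) ?V * of_bool (U = B)) * of_bool (S \<in> col_class n m U)"
        by (simp only: sum_of_bool_delta finite_col_class)
      finally show ?thesis using SB by (auto simp: col_class_def)
    qed
    have "(?p \<otimes>\<^bsub>CP n (Suc m)\<^esub> y) \<otimes>\<^bsub>CP n (Suc m)\<^esub> munit ?V ?V = psi n i (Suc m) x"
    proof (rule coef_eqI_Suc[OF CP_mult_closed psi_CP])
      fix S T a b assume A: "S \<in> colorings n m" "T \<in> colorings n m" "a \<le> n" "b \<le> n"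
        "mset (S @ [a]) = mset (T @ [b])"
      have Sa: "S @ [a] \<in> colorings n (Suc m)" "T @ [b] \<in> colorings n (Suc m)"
        using A by (simp_all add: colorings_snoc)
      have L: "coef n (Suc m) ((?p \<otimes>\<^bsub>CP n (Suc m)\<^esub> y) \<otimes>\<^bsub>CP n (Suc m)\<^esub> munit ?V ?V) (S @ [a]) (T @ [b]) =
        coef n (Suc m) (?p \<otimes>\<^bsub>CP n (Suc m)\<^esub> y) (S @ [a]) ?V * of_bool (?V = T @ [b])"
        by (rule coef_munit_mult_right[OF Vc Vc refl Sa A(5)])
      have R: "coef n (Suc m) (psi n i (Suc m) x) (S @ [a]) (T @ [b]) = of_bool (a = i \<and> b = i) *
        coef n m x S T"
        by (rule coef_psi[OF A i])
      show "coef n (Suc m) ((?p \<otimes>\<^bsub>CP n (Suc m)\<^esub> y) \<otimes>\<^bsub>CP n (Suc m)\<^esub> munit ?V ?V) (S @ [a]) (T @ [b]) =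
        coef n (Suc m) (psi n i (Suc m) x) (S @ [a]) (T @ [b])"
      proof (cases "?V = T @ [b]")
        case True
        then have eq: "U = T" "b = i" by auto
        have "mset (S @ [a]) = mset ?V" using A True by simp
        note pe = coef_psi_e_mult[OF i A(1,3) Vc this, of y]
        show ?thesis
        proof (cases "a = i")
          case ai: True
          have "mset S = mset T" using A(5) eq ai by simp
          note hx' = hx[OF A(1) this]
          show ?thesis unfolding L R pe hx' using ai eq by simp
        qed (simp add: L R pe)
      next
        case False
        have "of_bool (a = i \<and> b = i) * coef n m x S T = 0"
        proof (cases "a = i \<and> b = i")
          case True
          then have "mset S = mset T" "U \<noteq> T" using A False by auto
          then show ?thesis using hx[OF A(1), of T] by simp
        qed simp
        then show ?thesis unfolding L R using False by (simp only: of_bool_def if_False mult_zero_right)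
      qed
    qed
    then have "psi n i (Suc m) x \<odot>\<^bsub>M\<^esub> w' = (?p \<otimes>\<^bsub>CP n (Suc m)\<^esub> y) \<odot>\<^bsub>M\<^esub> w'"
      using M.smult_right_T[OF CP_mult_closed] by metis
    also have "\<dots> = v" unfolding M0.smult_assoc[OF psi_CP y(1) M.w] y(2)[symmetric] by (rule vM(2))
    finally show ?thesis using x by (auto simp: Res_simps)
  qed
  have "cyclic_at n m U ?R w'"
    unfolding cyclic_at_def
    using left_module_Res[OF M0.left_module_axioms i] U M.w pw M.w0 M.Tw gen
    by (simp add: Res_simps u Res_carrier[OF M0.left_module_axioms i])
  then show ?thesis by blast
qed

section \<open>The crystal of simple modules\<close>

lemma iso_class_eq:
  assumes M: "left_module (CP n m) M" and iso: "modules_isomorphic (CP n m) M N"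
  shows "iso_class n m M = iso_class n m N"
  unfolding iso_class_def
  using modules_isomorphic_trans[OF iso] modules_isomorphic_trans[OF modules_isomorphic_sym[OF M iso]] by blast

definition W_class :: "nat \<Rightarrow> nat \<Rightarrow> nat list \<Rightarrow> rook_module set" where
  "W_class n m T = iso_class n m (W_col n m T)"

lemma cyclic_iso_class:
  assumes "cyclic_at n m T M w"
  shows "iso_class n m M = W_class n m T"
proof -
  interpret cyclic n m T M w by (rule cyclic.intro[OF assms])
  show ?thesis unfolding W_class_def by (rule iso_class_eq[OF left_module_axioms W_iso])
qed

lemma W_in_W_class:
  assumes T: "T \<in> colorings n m"
  shows "W_col n m T \<in> W_class n m T"
proof -
  interpret cyclic n m T "W_col n m T" "munit T T" by (rule cyclic.intro[OF cyclic_at_W[OF T]])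
  show ?thesis unfolding W_class_def iso_class_def using findim iso_W by blast
qed

lemma W_class_cyclic:
  assumes T: "T \<in> colorings n m" and M: "M \<in> W_class n m T"
  shows "\<exists>w. cyclic_at n m T M w"
proof (rule cyclic_at_iso[OF cyclic_at_W[OF T]])
  show "modules_isomorphic (CP n m) (W_col n m T) M" "left_module (CP n m) M"
    using M by (auto simp: W_class_def iso_class_def findim_module_def)
qed

text \<open>Equal classes would make \<open>W_col n m T\<close> cyclic at \<open>T'\<close> as well,
  which \<open>other_T\<close> excludes for different multisets; the converse is
  \<open>change_T\<close>.\<close>

lemma W_class_eq_iff:
  assumes T: "T \<in> colorings n m" and T': "T' \<in> colorings n m"
  shows "W_class n m T = W_class n m T' \<longleftrightarrow> mset T = mset T'"
proof
  interpret cyclic n m T "W_col n m T" "munit T T" by (rule cyclic.intro[OF cyclic_at_W[OF T]])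
  show "mset T = mset T'" if eq: "W_class n m T = W_class n m T'"
  proof (rule ccontr)
    assume "mset T \<noteq> mset T'"
    moreover obtain w where w: "cyclic_at n m T' (W_col n m T) w"
      using W_class_cyclic[OF T'] W_in_W_class[OF T] eq by blast
    ultimately show False using other_T[OF T', of w] by (auto simp: cyclic_at_def)
  qed
  show "W_class n m T = W_class n m T'" if "mset T = mset T'"
    using cyclic_iso_class[OF change_T[OF T']] that by (simp add: W_class_def)
qed

lemma simple_classes_W_class: "simple_classes n m = W_class n m ` colorings n m"
proof (rule equalityI; rule subsetI)
  fix C assume "C \<in> simple_classes n m"
  then obtain M :: rook_module where M: "C = iso_class n m M" "irreducible_module (CP n m) M"
    unfolding simple_classes_def by blast
  obtain T w where c: "cyclic_at n m T M w" using irreducible_cyclic[OF M(2)] by blast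
  then have "T \<in> colorings n m" by (simp add: cyclic_at_def)
  then show "C \<in> W_class n m ` colorings n m" using cyclic_iso_class[OF c] M(1) by blast
next
  fix C assume "C \<in> W_class n m ` colorings n m"
  then obtain T where C: "T \<in> colorings n m" "C = iso_class n m (W_col n m T)"
    by (auto simp: W_class_def)
  interpret cyclic n m T "W_col n m T" "munit T T" by (rule cyclic.intro[OF cyclic_at_W[OF C(1)]])
  show "C \<in> simple_classes n m"
    unfolding simple_classes_def using C(2) findim irreducible by blast
qed

text \<open>\<open>the_elem\<close> needs a singleton, so the value is computed for every
  representative: induction appends colour \<open>b\<close>, restriction removes colour
  \<open>a\<close>. If \<open>a\<close> does not occur, \<open>T'\<close> may be any
  colouring.\<close>

lemma induced_map_Res_Ind:
  assumes T: "T \<in> colorings n m" and a: "a \<le> n" and b: "b \<le> n" and ab: "a \<noteq> b"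
    and T': "T' \<in> colorings n m" and mT': "a \<in># mset T \<Longrightarrow> mset T' = add_mset b (mset T - {#a#})"
  shows "induced_map n m (\<lambda>M. Res n a (m + 1) (Ind n b (m + 1) M)) (W_class n m T) =
    (if a \<in># mset T then Some (W_class n m T') else None)"
proof -
  let ?F = "\<lambda>M :: rook_module. Res n a (m + 1) (Ind n b (m + 1) M)"
  let ?g = "\<lambda>M. if carrier (?F M) = {\<zero>\<^bsub>?F M\<^esub>} then None else Some (iso_class n m (?F M))"
  have "?g M = (if a \<in># mset T then Some (W_class n m T') else None)" if M: "M \<in> W_class n m T" for M
  proof -
    obtain w where w: "cyclic_at n m T M w" using W_class_cyclic[OF T M] by blast
    obtain w' where w': "cyclic_at n (Suc m) (T @ [b]) (Ind n b (Suc m) M) w'"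
      using cyclic_Ind[OF w b] by blast
    show ?thesis
    proof (cases "a \<in># mset T")
      case True
      have "mset (T @ [b]) = add_mset a (mset T')"
        using mT'[OF True] True by (simp add: add_mset_commute[of a b])
      then obtain u where u: "cyclic_at n m T' (Res n a (Suc m) (Ind n b (Suc m) M)) u"
        using cyclic_Res[OF w' a T'] by blast
      then have "carrier (?F M) \<noteq> {\<zero>\<^bsub>?F M\<^esub>}" by (auto simp: cyclic_at_def)
      then show ?thesis using True cyclic_iso_class[OF u] by simp
    next
      case False
      \<comment> \<open>Here \<open>a \<noteq> b\<close> is essential: the appended colour must not
        be the one that is removed.\<close>
      then have "a \<notin># mset (T @ [b])" using ab by simp
      then have "carrier (?F M) = {\<zero>\<^bsub>?F M\<^esub>}" using Res_zero[OF w' a] by simp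
      then show ?thesis using False by simp
    qed
  qed
  then have "?g ` W_class n m T = {if a \<in># mset T then Some (W_class n m T') else None}"
    using W_in_W_class[OF T] by (auto simp: image_iff)
  then show ?thesis by (simp add: induced_map_def)
qed

text \<open>The colouring whose colour classes are consecutive intervals of lengths
  \<open>\<mu> 0, \<mu> 1, ...\<close>; it identifies \<open>W_std\<close> as a
  \<open>W_col\<close>. The colours are those below \<open>N\<close>, so \<open>N = Suc n\<close> is
  used.\<close>

definition intervals_list :: "(nat \<Rightarrow> nat) \<Rightarrow> nat \<Rightarrow> nat list" where
  "intervals_list \<mu> N = concat (map (\<lambda>k. replicate (\<mu> k) k) [0..<N])"

lemma intervals_list_Suc: "intervals_list \<mu> (Suc N) = intervals_list \<mu> N @ replicate (\<mu> N) N"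
  by (simp add: intervals_list_def)

lemma length_intervals_list: "length (intervals_list \<mu> N) = (\<Sum>j<N. \<mu> j)"
  by (induction N) (simp_all add: intervals_list_Suc, simp add: intervals_list_def)

lemma set_intervals_list: "set (intervals_list \<mu> N) \<subseteq> {..<N}"
  by (auto simp: intervals_list_def)

lemma count_intervals_list: "count (mset (intervals_list \<mu> N)) k = (if k < N then \<mu> k else 0)"
  by (induction N) (auto simp: intervals_list_Suc, simp add: intervals_list_def)

lemma intervals_list_positions:
  "k < N \<Longrightarrow> {j. j < (\<Sum>i<N. \<mu> i) \<and> intervals_list \<mu> N ! j = k} = {(\<Sum>j<k. \<mu> j)..<(\<Sum>j\<le>k. \<mu> j)}"
proof (induction N)
  case (Suc N)
  let ?l = "\<Sum>i<N. \<mu> i"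
  have len: "length (intervals_list \<mu> N) = ?l" by (rule length_intervals_list)
  have low: "intervals_list \<mu> N ! j < N" if "j < ?l" for j
    using subsetD[OF set_intervals_list nth_mem[of j "intervals_list \<mu> N"]] that len by simp
  have nth: "intervals_list \<mu> (Suc N) ! j = (if j < ?l then intervals_list \<mu> N ! j else N)"
    if "j < (\<Sum>i<Suc N. \<mu> i)" for j
    using that by (auto simp: intervals_list_Suc nth_append len)
  show ?case
  proof (cases "k = N")
    case True
    have "j < (\<Sum>i<Suc N. \<mu> i) \<and> intervals_list \<mu> (Suc N) ! j = N \<longleftrightarrow> j \<in> {?l..<(\<Sum>i<Suc N. \<mu> i)}" for j
      using low[of j] nth[of j] by (cases "j < ?l") auto
    then show ?thesis unfolding True lessThan_Suc_atMost by blast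
  next
    case False
    then have "k < N" using Suc.prems by simp
    have "{j. j < (\<Sum>i<Suc N. \<mu> i) \<and> intervals_list \<mu> (Suc N) ! j = k} =
      {j. j < ?l \<and> intervals_list \<mu> N ! j = k}"
    proof (intro Collect_cong)
      fix j
      show "j < (\<Sum>i<Suc N. \<mu> i) \<and> intervals_list \<mu> (Suc N) ! j = k \<longleftrightarrow> j < ?l \<and> intervals_list \<mu> N ! j = k"
        using nth[of j] False by (cases "j < ?l") auto
    qed
    then show ?thesis using Suc.IH[OF \<open>k < N\<close>] by simp
  qed
qed simp

lemma W_std_W:
  assumes "(\<Sum>j\<le>n. \<mu> j) = m"
  shows "W_std n m \<mu> = W_col n m (intervals_list \<mu> (Suc n))" "intervals_list \<mu> (Suc n) \<in> colorings n m"
proof -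
  have s: "(\<Sum>j<Suc n. \<mu> j) = m" using assms by (simp add: lessThan_Suc_atMost)
  show "intervals_list \<mu> (Suc n) \<in> colorings n m"
    using length_intervals_list[of \<mu> "Suc n"] set_intervals_list[of \<mu> "Suc n"] s
    by (auto simp: colorings_def)
  show "W_std n m \<mu> = W_col n m (intervals_list \<mu> (Suc n))"
    unfolding W_std_def W_col_def
    by (rule W_module_cong) (use intervals_list_positions[of _ "Suc n" \<mu>] s in auto)
qed

text \<open>Uniqueness comes from \<open>W_class_eq_iff\<close>: the class fixes the multiset, hence
  \<open>\<mu>\<close> on \<open>{..n}\<close>, and the support condition fixes the remaining
  values.\<close>

lemma multiplicities_W_class:
  assumes T: "T \<in> colorings n m"
  shows "multiplicities n m (W_class n m T) = count (mset T)"
  unfolding multiplicities_def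
proof (rule the_equality)
  have sz: "(\<Sum>j\<le>n. count (mset T) j) = m"
  proof -
    have "m = size (mset T)" using colorings_length[OF T] by simp
    also have "\<dots> = (\<Sum>j\<in>set_mset (mset T). count (mset T) j)" by (rule size_multiset_overloaded_eq)
    also have "\<dots> = (\<Sum>j\<le>n. count (mset T) j)"
      by (rule sum.mono_neutral_left) (use T in \<open>auto simp: colorings_def count_eq_zero_iff\<close>)
    finally show ?thesis by simp
  qed
  have big: "count (mset T) j = 0" if "j > n" for j
    using T that by (auto simp: colorings_def count_eq_zero_iff)
  let ?L = "\<lambda>\<mu>. intervals_list \<mu> (Suc n)"
  have eq: "mset (?L \<mu>) = mset T \<longleftrightarrow> \<mu> = count (mset T)" if "\<forall>j>n. \<mu> j = 0" for \<mu>
  proof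
    assume *: "mset (?L \<mu>) = mset T"
    show "\<mu> = count (mset T)"
    proof
      fix k show "\<mu> k = count (mset T) k"
        using count_intervals_list[of \<mu> "Suc n" k] that unfolding * by (cases "k < Suc n") auto
    qed
  next
    assume "\<mu> = count (mset T)"
    then show "mset (?L \<mu>) = mset T"
      using that by (intro multiset_eqI) (auto simp: count_intervals_list)
  qed
  show "(\<forall>j>n. count (mset T) j = 0) \<and> (\<Sum>j\<le>n. count (mset T) j) = m \<and>
     W_class n m T = iso_class n m (W_std n m (count (mset T)))"
    using big sz W_std_W[OF sz] W_class_eq_iff[OF T W_std_W(2)[OF sz]] eq[of "count (mset T)"]
    by (simp add: W_class_def)
  fix \<mu> assume mu: "(\<forall>j>n. \<mu> j = 0) \<and> (\<Sum>j\<le>n. \<mu> j) = m \<and> W_class n m T = iso_class n m (W_std n m \<mu>)"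
  then have s: "(\<Sum>j\<le>n. \<mu> j) = m" by simp
  have "W_class n m T = W_class n m (?L \<mu>)" using mu W_std_W(1)[OF s] by (simp add: W_class_def)
  then have "mset (?L \<mu>) = mset T" using W_class_eq_iff[OF T W_std_W(2)[OF s]] by simp
  then show "\<mu> = count (mset T)" using eq mu by simp
qed

text \<open>The sorted list is only a choice of a colouring with the given multiset; by
  \<open>g_eq\<close> every other choice gives the same class.\<close>

lemma crystal_iso_simple:
  "crystal_iso n (\<lambda>M. W_class n m (sorted_list_of_multiset M)) (mset_crystal n m) (simple_crystal n m)"
proof -
  define g where "g M = W_class n m (sorted_list_of_multiset M)" for M
  have elts: "elts (mset_crystal n m) = {M. size M = m \<and> set_mset M \<subseteq> {..n}}"
    by (simp add: mset_crystal_def)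
  have col: "sorted_list_of_multiset M \<in> colorings n m" if "M \<in> elts (mset_crystal n m)" for M
    using that by (auto simp: elts colorings_def size_mset[symmetric] simp del: size_mset)
  have g_eq: "g (mset T) = W_class n m T" if T: "T \<in> colorings n m" for T
  proof -
    have "mset T \<in> elts (mset_crystal n m)" using T by (simp add: elts colorings_def)
    then show ?thesis
      unfolding g_def W_class_eq_iff[OF col[OF \<open>mset T \<in> elts (mset_crystal n m)\<close>] T] by simp
  qed
  have bij: "bij_betw g (elts (mset_crystal n m)) (elts (simple_crystal n m))"
    unfolding bij_betw_def
  proof
    show "inj_on g (elts (mset_crystal n m))"
      by (rule inj_onI) (simp add: g_def W_class_eq_iff[OF col col])
    have "W_class n m T \<in> g ` elts (mset_crystal n m)" if "T \<in> colorings n m" for T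
      using g_eq[OF that] that by (auto simp: elts colorings_def image_iff intro!: exI[of _ "mset T"])
    moreover have "g M \<in> W_class n m ` colorings n m" if "M \<in> elts (mset_crystal n m)" for M
      using col[OF that] by (simp add: g_def)
    ultimately show "g ` elts (mset_crystal n m) = elts (simple_crystal n m)"
      unfolding simple_crystal_def crystal.simps simple_classes_W_class by blast
  qed
  \<comment> \<open>One computation serves both operators: \<open>(a, b)\<close> is
    \<open>(i, i - 1)\<close> for \<open>etil\<close> and \<open>(i - 1, i)\<close> for
    \<open>ftil\<close>.\<close>
  have map: "induced_map n m (\<lambda>M. Res n a (m + 1) (Ind n b (m + 1) M)) (g M) =
      map_option g (if a \<in># M then Some (add_mset b (M - {#a#})) else None)"
    if M: "M \<in> elts (mset_crystal n m)" and ab: "a \<le> n" "b \<le> n" "a \<noteq> b" for M a b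
  proof -
    \<comment> \<open>If \<open>a\<close> does not occur, \<open>M\<close> itself is the default, so
      that \<open>?M'\<close> is a multiset of the right size in either case.\<close>
    let ?T = "sorted_list_of_multiset M" and ?M' = "if a \<in># M then add_mset b (M - {#a#}) else M"
    have M': "?M' \<in> elts (mset_crystal n m)"
    proof (cases "a \<in># M")
      case True
      then obtain M0 where "M = add_mset a M0" by (metis mset_add)
      then show ?thesis using M ab by (simp add: elts)
    qed (use M in simp)
    have "induced_map n m (\<lambda>M. Res n a (m + 1) (Ind n b (m + 1) M)) (g M) =
      (if a \<in># mset ?T then Some (W_class n m (sorted_list_of_multiset ?M')) else None)"
      unfolding g_def by (rule induced_map_Res_Ind[OF col[OF M] ab col[OF M']]) simp
    then show ?thesis by (simp add: g_def)
  qed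
  have "crystal_iso n g (mset_crystal n m) (simple_crystal n m)"
    unfolding crystal_iso_def
  proof (intro conjI ballI bij)
    fix M assume M: "M \<in> elts (mset_crystal n m)"
    have mult: "multiplicities n m (g M) = count M"
      using multiplicities_W_class[OF col[OF M]] by (simp add: g_def)
    show "wt (simple_crystal n m) (g M) = wt (mset_crystal n m) M"
      by (simp add: simple_crystal_def mset_crystal_def mset_wt_def mult)
    fix i assume i: "i \<in> {1..n}"
    show "eps (simple_crystal n m) i (g M) = eps (mset_crystal n m) i M"
      "phi (simple_crystal n m) i (g M) = phi (mset_crystal n m) i M"
      by (simp_all add: simple_crystal_def mset_crystal_def mult)
    have E: "E_functor n i m = (\<lambda>M. Res n i (m + 1) (Ind n (i - 1) (m + 1) M))"
      and F: "F_functor n i m = (\<lambda>M. Res n (i - 1) (m + 1) (Ind n i (m + 1) M))"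
      by (rule ext, simp add: E_functor_def F_functor_def)+
    show "etil (simple_crystal n m) i (g M) = map_option g (etil (mset_crystal n m) i M)"
      unfolding simple_crystal_def mset_crystal_def crystal.simps E
      by (rule map[OF M]) (use i in auto)
    show "ftil (simple_crystal n m) i (g M) = map_option g (ftil (mset_crystal n m) i M)"
      unfolding simple_crystal_def mset_crystal_def crystal.simps F
      by (rule map[OF M]) (use i in auto)
  qed
  then show ?thesis by (simp add: g_def[abs_def])
qed

theorem theorem4p3:
  fixes n m :: nat
  assumes "n \<ge> 1" and "m \<ge> 1"
  shows "gl_crystal n (simple_crystal n m) \<and>
    gl_crystal n (tableau_crystal n [m]) \<and>
    crystals_isomorphic n (simple_crystal n m) (tableau_crystal n [m])"
  using gl_crystal_transfer[OF gl_crystal_mset_crystal crystal_iso_simple]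
    gl_crystal_transfer[OF gl_crystal_mset_crystal crystal_iso_tableau[OF assms]]
    crystals_isomorphic_via[OF gl_crystal_mset_crystal crystal_iso_simple crystal_iso_tableau[OF assms]]
  by blast

end
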